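(* There is a deterministic algorithm which, given a permutation $t:[n]\to[n]$ (the text) and a permutation $\pi:[k]\to[k]$ (the pattern) with $n\ge k$, decides whether $t$ contains $\pi$ in time $n^{0.44k+o(k)}$.
   Context: $[n]=\{1,\dots,n\}$. A permutation $t:[n]\to[n]$ contains $\pi:[k]\to[k]$ if there are indices $1\le i_1<\dots<i_k\le n$ such that for all $1\le j,\ell\le k$, $t(i_j)<t(i_\ell)$ if and only if $\pi(j)<\pi(\ell)$; otherwise $t$ avoids $\pi$. The problem of deciding whether $t$ contains $\pi$ is called Permutation Pattern Matching. *)

theory Defs
  imports
    Complex_Main
    "HOL-Combinatorics.Permutations"
    "HOL-Library.Landau_Symbols"
    "HOL-Library.Log_Nat"
begin

definition contains_pattern :: "nat \<Rightarrow> (nat \<Rightarrow> nat) \<Rightarrow> nat \<Rightarrow> (nat \<Rightarrow> nat) \<Rightarrow> bool" where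
  "contains_pattern n t k \<pi> \<longleftrightarrow>
     (\<exists>i. strict_mono_on {1..k} i \<and> i ` {1..k} \<subseteq> {1..n} \<and>
          (\<forall>j\<in>{1..k}. \<forall>l\<in>{1..k}. t (i j) < t (i l) \<longleftrightarrow> \<pi> j < \<pi> l))"

text \<open>
  Deterministic algorithms are programs for a random access machine with logarithmic cost
  (the machine of Aho, Hopcroft and Ullman, with structured control flow instead of jumps).
  The memory is an infinite array of natural numbers; indirect addressing is available both for
  reading (\<open>Mem\<close>) and for writing (\<open>Store\<close>). Subtraction is truncated, and division is the integer
  division with \<open>x div 0 = 0\<close>. A condition holds iff its value is nonzero.
\<close>

type_synonym memory = "nat \<Rightarrow> nat"

datatype expr =
    Const nat
  | Mem expr
  | Add expr expr
  | Sub expr expr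
  | Mul expr expr
  | Quot expr expr

datatype prog =
    Skip
  | Store expr expr
  | Seq prog prog
  | If expr prog prog
  | While expr prog

fun val :: "expr \<Rightarrow> memory \<Rightarrow> nat" where
  "val (Const c) m = c"
| "val (Mem a) m = m (val a m)"
| "val (Add a b) m = val a m + val b m"
| "val (Sub a b) m = val a m - val b m"
| "val (Mul a b) m = val a m * val b m"
| "val (Quot a b) m = val a m div val b m"

text \<open>\<open>floorlog 2 x\<close> is the number of binary digits of \<open>x\<close>, which is \<open>0\<close> for \<open>x = 0\<close>.\<close>

definition len :: "nat \<Rightarrow> nat" where
  "len x = 1 + floorlog 2 x"

text \<open>
  Every operation is charged the length of its operands (including addresses) and of its result.
  Operands are themselves results of subexpressions, so it suffices to charge, at every node of
  the expression, the length of the value of that node.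
\<close>

fun expr_cost :: "expr \<Rightarrow> memory \<Rightarrow> nat" where
  "expr_cost (Const c) m = len c"
| "expr_cost (Mem a) m = expr_cost a m + len (val (Mem a) m)"
| "expr_cost (Add a b) m = expr_cost a m + expr_cost b m + len (val (Add a b) m)"
| "expr_cost (Sub a b) m = expr_cost a m + expr_cost b m + len (val (Sub a b) m)"
| "expr_cost (Mul a b) m = expr_cost a m + expr_cost b m + len (val (Mul a b) m)"
| "expr_cost (Quot a b) m = expr_cost a m + expr_cost b m + len (val (Quot a b) m)"

text \<open>
  \<open>exec p m T m'\<close>: started in memory \<open>m\<close>, the program \<open>p\<close> halts after time \<open>T\<close> with memory \<open>m'\<close>.
\<close>

inductive exec :: "prog \<Rightarrow> memory \<Rightarrow> nat \<Rightarrow> memory \<Rightarrow> bool" where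
  Skip: "exec Skip m 1 m"
| Store: "exec (Store a b) m (1 + expr_cost a m + expr_cost b m) (m(val a m := val b m))"
| Seq: "exec p m T m' \<Longrightarrow> exec q m' T' m'' \<Longrightarrow> exec (Seq p q) m (T + T') m''"
| IfTrue: "val a m \<noteq> 0 \<Longrightarrow> exec p m T m' \<Longrightarrow> exec (If a p q) m (1 + expr_cost a m + T) m'"
| IfFalse: "val a m = 0 \<Longrightarrow> exec q m T m' \<Longrightarrow> exec (If a p q) m (1 + expr_cost a m + T) m'"
| WhileTrue: "val a m \<noteq> 0 \<Longrightarrow> exec p m T m' \<Longrightarrow> exec (While a p) m' T' m'' \<Longrightarrow>
    exec (While a p) m (1 + expr_cost a m + T + T') m''"
| WhileFalse: "val a m = 0 \<Longrightarrow> exec (While a p) m (1 + expr_cost a m) m"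

lemma exec_deterministic:
  "exec p m T m' \<Longrightarrow> exec p m T' m'' \<Longrightarrow> T = T' \<and> m' = m''"
proof (induction arbitrary: T' m'' rule: exec.induct)
  case (Skip m)
  then show ?case by cases simp
next
  case (Store a b m)
  then show ?case by cases simp
next
  case (Seq p m T m1 q T1 m2)
  from Seq.prems obtain U U1 x where
    "T' = U + U1" "exec p m U x" "exec q x U1 m''" by cases
  with Seq.IH show ?case by metis
next
  case (IfTrue a m p T m' q)
  from IfTrue.prems IfTrue.hyps obtain U where
    "T' = 1 + expr_cost a m + U" "exec p m U m''" by cases simp_all
  with IfTrue.IH show ?case by metis
next
  case (IfFalse a m q T m' p)
  from IfFalse.prems IfFalse.hyps obtain U where
    "T' = 1 + expr_cost a m + U" "exec q m U m''" by cases simp_all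
  with IfFalse.IH show ?case by metis
next
  case (WhileTrue a m p T m1 T1 m2)
  from WhileTrue.prems WhileTrue.hyps(1) obtain U U1 x where
    "T' = 1 + expr_cost a m + U + U1" "exec p m U x" "exec (While a p) x U1 m''"
    by cases simp_all
  with WhileTrue.IH show ?case by metis
next
  case (WhileFalse a m p)
  from WhileFalse.prems WhileFalse.hyps show ?case by cases simp_all
qed

text \<open>
  The memory initially consists of the numbers
  \<open>n, k, t 1, \<dots>, t n, \<pi> 1, \<dots>, \<pi> k\<close>, followed by zeros.
\<close>

definition input :: "nat \<Rightarrow> (nat \<Rightarrow> nat) \<Rightarrow> nat \<Rightarrow> (nat \<Rightarrow> nat) \<Rightarrow> memory" where
  "input n t k \<pi> a =
     (if a = 0 then n
      else if a = 1 then k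
      else if a \<le> n + 1 then t (a - 1)
      else if a \<le> n + k + 1 then \<pi> (a - (n + 1))
      else 0)"

text \<open>The answer is read from cell \<open>0\<close> of the final memory.\<close>

definition accepting :: "memory \<Rightarrow> bool" where
  "accepting m \<longleftrightarrow> m 0 = 1"

definition rejecting :: "memory \<Rightarrow> bool" where
  "rejecting m \<longleftrightarrow> m 0 = 0"

end

theory Submission
  imports Defs "HOL-Library.Nat_Bijection" "HOL-Real_Asymp.Real_Asymp"
begin

text \<open>
  Embedding the pattern is a constraint satisfaction problem whose variables are the pattern
  elements and whose constraints only relate elements with consecutive positions or consecutive
  values; the constraint graph has maximum degree \<open>4\<close>. In such a graph on \<open>k\<close> vertices one can delete
  at most \<open>2k/5 + 3k/M\<close> vertices so that the remaining components have at most \<open>M\<close> vertices. Once the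
  deleted elements are placed (in at most \<open>n\<close> to the power \<open>0.44k\<close> ways, for \<open>M = 100\<close>), every
  component is treated on its own by brute force, and the sets involved are found by exhaustive
  search in time exponential in \<open>k\<close>, which is \<open>n\<close> to the power \<open>o(k)\<close>.

  For the deletion bound, let the excess of a vertex set be its number of edges minus its number
  of vertices, and consider the maximal excess of a subset. It is at most \<open>k\<close> in the beginning. First
  delete vertices that lower it by \<open>3\<close>, as long as there are any. If \<open>a\<close> vertices have been deleted,
  then at most \<open>k - 3a\<close> is left; moreover every vertex of degree \<open>4\<close> in a minimal subset of maximal
  excess then has two neighbours of degree \<open>2\<close>, so that at most \<open>(k - a)/2\<close> is left. Afterwards, in every
  connected part of excess at least \<open>2\<close> some vertex lowers the maximal excess by \<open>2\<close>, and parts of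
  smaller excess are almost trees, which are broken up cheaply.

  The exhaustive search is a closed term over the natural numbers with bounded sums and products,
  which is compiled to the machine.
\<close>

section \<open>Fragmentation of graphs of maximum degree 4\<close>

text \<open>Taking the maximum over subsets makes the excess blind to pendant trees and to tree
  components, which are cheap to break up, and supermodularity lets the effect of a deletion be read
  off inside a minimal maximiser. The bounds \<open>k - 3a\<close> and \<open>(k - a)/2\<close> meet
  at \<open>a = k/5\<close>, where both equal \<open>2k/5\<close>; the second phase needs half of
  that, so the worst case is \<open>k/5 + k/5\<close> deletions. The constant 0.44 leaves some slack
  over 2/5 + 3/100. The deleted set is only shown to exist: since the program tries all sets, no
  step of the graph argument has to be effective. The price, a factor \<open>4 ^ k\<close> for the
  choice of a set and of a part, is harmless because for \<open>2 \<le> k \<le> n\<close> the number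
  \<open>4 ^ k = k powr (k * ln 4 / ln k)\<close> is at most
  \<open>n powr (k * ln 4 / ln k)\<close>.\<close>

lemma obtain_max_card:
  assumes "finite R" "P A" "\<And>X. P X \<Longrightarrow> X \<subseteq> R"
  obtains X where "P X" "\<And>Y. P Y \<Longrightarrow> card Y \<le> card X"
proof -
  have "\<forall>X. P X \<longrightarrow> card X < Suc (card R)"
    using assms(1,3) by (auto simp: less_Suc_eq_le intro!: card_mono)
  then show ?thesis
    using ex_has_greatest_nat[of P A card "Suc (card R)"] assms(2) that by blast
qed

lemma obtain_min_card:
  fixes P :: "'a set \<Rightarrow> bool"
  assumes "P A" obtains X where "P X" "\<And>Y. P Y \<Longrightarrow> card X \<le> card Y"
  using ex_has_least_nat[of P A card] assms by blast

section \<open>Edge counts between vertex sets, and the excess\<close>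

locale sgraph =
  fixes E :: "'a \<Rightarrow> 'a \<Rightarrow> bool"
  assumes sym: "E u v \<Longrightarrow> E v u" and irrefl: "\<not> E u u"
begin

text \<open>Ordered pairs are counted: for disjoint sets this is the number of edges between them,
  while \<open>cut A A\<close> counts every edge twice, hence the \<open>div 2\<close> in
  \<open>excess\<close>. Integers are used because the excess of a tree is -1.\<close>

definition cut :: "'a set \<Rightarrow> 'a set \<Rightarrow> int" where
  "cut A B = (\<Sum>u\<in>A. \<Sum>v\<in>B. of_bool (E u v))"

definition excess :: "'a set \<Rightarrow> int" where
  "excess A = cut A A div 2 - int (card A)"

lemma cut_nonneg: "0 \<le> cut A B"
  unfolding cut_def by (intro sum_nonneg) auto

lemma cut_empty [simp]: "cut {} B = 0" "cut A {} = 0"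
  by (auto simp: cut_def)

lemma cut_commute: "cut A B = cut B A"
proof -
  have "E u v = E v u" for u v using sym by blast
  then show ?thesis unfolding cut_def by (subst sum.swap) simp
qed

lemma cut_self [simp]: "cut {v} {v} = 0"
  by (simp add: cut_def irrefl)

lemma cut_Un_left: "finite A \<Longrightarrow> finite B \<Longrightarrow> A \<inter> B = {} \<Longrightarrow> cut (A \<union> B) C = cut A C + cut B C"
  by (simp add: cut_def sum.union_disjoint)

lemma cut_Un_right: "finite A \<Longrightarrow> finite B \<Longrightarrow> A \<inter> B = {} \<Longrightarrow> cut C (A \<union> B) = cut C A + cut C B"
  by (metis cut_Un_left cut_commute)

lemma cut_mono: "finite A' \<Longrightarrow> finite B' \<Longrightarrow> A \<subseteq> A' \<Longrightarrow> B \<subseteq> B' \<Longrightarrow> cut A B \<le> cut A' B'"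
  using cut_Un_left[of A "A' - A" B'] cut_Un_right[of B "B' - B" A]
    cut_nonneg[of A "B' - B"] cut_nonneg[of "A' - A" B']
  by (simp add: finite_subset Un_absorb1)

lemma cut_sum_degrees: "finite A \<Longrightarrow> cut A B = (\<Sum>u\<in>A. cut {u} B)"
  by (simp add: cut_def)

lemma cut_edge: "finite A \<Longrightarrow> finite B \<Longrightarrow> u \<in> A \<Longrightarrow> v \<in> B \<Longrightarrow> E u v \<Longrightarrow> 1 \<le> cut A B"
  using cut_mono[of A B "{u}" "{v}"] by (simp add: cut_def)

lemma cut_posE:
  assumes "cut A B > 0" obtains u v where "u \<in> A" "v \<in> B" "E u v"
proof -
  have "\<exists>u\<in>A. \<exists>v\<in>B. E u v"
  proof (rule ccontr)
    assume "\<not> ?thesis"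
    then have "cut A B = 0" unfolding cut_def by (intro sum.neutral ballI) auto
    with assms show False by simp
  qed
  then show ?thesis using that by blast
qed

lemma cut_eq_0_iff: "finite A \<Longrightarrow> finite B \<Longrightarrow> cut A B = 0 \<longleftrightarrow> (\<forall>u\<in>A. \<forall>v\<in>B. \<not> E u v)"
  using cut_edge[of A B] cut_posE[of A B] cut_nonneg[of A B]
  by (metis dual_order.irrefl le_less not_one_le_zero)

lemma cut_le_card: "finite B \<Longrightarrow> cut {v} B \<le> int (card {u \<in> B. E v u})"
proof -
  have "{u \<in> B. E v u} = B \<inter> Collect (E v)" by blast
  then show "finite B \<Longrightarrow> ?thesis" by (simp add: cut_def)
qed

lemma cut_insert:
  assumes "finite A" "v \<notin> A" shows "cut (insert v A) (insert v A) = cut A A + 2 * cut {v} A"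
  using assms cut_Un_left[of "{v}" A "insert v A"] cut_Un_right[of "{v}" A "{v}"]
    cut_Un_right[of "{v}" A A] cut_commute[of A "{v}"] by simp

lemma even_cut: "finite A \<Longrightarrow> even (cut A A)"
  by (induction rule: finite_induct) (simp_all add: cut_insert)

lemma cut_excess: "finite A \<Longrightarrow> cut A A = 2 * (excess A + int (card A))"
  unfolding excess_def using even_cut[of A] by simp

lemma excess_empty [simp]: "excess {} = 0"
  by (simp add: excess_def)

lemma excess_Un:
  assumes "finite A" "finite B" "A \<inter> B = {}"
  shows "excess (A \<union> B) = excess A + excess B + cut A B"
proof -
  have "cut (A \<union> B) (A \<union> B) = cut A A + 2 * cut A B + cut B B"
    using assms by (simp add: cut_Un_left cut_Un_right cut_commute[of B A])
  with assms show ?thesis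
    using cut_excess[of A] cut_excess[of B] cut_excess[of "A \<union> B"]
    by (simp add: card_Un_disjoint)
qed

lemma excess_insert: "finite A \<Longrightarrow> v \<notin> A \<Longrightarrow> excess (insert v A) = excess A + cut {v} A - 1"
  using excess_Un[of "{v}" A] by (simp add: excess_def)

lemma excess_remove:
  assumes "finite A" "v \<in> A" shows "excess (A - {v}) = excess A - cut {v} A + 1"
proof -
  have "cut {v} A = cut {v} (A - {v})"
    using cut_Un_right[of "{v}" "A - {v}" "{v}"] assms by (simp add: insert_absorb)
  then show ?thesis using excess_insert[of "A - {v}" v] assms by (simp add: insert_absorb)
qed

lemma excess_split:
  assumes "finite B" "A \<subseteq> B" shows "excess B = excess A + excess (B - A) + cut A (B - A)"
proof -
  have "finite A" using assms finite_subset by blast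
  moreover have "A \<union> (B - A) = B" "A \<inter> (B - A) = {}" using assms by auto
  ultimately show ?thesis using excess_Un[of A "B - A"] assms by simp
qed

text \<open>Cardinalities cancel, and an edge inside \<open>A\<close> or inside \<open>B\<close> is
  counted equally often on both sides; edges between \<open>A - B\<close> and \<open>B - A\<close>
  appear only in \<open>A \<union> B\<close>.\<close>

lemma excess_supermodular:
  assumes "finite A" "finite B"
  shows "excess A + excess B \<le> excess (A \<union> B) + excess (A \<inter> B)"
proof -
  have "excess (A \<union> B) = excess A + excess (B - A) + cut A (B - A)"
    using excess_Un[of A "B - A"] assms by (simp add: Un_Diff_cancel)
  moreover have "excess B = excess (A \<inter> B) + excess (B - A) + cut (A \<inter> B) (B - A)"
    using excess_split[of B "A \<inter> B"] assms by (simp add: Diff_Int2 Diff_Int)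
  moreover have "cut (A \<inter> B) (B - A) \<le> cut A (B - A)"
    using assms by (intro cut_mono) auto
  ultimately show ?thesis by linarith
qed

text \<open>The empty set competes as well, so the value is never negative, and it is 0 for every
  forest.\<close>

definition max_excess :: "'a set \<Rightarrow> int" where
  "max_excess R = Max (excess ` Pow R)"

lemma excess_le_max: "finite R \<Longrightarrow> U \<subseteq> R \<Longrightarrow> excess U \<le> max_excess R"
  unfolding max_excess_def by (intro Max_ge) auto

lemma max_excess_nonneg: "finite R \<Longrightarrow> 0 \<le> max_excess R"
  using excess_le_max[of R "{}"] by simp

lemma max_excess_leI: "finite R \<Longrightarrow> (\<And>U. U \<subseteq> R \<Longrightarrow> excess U \<le> c) \<Longrightarrow> max_excess R \<le> c"
  unfolding max_excess_def by (subst Max_le_iff) auto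

lemma max_excess_witness:
  assumes "finite R" obtains U where "U \<subseteq> R" "excess U = max_excess R"
proof -
  have "max_excess R \<in> excess ` Pow R"
    unfolding max_excess_def using assms by (intro Max_in) auto
  then show ?thesis using that by auto
qed

lemma max_excess_separated:
  assumes "finite A" "finite B" "A \<inter> B = {}" "cut A B = 0"
  shows "max_excess A + max_excess B \<le> max_excess (A \<union> B)"
proof -
  obtain U where U: "U \<subseteq> A" "excess U = max_excess A" using max_excess_witness assms(1) by blast
  obtain W where W: "W \<subseteq> B" "excess W = max_excess B" using max_excess_witness assms(2) by blast
  have fin: "finite U" "finite W" using U W assms finite_subset by blast+
  have "excess (U \<union> W) = excess U + excess W + cut U W"
    using fin U W assms by (intro excess_Un) auto
  moreover have "excess (U \<union> W) \<le> max_excess (A \<union> B)" using U W assms by (intro excess_le_max) auto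
  ultimately show ?thesis using U W cut_nonneg[of U W] by linarith
qed

section \<open>Connected sets\<close>

text \<open>Cuts replace paths: what the arguments use is an edge leaving each proper nonempty part.
  The empty set counts as connected.\<close>

definition conn :: "'a set \<Rightarrow> bool" where
  "conn R \<longleftrightarrow> (\<forall>A. A \<subseteq> R \<longrightarrow> A \<noteq> {} \<longrightarrow> A \<noteq> R \<longrightarrow> 1 \<le> cut A (R - A))"

lemma connD: "conn R \<Longrightarrow> A \<subseteq> R \<Longrightarrow> A \<noteq> {} \<Longrightarrow> A \<noteq> R \<Longrightarrow> 1 \<le> cut A (R - A)"
  by (simp add: conn_def)

lemma not_connE:
  assumes "\<not> conn R" "finite R"
  obtains A where "A \<subseteq> R" "A \<noteq> {}" "A \<noteq> R" "cut A (R - A) = 0"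
proof -
  obtain A where "A \<subseteq> R" "A \<noteq> {}" "A \<noteq> R" "\<not> 1 \<le> cut A (R - A)"
    using assms by (auto simp: conn_def)
  then show ?thesis using that[of A] cut_nonneg[of A "R - A"] by auto
qed

text \<open>By connectivity the part grows to \<open>R\<close> one neighbour at a time; a new vertex
  costs 1 and brings at least one edge.\<close>

lemma excess_le_conn:
  assumes "finite R" "conn R" "A \<subseteq> R" "A \<noteq> {}"
  shows "excess A \<le> excess R"
  using assms(3,4)
proof (induction "card (R - A)" arbitrary: A rule: less_induct)
  case less
  show ?case
  proof (cases "A = R")
    case False
    then have "cut A (R - A) > 0" using connD[OF assms(2), of A] less.prems by auto
    then obtain u w where uw: "u \<in> A" "w \<in> R - A" "E u w" by (rule cut_posE)
    have fA: "finite A" using less.prems assms finite_subset by blast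
    have "1 \<le> cut {w} A" using uw fA sym by (intro cut_edge[of _ _ w u]) auto
    then have "excess A \<le> excess (insert w A)" using uw fA excess_insert[of A w] by simp
    also have "card (R - insert w A) < card (R - A)"
      using uw assms(1) by (intro psubset_card_mono) auto
    then have "excess (insert w A) \<le> excess R" using uw less.prems by (intro less.hyps) auto
    finally show ?thesis .
  qed simp
qed

lemma excess_conn_ge: "finite R \<Longrightarrow> conn R \<Longrightarrow> R \<noteq> {} \<Longrightarrow> excess R \<ge> -1"
  using excess_le_conn[of R "{SOME x. x \<in> R}"] by (simp add: excess_def some_in_eq)

lemma max_excess_conn:
  assumes "finite R" "conn R" shows "max_excess R = max 0 (excess R)"
proof (rule antisym)
  show "max_excess R \<le> max 0 (excess R)"
  proof (rule max_excess_leI[OF assms(1)])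
    fix U assume "U \<subseteq> R"
    then show "excess U \<le> max 0 (excess R)"
      using excess_le_conn[OF assms, of U] by (cases "U = {}") auto
  qed
  show "max 0 (excess R) \<le> max_excess R"
    using excess_le_max[OF assms(1), of R] max_excess_nonneg[OF assms(1)] by simp
qed

text \<open>Growing one part inside the complement of the other until they touch gains an edge.\<close>

lemma excess_disjoint_conn:
  assumes "finite R" "conn R" "A \<subseteq> R" "B \<subseteq> R" "A \<noteq> {}" "B \<noteq> {}" "A \<inter> B = {}"
  shows "excess A + excess B + 1 \<le> excess R"
proof -
  define P where "P X \<longleftrightarrow> A \<subseteq> X \<and> X \<subseteq> R - B \<and> excess A \<le> excess X" for X
  have "P A" "\<And>X. P X \<Longrightarrow> X \<subseteq> R" using assms unfolding P_def by auto
  with assms(1) obtain X where PX: "P X" and mx: "\<And>Y. P Y \<Longrightarrow> card Y \<le> card X"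
    using obtain_max_card[of R P A] by blast
  then have X: "A \<subseteq> X" "X \<subseteq> R - B" "excess A \<le> excess X" by (simp_all add: P_def)
  have fX: "finite X" "finite B"
    using X assms finite_subset[of X R] finite_subset[of B R] by auto
  have "1 \<le> cut X (R - X)" using X assms by (intro connD) auto
  then obtain u w where uw: "u \<in> X" "w \<in> R - X" "E u w" using cut_posE[of X "R - X"] by auto
  have "w \<in> B"
  proof (rule ccontr)
    assume nB: "w \<notin> B"
    have "1 \<le> cut {w} X" using uw fX sym by (intro cut_edge[of _ _ w u]) auto
    then have "excess X \<le> excess (insert w X)" using uw fX excess_insert[of X w] by simp
    then have "P (insert w X)" using X uw nB by (auto simp: P_def)
    from mx[OF this] show False using uw fX by simp
  qed
  then have "1 \<le> cut X B" using uw fX by (intro cut_edge[of _ _ u w]) auto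
  moreover have "excess (X \<union> B) = excess X + excess B + cut X B"
    using fX X by (intro excess_Un) auto
  moreover have "excess (X \<union> B) \<le> excess R"
    using assms X by (intro excess_le_conn) auto
  ultimately show ?thesis using X by linarith
qed

section \<open>Minimal sets of maximal excess\<close>

definition core :: "'a set \<Rightarrow> 'a set \<Rightarrow> bool" where
  "core R H \<longleftrightarrow> H \<subseteq> R \<and> excess H = max_excess R \<and>
     (\<forall>U. U \<subseteq> R \<longrightarrow> excess U = max_excess R \<longrightarrow> card H \<le> card U)"

lemma core_exists:
  assumes "finite R" obtains H where "core R H"
proof -
  obtain U where U: "U \<subseteq> R" "excess U = max_excess R" using max_excess_witness assms by blast
  define P where "P U \<longleftrightarrow> U \<subseteq> R \<and> excess U = max_excess R" for U
  have "P U" using U by (simp add: P_def)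
  then obtain H where "P H" "\<And>U. P U \<Longrightarrow> card H \<le> card U"
    using obtain_min_card[of P U] by blast
  then have "core R H" by (simp add: core_def P_def)
  then show ?thesis by (rule that)
qed

lemma core_finite: "finite R \<Longrightarrow> core R H \<Longrightarrow> finite H"
  by (auto simp: core_def intro: finite_subset)

lemma core_psubset:
  assumes "finite R" "core R H" "U \<subset> H" shows "excess U < excess H"
proof -
  have "finite H" using assms core_finite by blast
  then have "card U < card H" using assms by (intro psubset_card_mono)
  moreover have UR: "U \<subseteq> R" using assms(2,3) unfolding core_def by blast
  ultimately have "excess U \<noteq> max_excess R"
    using assms(2) unfolding core_def by (metis not_le)
  with excess_le_max[OF assms(1) UR] show ?thesis using assms(2) by (simp add: core_def)
qed

lemma core_degree:
  assumes "finite R" "core R H" "v \<in> H" shows "2 \<le> cut {v} H"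
proof -
  have "finite H" "H - {v} \<subset> H" using assms core_finite by blast+
  from core_psubset[OF assms(1,2) this(2)] excess_remove[OF this(1) assms(3)]
  show ?thesis by linarith
qed

text \<open>\<open>U \<union> H\<close> cannot exceed the maximum that \<open>H\<close> attains, so
  by supermodularity nothing is lost in passing to \<open>U \<inter> H\<close>. Hence deletions can
  be studied inside \<open>H\<close>.\<close>

lemma core_Int:
  assumes "finite R" "core R H" "U \<subseteq> R" shows "excess U \<le> excess (U \<inter> H)"
proof -
  have "finite U" "finite H" using assms finite_subset core_finite by blast+
  then have "excess U + excess H \<le> excess (U \<union> H) + excess (U \<inter> H)"
    by (rule excess_supermodular)
  moreover have "excess (U \<union> H) \<le> excess H"
    using excess_le_max[OF assms(1), of "U \<union> H"] assms by (auto simp: core_def)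
  ultimately show ?thesis by linarith
qed

text \<open>A best subset avoiding \<open>v\<close> loses nothing when restricted to
  \<open>H\<close>, where it is a proper subset of a minimal maximiser.\<close>

lemma core_remove:
  assumes "finite R" "core R H" "v \<in> H" shows "max_excess (R - {v}) < max_excess R"
proof -
  obtain U where U: "U \<subseteq> R - {v}" "excess U = max_excess (R - {v})"
    using max_excess_witness[of "R - {v}"] assms(1) by blast
  have "excess U \<le> excess (U \<inter> H)" using U assms by (intro core_Int[OF assms(1,2)]) auto
  also have "\<dots> < excess H" using U assms by (intro core_psubset[OF assms(1,2)]) auto
  finally show ?thesis using U assms by (simp add: core_def)
qed

text \<open>The handshake identity: degrees in \<open>H\<close> add up to twice the number of edges,
  which exceeds \<open>card H\<close> by the maximal excess.\<close>

lemma core_sum_degrees: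
  assumes "finite R" "core R H"
  shows "(\<Sum>v\<in>H. cut {v} H - 2) = 2 * max_excess R"
  using cut_sum_degrees[of H H] cut_excess[of H] core_finite[OF assms] assms
  by (simp add: sum_subtractf core_def)

text \<open>If the core fell apart, the excesses of the two parts would add up to the maximum, but
  inside the connected \<open>R\<close> they could be joined with the gain of an edge.\<close>

lemma core_conn:
  assumes "finite R" "core R H" "conn R" "max_excess R = excess R"
  shows "conn H"
proof (rule ccontr)
  assume "\<not> conn H"
  then obtain A where A: "A \<subseteq> H" "A \<noteq> {}" "A \<noteq> H" "cut A (H - A) = 0"
    using not_connE core_finite[OF assms(1,2)] by blast
  have H: "H \<subseteq> R" "excess H = max_excess R" using assms by (auto simp: core_def)
  have "excess H = excess A + excess (H - A)"
    using excess_split[of H A] A core_finite[OF assms(1,2)] by simp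
  moreover have "excess A + excess (H - A) + 1 \<le> excess R"
    using A H assms by (intro excess_disjoint_conn) auto
  ultimately show False using H assms by linarith
qed

text \<open>
  The set \<open>Q\<close> collects the vertices of \<open>H\<close> that have to go together with \<open>v\<close> (in essence, the
  trees left hanging after the removal of \<open>v\<close>); they have small degree.
\<close>

lemma core_vertex_residue:
  assumes "finite R" "core R H" "v \<in> H" "max_excess (R - {v}) \<ge> max_excess R - s"
  obtains U Q where "H = insert v (U \<union> Q)" "v \<notin> U" "v \<notin> Q" "U \<inter> Q = {}"
    "excess U \<ge> max_excess R - s"
    "(\<Sum>x\<in>Q. cut {x} H - 2) + cut Q U \<le> cut Q {v} + 2 * (s + 1 - cut {v} H)"
proof -
  have fH: "finite H" using assms core_finite by blast
  obtain U' where U': "U' \<subseteq> R - {v}" "excess U' = max_excess (R - {v})"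
    using max_excess_witness[of "R - {v}"] assms(1) by blast
  define U where "U = U' \<inter> H"
  define Q where "Q = H - {v} - U"
  have "excess U' \<le> excess U" unfolding U_def using U' assms by (intro core_Int[OF assms(1,2)]) auto
  then have exU: "excess U \<ge> max_excess R - s" using U' assms by simp
  have vU: "v \<notin> U" "v \<notin> Q" "U \<inter> Q = {}" using U' by (auto simp: U_def Q_def)
  have HUQ: "H = insert v (U \<union> Q)" using assms(3) by (auto simp: U_def Q_def)
  have fin: "finite U" "finite Q" using fH by (auto simp: U_def Q_def)
  have "H - {v} = Q \<union> U" using HUQ vU by auto
  then have 1: "excess Q + excess U + cut Q U = excess H - cut {v} H + 1"
    using excess_remove[OF fH assms(3)] excess_Un[of Q U] fin vU by (simp add: Int_commute)
  \<comment> \<open>Degrees in \<open>Q\<close> count the edges to \<open>v\<close> and to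
    \<open>U\<close> once and those inside \<open>Q\<close> twice. The last number is
    \<open>2 * (excess Q + card Q)\<close>, and \<open>1\<close> bounds \<open>excess Q\<close> by
    \<open>s + 1 - cut {v} H - cut Q U\<close>.\<close>
  have "cut Q H = cut Q (insert v (U \<union> Q))" using HUQ by simp
  also have "\<dots> = cut Q {v} + cut Q U + cut Q Q"
    using cut_Un_right[of "{v}" "U \<union> Q" Q] cut_Un_right[of U Q Q] fin vU by simp
  finally have "(\<Sum>x\<in>Q. cut {x} H) = cut Q {v} + cut Q U + cut Q Q"
    using cut_sum_degrees[of Q H] fin by simp
  then have 2: "(\<Sum>x\<in>Q. cut {x} H - 2) = cut Q {v} + cut Q U + 2 * excess Q"
    using cut_excess[of Q] fin by (simp add: sum_subtractf)
  have "excess H = max_excess R" using assms by (simp add: core_def)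
  then have "(\<Sum>x\<in>Q. cut {x} H - 2) + cut Q U \<le> cut Q {v} + 2 * (s + 1 - cut {v} H)"
    using 1 2 exU by (smt (verit))
  then show ?thesis using that[of U Q] HUQ vU exU by blast
qed

section \<open>Graphs in which no vertex lowers the maximal excess by three\<close>

text \<open>By \<open>core_sum_degrees\<close> it suffices that degree 2 is at least as frequent as
  degree 4, for then \<open>cut {v} H - 2\<close> is at most 1 on average. This follows by counting
  the edges between the two classes from both sides.\<close>

lemma stuck_max_excess:
  assumes fin: "finite R" and H: "core R H"
    and deg: "\<And>v. v \<in> H \<Longrightarrow> cut {v} H \<le> 4"
    and stuck: "\<And>v. v \<in> H \<Longrightarrow> max_excess R - 2 \<le> max_excess (R - {v})"
  shows "2 * max_excess R \<le> int (card H)"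
proof -
  define V4 where "V4 = {v \<in> H. cut {v} H = 4}"
  define V2 where "V2 = {v \<in> H. cut {v} H = 2}"
  have fH: "finite H" using fin H core_finite by blast
  then have fV: "finite V4" "finite V2" by (auto simp: V4_def V2_def)
  have two: "2 \<le> cut {v} V2" if "v \<in> V4" for v
  proof -
    have v: "v \<in> H" "cut {v} H = 4" using that by (auto simp: V4_def)
    obtain U Q where UQ: "H = insert v (U \<union> Q)" "v \<notin> U" "v \<notin> Q" "U \<inter> Q = {}"
      "(\<Sum>x\<in>Q. cut {x} H - 2) + cut Q U \<le> cut Q {v} + 2 * (2 + 1 - cut {v} H)"
      using core_vertex_residue[OF fin H v(1) stuck[OF v(1)]] by metis
    define Q2 where "Q2 = Q \<inter> V2"
    have fQ: "finite Q" "finite Q2" using UQ(1) fH by (auto simp: Q2_def)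
    have Q_split: "Q = Q2 \<union> (Q - Q2)" by (auto simp: Q2_def)
    \<comment> \<open>For \<open>s = 2\<close> and degree 4 the residue bound leaves
      \<open>cut Q {v} - 2\<close> for the surplus degrees in \<open>Q\<close>. Each neighbour of
      \<open>v\<close> in \<open>Q\<close> of degree at least 3 uses up one unit, so at least two
      neighbours have degree 2.\<close>
    have "(\<Sum>x\<in>Q - Q2. 1) \<le> (\<Sum>x\<in>Q - Q2. cut {x} H - 2)"
    proof (rule sum_mono)
      fix x assume x: "x \<in> Q - Q2"
      then have "x \<in> H" using UQ(1) by auto
      moreover have "cut {x} H \<noteq> 2" using x \<open>x \<in> H\<close> by (auto simp: Q2_def V2_def)
      ultimately show "1 \<le> cut {x} H - 2" using core_degree[OF fin H, of x] by linarith
    qed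
    also have "\<dots> \<le> (\<Sum>x\<in>Q. cut {x} H - 2)"
    proof (rule sum_mono2)
      fix x assume "x \<in> Q - (Q - Q2)"
      then show "0 \<le> cut {x} H - 2" using UQ(1) core_degree[OF fin H, of x] by auto
    qed (use fQ in auto)
    finally have 1: "int (card (Q - Q2)) \<le> cut Q {v} - 2"
      using UQ(5) v(2) cut_nonneg[of Q U] by simp
    have "cut Q {v} = cut Q2 {v} + cut (Q - Q2) {v}"
      using cut_Un_left[of Q2 "Q - Q2" "{v}"] fQ Q_split by auto
    moreover have "cut (Q - Q2) {v} \<le> int (card (Q - Q2))"
      using cut_le_card[of "Q - Q2" v] card_mono[of "Q - Q2" "{u \<in> Q - Q2. E v u}"] fQ
      by (force simp: cut_commute[of _ "{v}"])
    moreover have "cut Q2 {v} \<le> cut V2 {v}"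
      using fV by (intro cut_mono) (auto simp: Q2_def)
    ultimately show ?thesis using 1 by (simp add: cut_commute[of "{v}"])
  qed
  have "2 * int (card V4) = (\<Sum>v\<in>V4. 2)" by simp
  also have "\<dots> \<le> (\<Sum>v\<in>V4. cut {v} V2)" using two by (rule sum_mono)
  also have "\<dots> = (\<Sum>v\<in>V2. cut {v} V4)"
    using cut_sum_degrees[OF fV(1), of V2] cut_sum_degrees[OF fV(2), of V4] cut_commute by simp
  also have "\<dots> \<le> (\<Sum>v\<in>V2. 2)"
  proof (rule sum_mono)
    fix v assume "v \<in> V2"
    then show "cut {v} V4 \<le> 2" using cut_mono[of "{v}" H "{v}" V4] fH by (auto simp: V2_def V4_def)
  qed
  finally have cards: "card V4 \<le> card V2" by simp
  have "2 * max_excess R = (\<Sum>v\<in>H. cut {v} H - 2)" using core_sum_degrees[OF fin H] by simp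
  also have "\<dots> \<le> (\<Sum>v\<in>H. 1 + of_bool (v \<in> V4) - of_bool (v \<in> V2))"
  proof (rule sum_mono)
    fix v assume v: "v \<in> H"
    then show "cut {v} H - 2 \<le> 1 + of_bool (v \<in> V4) - of_bool (v \<in> V2)"
      using deg[OF v] core_degree[OF fin H v] by (auto simp: V4_def V2_def)
  qed
  also have "\<dots> = int (card H) + int (card (H \<inter> V4)) - int (card (H \<inter> V2))"
    using fH by (simp add: sum.distrib sum_subtractf)
  also have "\<dots> = int (card H) + int (card V4) - int (card V2)"
    by (simp add: V4_def V2_def Int_absorb1)
  finally show ?thesis using cards by simp
qed

section \<open>A vertex that lowers the maximal excess by two\<close>

text \<open>For \<open>s = 1\<close> the residue bound gives
  \<open>cut Z U \<le> 4 - cut {v} H\<close> with \<open>Z = insert v Q\<close>, hence at most one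
  edge once the degree of \<open>v\<close> is at least 3.\<close>

lemma stuck_vertex_pendant:
  assumes fin: "finite R" and H: "core R H" and conn: "conn H" and ex: "2 \<le> max_excess R"
    and v: "v \<in> H" "3 \<le> cut {v} H" and stuck: "max_excess R - 1 \<le> max_excess (R - {v})"
  obtains Z where "Z \<subseteq> H" "v \<in> Z" "cut Z (H - Z) \<le> 1" "max_excess Z \<le> 0"
proof -
  obtain U Q where UQ: "H = insert v (U \<union> Q)" "v \<notin> U" "v \<notin> Q" "U \<inter> Q = {}"
    "excess U \<ge> max_excess R - 1"
    "(\<Sum>x\<in>Q. cut {x} H - 2) + cut Q U \<le> cut Q {v} + 2 * (1 + 1 - cut {v} H)"
    using core_vertex_residue[OF fin H v(1) stuck] by metis
  have fH: "finite H" using fin H core_finite by blast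
  then have fUQ: "finite U" "finite Q" using UQ(1) by auto
  define Z where "Z = insert v Q"
  have Z: "Z \<subseteq> H" "v \<in> Z" "H - Z = U" "finite Z" using UQ fUQ by (auto simp: Z_def)
  have "0 \<le> (\<Sum>x\<in>Q. cut {x} H - 2)"
    using UQ(1) core_degree[OF fin H] by (intro sum_nonneg) auto
  moreover have "cut Z U = cut {v} U + cut Q U"
    using cut_Un_left[of "{v}" Q U] fUQ UQ by (simp add: Z_def)
  moreover have "cut {v} H = cut {v} U + cut {v} Q"
    using cut_Un_right[of "{v}" "U \<union> Q" "{v}"] cut_Un_right[of U Q "{v}"] fUQ UQ by simp
  ultimately have d: "cut Z U \<le> 1" using UQ(6) v(2) cut_commute[of Q "{v}"] by (smt (verit))
  have exH: "excess H = max_excess R" using H by (simp add: core_def)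
  have "U \<noteq> {}" using UQ(5) ex by auto
  then have "Z \<noteq> H" using Z by auto
  then have d1: "1 \<le> cut Z U" using connD[OF conn, of Z] Z by auto
  \<comment> \<open>\<open>U\<close> misses the maximum by at most 1 and a proper subset of the core
    by at least 1, which leaves nothing for \<open>Y\<close>. For \<open>Y = Z\<close> the edge
    between \<open>Z\<close> and \<open>U\<close> replaces the strictness.\<close>
  have "max_excess Z \<le> 0"
  proof (rule max_excess_leI[OF Z(4)])
    fix Y assume Y: "Y \<subseteq> Z"
    then have fY: "finite Y" "Y \<inter> U = {}" using Z finite_subset by auto
    have YU: "excess (Y \<union> U) = excess Y + excess U + cut Y U"
      using fY fUQ by (intro excess_Un) auto
    show "excess Y \<le> 0"
    proof (cases "Y = Z")
      case True
      then have "Y \<union> U = H" using Z by auto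
      then show ?thesis using YU True d1 UQ(5) exH by simp
    next
      case False
      then have "Y \<union> U \<subset> H" using Y Z fY UQ by (auto simp: Z_def)
      then have "excess (Y \<union> U) < excess H" using core_psubset[OF fin H] by blast
      then show ?thesis using YU UQ(5) exH cut_nonneg[of Y U] by linarith
    qed
  qed
  then show ?thesis using that[of Z] Z d by simp
qed

text \<open>Posimodularity of the boundary: the right side exceeds the left by twice the number of
  edges between \<open>X \<inter> Z\<close> and \<open>H - (X \<union> Z)\<close>.\<close>

lemma cut_posimodular:
  assumes "finite H" "X \<subseteq> H" "Z \<subseteq> H"
  shows "cut (X - Z) (H - (X - Z)) + cut (Z - X) (H - (Z - X)) \<le> cut X (H - X) + cut Z (H - Z)"
proof -
  define A B C D where "A = X - Z" and "B = X \<inter> Z" and "C = Z - X" and "D = H - (X \<union> Z)"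
  note defs = A_def B_def C_def D_def
  have fin: "finite A" "finite B" "finite C" "finite D"
    using assms finite_subset[of X H] finite_subset[of Z H] by (auto simp: defs)
  have disj: "A \<inter> B = {}" "A \<inter> C = {}" "A \<inter> D = {}" "B \<inter> C = {}" "B \<inter> D = {}" "C \<inter> D = {}"
    by (auto simp: defs)
  note cut_Un = cut_Un_left cut_Un_right Int_Un_distrib2
  have parts: "X = A \<union> B" "H - X = C \<union> D" "Z = B \<union> C" "H - Z = A \<union> D"
    "H - A = B \<union> C \<union> D" "H - C = A \<union> B \<union> D" using assms by (auto simp: defs)
  have "cut X (H - X) = cut A C + cut A D + cut B C + cut B D"
    unfolding parts(2) by (subst parts(1)) (use fin disj in \<open>simp add: cut_Un\<close>)
  moreover have "cut Z (H - Z) = cut B A + cut B D + cut C A + cut C D"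
    unfolding parts(4) by (subst parts(3)) (use fin disj in \<open>simp add: cut_Un\<close>)
  moreover have "cut A (H - A) = cut A B + cut A C + cut A D"
    unfolding parts(5) using fin disj by (simp add: cut_Un)
  moreover have "cut C (H - C) = cut C A + cut C B + cut C D"
    unfolding parts(6) using fin disj by (simp add: cut_Un)
  ultimately have "cut A (H - A) + cut C (H - C) \<le> cut X (H - X) + cut Z (H - Z)"
    using cut_nonneg[of B D] cut_commute[of A B] cut_commute[of B C] by linarith
  then show ?thesis
    by (simp add: A_def C_def)
qed

text \<open>
  Take a maximal part \<open>X\<close> of the core that carries no excess and is attached by at most one edge.
  The vertex at which it is attached is the required one: otherwise that vertex, too, lies in
  such a part, and two of these parts joined by an edge have excess at most \<open>1\<close>.
\<close>

lemma conn_good_vertex: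
  assumes fin: "finite R" and conn: "conn R" and ex: "2 \<le> excess R"
  obtains v where "v \<in> R" "max_excess (R - {v}) \<le> excess R - 2"
proof (rule ccontr)
  note good = that
  assume contr: "\<not> thesis"
  have mx: "max_excess R = excess R" using max_excess_conn[OF fin conn] ex by simp
  obtain H where H: "core R H" using core_exists fin by blast
  have fH: "finite H" and HR: "H \<subseteq> R" and exH: "excess H = excess R"
    using core_finite[OF fin H] H mx by (auto simp: core_def)
  have cH: "conn H" using core_conn[OF fin H conn mx] .
  define P where "P X \<longleftrightarrow> X \<subseteq> H \<and> cut X (H - X) \<le> 1 \<and> max_excess X \<le> 0" for X
  have stuck: "\<exists>Z. P Z \<and> v \<in> Z" if v: "v \<in> H" "3 \<le> cut {v} H" for v
  proof -
    have "max_excess R - 1 \<le> max_excess (R - {v})"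
      using good[of v] contr v(1) HR mx by fastforce
    then show ?thesis
      using stuck_vertex_pendant[OF fin H cH _ v] ex mx by (metis P_def)
  qed
  have "P {}" by (simp add: P_def max_excess_def)
  moreover have "\<And>X. P X \<Longrightarrow> X \<subseteq> H" by (simp add: P_def)
  ultimately obtain X where PX: "P X" and X_max: "\<And>Y. P Y \<Longrightarrow> card Y \<le> card X"
    using obtain_max_card[of H P] fH by blast
  have X: "X \<subseteq> H" "cut X (H - X) \<le> 1" "max_excess X \<le> 0" using PX by (auto simp: P_def)
  have fX: "finite X" using X(1) fH finite_subset by blast
  have XH: "X \<noteq> H" using X(3) excess_le_max[OF fX, of X] exH ex by auto
  show False
  proof (cases "X = {}")
    case True
    \<comment> \<open>A core of positive excess has a vertex of degree at least 3, and this vertex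
      lies in a nonempty part, against the maximality of \<open>X\<close>.\<close>
    have "(\<Sum>v\<in>H. cut {v} H - 2) > 0" using core_sum_degrees[OF fin H] mx ex by simp
    then obtain v where v: "v \<in> H" "cut {v} H - 2 > 0"
      using sum_nonpos[of H "\<lambda>v. cut {v} H - 2"] by (meson not_le)
    then obtain Z where Z: "P Z" "v \<in> Z" using stuck[of v] by auto
    then have "finite Z" using fH by (auto simp: P_def intro: finite_subset)
    then have "card Z > 0" using Z by (auto simp: card_gt_0_iff)
    then show False using X_max[OF Z(1)] True by simp
  next
    case False
    have d: "1 \<le> cut X (H - X)" using connD[OF cH X(1) False XH] .
    then have "cut X (H - X) > 0" by simp
    then obtain x y where xy: "x \<in> X" "y \<in> H - X" "E x y" using cut_posE by blast
    have cXy: "1 \<le> cut X {y}" using xy fX by (intro cut_edge[of _ _ x y]) auto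
    have HX: "H - X = insert y (H - X - {y})" using xy by auto
    have "cut X (H - X) = cut X {y} + cut X (H - X - {y})"
      using cut_Un_right[of "{y}" "H - X - {y}" X] fH HX by simp
    then have cXy1: "cut X {y} = 1" and cXr: "cut X (H - X - {y}) = 0"
      using cXy X(2) cut_nonneg[of X "H - X - {y}"] by linarith+
    \<comment> \<open>Otherwise \<open>y\<close>, with one edge to \<open>X\<close> and at most one
      other, could be added to \<open>X\<close>: the boundary stays at most one edge and no subset
      gets positive excess.\<close>
    have "3 \<le> cut {y} H"
    proof (rule ccontr)
      assume "\<not> 3 \<le> cut {y} H"
      then have y2: "cut {y} H \<le> 2" by simp
      have "H = (X \<union> {y}) \<union> (H - X - {y})" using X(1) xy by auto
      then have "cut {y} H = cut {y} (X \<union> {y}) + cut {y} (H - X - {y})"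
        using cut_Un_right[of "X \<union> {y}" "H - X - {y}" "{y}"] fX fH by auto
      also have "cut {y} (X \<union> {y}) = cut X {y}"
        using cut_Un_right[of X "{y}" "{y}"] fX xy by (simp add: cut_commute)
      finally have "cut {y} (H - X - {y}) \<le> 1" using y2 cXy1 by simp
      moreover have "cut (insert y X) (H - insert y X) = cut {y} (H - X - {y}) + cut X (H - X - {y})"
        using cut_Un_left[of "{y}" X "H - X - {y}"] fX xy
        by (simp add: Diff_insert[of H y X])
      ultimately have 1: "cut (insert y X) (H - insert y X) \<le> 1" using cXr by simp
      have "max_excess (insert y X) \<le> 0"
      proof (rule max_excess_leI)
        fix U assume U: "U \<subseteq> insert y X"
        then have fU: "finite U" using fX finite_subset by blast
        have "U - {y} \<subseteq> X" using U by blast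
        then have 0: "excess (U - {y}) \<le> 0" using excess_le_max[OF fX] X(3) order_trans by blast
        show "excess U \<le> 0"
        proof (cases "y \<in> U")
          case True
          have "cut {y} (U - {y}) \<le> cut {y} X" using fX U by (intro cut_mono) auto
          moreover have "insert y (U - {y}) = U" using True by blast
          then have "excess U = excess (U - {y}) + cut {y} (U - {y}) - 1"
            using excess_insert[of "U - {y}" y] fU by simp
          ultimately show ?thesis using 0 cXy1 cut_commute[of X "{y}"] by linarith
        qed (use 0 in simp)
      qed (use fX in simp)
      then have "P (insert y X)" using 1 X xy by (simp add: P_def)
      then show False using X_max[of "insert y X"] xy fX by simp
    qed
    then obtain Z where Z: "P Z" "y \<in> Z" using stuck[of y] xy by auto
    then have ZH: "Z \<subseteq> H" "cut Z (H - Z) \<le> 1" "max_excess Z \<le> 0" by (auto simp: P_def)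
    have fZ: "finite Z" using ZH fH finite_subset by blast
    have XZ: "X - Z \<noteq> {}"
    proof
      assume "X - Z = {}"
      then have "X \<subset> Z" using Z xy by auto
      then have "card X < card Z" using fZ psubset_card_mono by blast
      then show False using X_max[OF Z(1)] by simp
    qed
    define Z' where "Z' = Z - X"
    have Z': "y \<in> Z'" "Z' \<subseteq> H" "finite Z'" "X \<inter> Z' = {}" using Z xy ZH fZ by (auto simp: Z'_def)
    \<comment> \<open>Uncrossing: \<open>X - Z\<close> already accounts for one of the at most two
      boundary edges, so posimodularity leaves at most one for \<open>Z - X\<close>.\<close>
    have "1 \<le> cut (X - Z) (H - (X - Z))" using XZ X(1) XH by (intro connD[OF cH]) auto
    then have dZ': "cut Z' (H - Z') \<le> 1"
      using cut_posimodular[OF fH X(1) ZH(1)] X(2) ZH(2) by (simp add: Z'_def)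
    have cXZ': "1 \<le> cut X Z'" using cut_mono[of X Z' X "{y}"] cXy fX Z' by simp
    define D where "D = H - (X \<union> Z')"
    have fD: "finite D" using fH by (simp add: D_def)
    \<comment> \<open>\<open>X\<close> and \<open>Z'\<close> spend their only boundary edge on each
      other, so by connectivity nothing else is left in \<open>H\<close>.\<close>
    have "H - X = Z' \<union> D" "H - Z' = X \<union> D" using Z' X(1) by (auto simp: D_def)
    then have "cut X (H - X) = cut X Z' + cut X D" "cut Z' (H - Z') = cut Z' X + cut Z' D"
      using cut_Un_right[of Z' D] cut_Un_right[of X D] fX fD Z' by (auto simp: D_def)
    then have z: "cut X D \<le> 0" "cut Z' D \<le> 0" "cut X Z' \<le> 1"
      using cXZ' X(2) dZ' cut_commute[of Z' X] cut_nonneg[of X D] by linarith+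
    have "cut (X \<union> Z') D \<le> 0" using cut_Un_left[of X Z' D] fX Z' z by simp
    then have "X \<union> Z' = H" using connD[OF cH, of "X \<union> Z'"] X(1) Z' False by (auto simp: D_def)
    then have "excess H = excess X + excess Z' + cut X Z'"
      using excess_Un[of X Z'] fX Z' by simp
    moreover have "excess X \<le> 0" using excess_le_max[OF fX, of X] X(3) by simp
    moreover have "excess Z' \<le> 0" using excess_le_max[OF fZ, of Z'] ZH(3) by (simp add: Z'_def)
    ultimately show False using z(3) exH ex by simp
  qed
qed

section \<open>Deleting vertices so that small pieces remain\<close>

text \<open>\<open>W\<close> may be any union of components: closure under adjacency is what the
  search tests. The budget \<open>s\<close> is real so that fractional costs can be added
  up.\<close>

definition frag :: "nat \<Rightarrow> 'a set \<Rightarrow> real \<Rightarrow> bool" where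
  "frag M R s \<longleftrightarrow> (\<exists>S\<subseteq>R. real (card S) \<le> s \<and>
     (\<forall>v\<in>R - S. \<exists>W\<subseteq>R - S. v \<in> W \<and> card W \<le> M \<and> cut W (R - S - W) = 0))"

lemma frag_mono: "frag M R s \<Longrightarrow> s \<le> t \<Longrightarrow> frag M R t"
  unfolding frag_def using order_trans by blast

lemma frag_small: "finite R \<Longrightarrow> card R \<le> M \<Longrightarrow> 0 \<le> s \<Longrightarrow> frag M R s"
  unfolding frag_def by (intro exI[of _ "{}"] conjI ballI exI[of _ R]) simp_all

lemma frag_separated:
  assumes "finite A" "finite B" "A \<inter> B = {}" "cut A B = 0" "frag M A s" "frag M B t"
  shows "frag M (A \<union> B) (s + t)"
proof -
  obtain S where S: "S \<subseteq> A" "real (card S) \<le> s"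
    "\<forall>v\<in>A - S. \<exists>W\<subseteq>A - S. v \<in> W \<and> card W \<le> M \<and> cut W (A - S - W) = 0"
    using assms(5) by (auto simp: frag_def)
  obtain T where T: "T \<subseteq> B" "real (card T) \<le> t"
    "\<forall>v\<in>B - T. \<exists>W\<subseteq>B - T. v \<in> W \<and> card W \<le> M \<and> cut W (B - T - W) = 0"
    using assms(6) by (auto simp: frag_def)
  have no: "\<not> E u v" if "u \<in> A" "v \<in> B" for u v
    using that assms(1,2,4) by (simp add: cut_eq_0_iff)
  have AB: "A \<union> B - (S \<union> T) = (A - S) \<union> (B - T)" using assms(3) S(1) T(1) by auto
  have "real (card (S \<union> T)) \<le> s + t" using card_Un_le[of S T] S(2) T(2) by linarith
  moreover have "\<exists>W\<subseteq>A \<union> B - (S \<union> T). v \<in> W \<and> card W \<le> M \<and> cut W (A \<union> B - (S \<union> T) - W) = 0"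
    if v: "v \<in> A \<union> B - (S \<union> T)" for v
  proof (cases "v \<in> A")
    case True
    then obtain W where W: "W \<subseteq> A - S" "v \<in> W" "card W \<le> M" "cut W (A - S - W) = 0"
      using S(3) v by auto
    have "finite W" using W(1) assms(1) by (meson finite_Diff finite_subset)
    then have "cut W (A \<union> B - (S \<union> T) - W) = 0"
      using W(1,4) no assms(1,2) unfolding AB by (simp add: cut_eq_0_iff) blast
    then show ?thesis using W AB by (intro exI[of _ W]) auto
  next
    case False
    then obtain W where W: "W \<subseteq> B - T" "v \<in> W" "card W \<le> M" "cut W (B - T - W) = 0"
      using T(3) v by auto
    have "finite W" using W(1) assms(2) by (meson finite_Diff finite_subset)
    then have "cut W (A \<union> B - (S \<union> T) - W) = 0"
      using W(1,4) no sym assms(1,2) unfolding AB by (simp add: cut_eq_0_iff) blast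
    then show ?thesis using W AB by (intro exI[of _ W]) auto
  qed
  ultimately show ?thesis
    unfolding frag_def using S(1) T(1) by (intro exI[of _ "S \<union> T"]) auto
qed

lemma frag_removes:
  assumes "finite A" "A \<subseteq> R" "frag M (R - A) s"
  shows "frag M R (s + real (card A))"
proof -
  obtain S where S: "S \<subseteq> R - A" "real (card S) \<le> s"
    "\<forall>v\<in>R - A - S. \<exists>W\<subseteq>R - A - S. v \<in> W \<and> card W \<le> M \<and> cut W (R - A - S - W) = 0"
    using assms(3) by (auto simp: frag_def)
  have "R - (A \<union> S) = R - A - S" by auto
  moreover have "real (card (A \<union> S)) \<le> s + real (card A)" using card_Un_le[of A S] S(2) by linarith
  ultimately show ?thesis
    unfolding frag_def using S assms(2) by (intro exI[of _ "A \<union> S"]) auto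
qed

lemma frag_remove: "v \<in> R \<Longrightarrow> frag M (R - {v}) s \<Longrightarrow> frag M R (s + 1)"
  using frag_removes[of "{v}" R M s] by simp

text \<open>A smallest set around \<open>v\<close> without outgoing edges is its component; an
  internal split would leave a smaller one.\<close>

lemma conn_piece:
  assumes "finite P" "v \<in> P"
  obtains W where "W \<subseteq> P" "v \<in> W" "cut W (P - W) = 0" "conn W"
proof -
  define C where "C W \<longleftrightarrow> W \<subseteq> P \<and> v \<in> W \<and> cut W (P - W) = 0" for W
  have "C P" using assms by (simp add: C_def)
  then obtain W where CW: "C W" and W_min: "\<And>Y. C Y \<Longrightarrow> card W \<le> card Y"
    using obtain_min_card[of C P] by blast
  then have W: "W \<subseteq> P" "v \<in> W" "cut W (P - W) = 0" by (auto simp: C_def)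
  have fW: "finite W" using W(1) assms(1) finite_subset by blast
  have "conn W"
  proof (rule ccontr)
    assume "\<not> conn W"
    then obtain A where A: "A \<subseteq> W" "A \<noteq> {}" "A \<noteq> W" "cut A (W - A) = 0"
      using not_connE fW by blast
    have fA: "finite A" using A(1) fW finite_subset by blast
    have "\<forall>x\<in>W. \<forall>y\<in>P - W. \<not> E x y" "\<forall>x\<in>A. \<forall>y\<in>W - A. \<not> E x y"
      using W(3) A(4) fW fA assms(1) by (simp_all add: cut_eq_0_iff)
    then have "cut A (P - A) = 0" "cut (W - A) (P - (W - A)) = 0"
      using A(1) fA fW assms(1) sym by (simp_all add: cut_eq_0_iff) blast+
    then have "C A \<or> C (W - A)" using W(1,2) A(1) by (auto simp: C_def)
    moreover have "card A < card W" "card (W - A) < card W"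
      using A fW by (auto intro!: psubset_card_mono)
    ultimately show False using W_min by fastforce
  qed
  then show ?thesis using that W by blast
qed

lemma frag_pieces:
  assumes "finite P" "\<And>W. W \<subseteq> P \<Longrightarrow> conn W \<Longrightarrow> cut W (P - W) = 0 \<Longrightarrow> card W \<le> M"
  shows "frag M P 0"
proof -
  have "\<exists>W\<subseteq>P. v \<in> W \<and> card W \<le> M \<and> cut W (P - W) = 0" if v: "v \<in> P" for v
  proof -
    obtain W where W: "W \<subseteq> P" "v \<in> W" "cut W (P - W) = 0" "conn W"
      by (rule conn_piece[OF assms(1) v])
    with assms(2)[of W] show ?thesis by blast
  qed
  then show ?thesis unfolding frag_def by (intro exI[of _ "{}"]) auto
qed

text \<open>A smallest large connected part with at most one outgoing edge is cut off and broken up.\<close>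

lemma frag_acyclic:
  assumes "finite R" "1 \<le> M" "\<And>U. U \<subseteq> R \<Longrightarrow> U \<noteq> {} \<Longrightarrow> excess U \<le> -1"
  shows "frag M R (real (card R) / M)"
  using assms(1,3)
proof (induction "card R" arbitrary: R rule: less_induct)
  case less
  note fin = less.prems(1) and acyclic = less.prems(2)
  define P where "P X \<longleftrightarrow> X \<subseteq> R \<and> M < card X \<and> conn X \<and> cut X (R - X) \<le> 1" for X
  show ?case
  proof (cases "\<exists>X. P X")
    case False
    have "frag M R 0"
    proof (rule frag_pieces[OF fin])
      fix W assume "W \<subseteq> R" "conn W" "cut W (R - W) = 0"
      then show "card W \<le> M" using False not_le by (auto simp: P_def)
    qed
    then show ?thesis by (rule frag_mono) simp
  next
    case True
    then obtain X where PX: "P X" and X_min: "\<And>Y. P Y \<Longrightarrow> card X \<le> card Y"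
      using obtain_min_card[of P] by blast
    then have X: "X \<subseteq> R" "M < card X" "conn X" "cut X (R - X) \<le> 1" by (auto simp: P_def)
    have fX: "finite X" using X(1) fin finite_subset by blast
    \<comment> \<open>\<open>v\<close> is the endpoint of the outgoing edge, if there is one; the
      rest of \<open>X\<close> is then detached from the outside.\<close>
    have "\<exists>v\<in>X. cut (X - {v}) (R - X) = 0"
    proof (cases "cut X (R - X) = 0")
      case True
      have "X \<noteq> {}" using X(2) by auto
      then obtain v where v: "v \<in> X" by blast
      have "cut (X - {v}) (R - X) \<le> cut X (R - X)" using fX fin by (intro cut_mono) auto
      then have "cut (X - {v}) (R - X) = 0" using True cut_nonneg[of "X - {v}" "R - X"] by linarith
      then show ?thesis using v by blast
    next
      case False
      then have "cut X (R - X) > 0" using cut_nonneg[of X "R - X"] by linarith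
      then obtain v w where vw: "v \<in> X" "w \<in> R - X" "E v w" by (rule cut_posE)
      have "1 \<le> cut {v} (R - X)" using vw fin by (intro cut_edge[of _ _ v w]) auto
      moreover have "cut X (R - X) = cut {v} (R - X) + cut (X - {v}) (R - X)"
        using cut_Un_left[of "{v}" "X - {v}" "R - X"] fX vw by (simp add: insert_absorb)
      ultimately have "cut (X - {v}) (R - X) = 0" using X(4) cut_nonneg[of "X - {v}" "R - X"] by linarith
      then show ?thesis using vw by blast
    qed
    then obtain v where v: "v \<in> X" "cut (X - {v}) (R - X) = 0" by blast
    have 0: "frag M (X - {v}) 0"
    proof (rule frag_pieces)
      \<comment> \<open>Two edges from \<open>v\<close> to the connected set \<open>Y\<close> would
        close a cycle and give \<open>insert v Y\<close> nonnegative excess. So a large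
        \<open>Y\<close> has at most one outgoing edge and would be a smaller choice than
        \<open>X\<close>.\<close>
      fix Y assume Y: "Y \<subseteq> X - {v}" "conn Y" "cut Y (X - {v} - Y) = 0"
      have fY: "finite Y" using Y(1) fX by (meson finite_Diff finite_subset)
      show "card Y \<le> M"
      proof (rule ccontr)
        assume M: "\<not> card Y \<le> M"
        then have ne: "Y \<noteq> {}" by auto
        have "excess (insert v Y) = excess Y + cut {v} Y - 1" using Y(1) fY by (intro excess_insert) auto
        moreover have "excess (insert v Y) \<le> -1" using Y(1) X(1) v(1) by (intro acyclic) auto
        ultimately have 1: "cut {v} Y \<le> 1" using excess_conn_ge[OF fY Y(2) ne] by linarith
        have "cut Y (R - X) \<le> cut (X - {v}) (R - X)" using Y(1) fX fin by (intro cut_mono) auto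
        then have 2: "cut Y (R - X) \<le> 0" using v(2) by simp
        have "R - Y = ((X - {v} - Y) \<union> {v}) \<union> (R - X)" using Y(1) X(1) v(1) by auto
        then have "cut Y (R - Y) = cut Y (X - {v} - Y) + cut Y {v} + cut Y (R - X)"
          using cut_Un_right[of "(X - {v} - Y) \<union> {v}" "R - X" Y] cut_Un_right[of "X - {v} - Y" "{v}" Y]
            fX fin v(1) by auto
        then have "cut Y (R - Y) \<le> 1" using 1 2 Y(3) cut_commute[of Y "{v}"] by simp
        then have "P Y" using M Y X(1) by (auto simp: P_def)
        moreover have "card Y < card X" using Y(1) v(1) fX by (intro psubset_card_mono) auto
        ultimately show False using X_min by fastforce
      qed
    qed (use fX in simp)
    have "X \<noteq> {}" using v by auto
    then have cards: "card (R - X) < card R" "card (R - X) + card X = card R"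
      using X(1) fX fin card_Diff_subset[of X R] card_mono[of R X] card_gt_0_iff[of X] by auto
    have "frag M (R - X) (real (card (R - X)) / M)"
    proof (rule less.hyps[OF cards(1)])
      show "excess U \<le> -1" if "U \<subseteq> R - X" "U \<noteq> {}" for U
        using that by (intro acyclic) auto
    qed (use fin in simp)
    then have "frag M ((X - {v}) \<union> (R - X)) (0 + real (card (R - X)) / M)"
      using fX fin v(2) 0 by (intro frag_separated) auto
    also have "(X - {v}) \<union> (R - X) = R - {v}" using X(1) v(1) by auto
    finally have "frag M R (real (card (R - X)) / M + 1)" using frag_remove[of v R] v(1) X(1) by auto
    then show ?thesis
    proof (rule frag_mono)
      \<comment> \<open>\<open>X\<close> has more than \<open>M\<close> vertices, so splitting it
        off pays for the deletion of \<open>v\<close>.\<close>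
      have "real (card R) / M = real (card (R - X)) / M + real (card X) / M"
        using cards(2) by (simp flip: add_divide_distrib of_nat_add)
      moreover have "1 \<le> real (card X) / M" using X(2) assms(2) by simp
      ultimately show "real (card (R - X)) / M + 1 \<le> real (card R) / M" by linarith
    qed
  qed
qed

text \<open>A large connected \<open>R\<close> has at most one cycle. Any vertex of a smallest
  nonempty \<open>U\<close> of nonnegative excess destroys it: another such set disjoint from
  \<open>U\<close> would force positive excess in \<open>R\<close>, and one meeting \<open>U\<close>
  without that vertex would, by supermodularity, yield a smaller candidate. The factor 2 pays for
  this one deletion, because \<open>card R > M\<close>.\<close>

lemma frag_unicyclic:
  assumes "finite R" "1 \<le> M" "max_excess R \<le> 0"
  shows "frag M R (2 * real (card R) / M)"
  using assms(1,3)
proof (induction "card R" arbitrary: R rule: less_induct)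
  case less
  note fin = less.prems(1)
  have le: "excess U \<le> 0" if "U \<subseteq> R" for U using excess_le_max[OF fin that] less.prems by simp
  consider "card R \<le> M" | "\<not> conn R" | "M < card R" "conn R" by linarith
  then show ?case
  proof cases
    case 1
    then show ?thesis using fin by (intro frag_small) auto
  next
    case 2
    then obtain A where A: "A \<subseteq> R" "A \<noteq> {}" "A \<noteq> R" "cut A (R - A) = 0" using not_connE fin by blast
    have fA: "finite A" using A fin finite_subset by blast
    have cards: "card A < card R" "card (R - A) < card R" using A fin by (auto intro!: psubset_card_mono)
    have "frag M (A \<union> (R - A)) (2 * real (card A) / M + 2 * real (card (R - A)) / M)"
      using fA fin A(4) cards le A(1)
      by (intro frag_separated less.hyps max_excess_leI) auto
    moreover have "A \<union> (R - A) = R" "card A + card (R - A) = card R"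
      using A(1) fA fin card_Diff_subset[of A R] card_mono[of R A] by auto
    ultimately show ?thesis
      by (simp flip: add_divide_distrib of_nat_add distrib_left)
  next
    case 3
    then have ne: "R \<noteq> {}" by auto
    have big: "1 \<le> real (card R) / M" using 3 assms(2) by simp
    define C where "C U \<longleftrightarrow> U \<subseteq> R \<and> U \<noteq> {} \<and> 0 \<le> excess U" for U
    show ?thesis
    proof (cases "\<exists>U. C U")
      case False
      then have "frag M R (real (card R) / M)"
        using fin assms(2) by (intro frag_acyclic) (auto simp: C_def not_le)
      then show ?thesis by (rule frag_mono) (use big in simp)
    next
      case True
      then obtain U where CU: "C U" and U_min: "\<And>Y. C Y \<Longrightarrow> card U \<le> card Y"
        using obtain_min_card[of C] by blast
      then have U: "U \<subseteq> R" "U \<noteq> {}" "0 \<le> excess U" by (auto simp: C_def)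
      then obtain v where v: "v \<in> U" by blast
      have fU: "finite U" using U fin finite_subset by blast
      have "frag M (R - {v}) (real (card (R - {v})) / M)"
      proof (rule frag_acyclic)
        fix Y assume Y: "Y \<subseteq> R - {v}" "Y \<noteq> {}"
        have fY: "finite Y" using Y(1) fin by (meson finite_Diff finite_subset)
        show "excess Y \<le> -1"
        proof (rule ccontr)
          assume "\<not> excess Y \<le> -1"
          then have ex: "0 \<le> excess Y" by simp
          show False
          proof (cases "U \<inter> Y = {}")
            case True
            then have "excess U + excess Y + 1 \<le> excess R"
              using Y U fin 3 by (intro excess_disjoint_conn) auto
            then show False using le[of R] ex U(3) by simp
          next
            case False
            have "excess U + excess Y \<le> excess (U \<union> Y) + excess (U \<inter> Y)"
              using fU fY by (rule excess_supermodular)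
            moreover have "excess (U \<union> Y) \<le> 0" using U Y by (intro le) auto
            ultimately have "C (U \<inter> Y)" using ex U False by (auto simp: C_def)
            moreover have "card (U \<inter> Y) < card U" using v Y fU by (intro psubset_card_mono) auto
            ultimately show False using U_min by fastforce
          qed
        qed
      qed (use fin assms(2) in auto)
      then have "frag M R (real (card (R - {v})) / M + 1)" using v U by (intro frag_remove) auto
      then show ?thesis
      proof (rule frag_mono)
        have "real (card (R - {v})) / M \<le> real (card R) / M"
          using fin by (intro divide_right_mono) (auto intro: card_mono)
        then show "real (card (R - {v})) / M + 1 \<le> 2 * real (card R) / M" using big by simp
      qed
    qed
  qed
qed

text \<open>A deletion that lowers the maximal excess by 2 is paid for by the first summand. If the
  excess is 1, breaking the last cycle but one costs 1 and only 1/2 is available; the rest comes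
  from the size term, which explains 3 instead of the 2 of \<open>frag_unicyclic\<close>.\<close>

lemma frag_max_excess:
  assumes "finite R" "1 \<le> M"
  shows "frag M R (max_excess R / 2 + 3 * real (card R) / M)"
  using assms(1)
proof (induction "card R" arbitrary: R rule: less_induct)
  case less
  note fin = less.prems
  have nn: "0 \<le> real_of_int (max_excess R)" using max_excess_nonneg[OF fin] by simp
  consider "card R \<le> M" | "\<not> conn R" | "M < card R" "conn R" by linarith
  then show ?case
  proof cases
    case 1
    then show ?thesis using fin nn by (intro frag_small) auto
  next
    case 2
    then obtain A where A: "A \<subseteq> R" "A \<noteq> {}" "A \<noteq> R" "cut A (R - A) = 0" using not_connE fin by blast
    have fA: "finite A" using A fin finite_subset by blast
    have cards: "card A < card R" "card (R - A) < card R" using A fin by (auto intro!: psubset_card_mono)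
    have "frag M (A \<union> (R - A)) ((max_excess A / 2 + 3 * real (card A) / M)
        + (max_excess (R - A) / 2 + 3 * real (card (R - A)) / M))"
      using fA fin A(4) cards by (intro frag_separated less.hyps) auto
    moreover have AR: "A \<union> (R - A) = R" "card A + card (R - A) = card R"
      using A(1) fA fin card_Diff_subset[of A R] card_mono[of R A] by auto
    moreover have "real_of_int (max_excess A) + real_of_int (max_excess (R - A)) \<le> real_of_int (max_excess R)"
      using max_excess_separated[of A "R - A"] fA fin A(4) AR by (simp flip: of_int_add)
    moreover have "3 * real (card A) / M + 3 * real (card (R - A)) / M = 3 * real (card R) / M"
      using AR(2) by (simp flip: add_divide_distrib of_nat_add distrib_left)
    ultimately show ?thesis by (auto elim!: frag_mono)
  next
    case 3
    have big: "1 \<le> real (card R) / M" using 3 assms(2) by simp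
    have mono: "real (card (R - {v})) / M \<le> real (card R) / M" for v
      using fin by (intro divide_right_mono) (auto intro: card_mono)
    consider "2 \<le> excess R" | "excess R = 1" | "excess R \<le> 0" by linarith
    then show ?thesis
    proof cases
      case 1
      then obtain v where v: "v \<in> R" "max_excess (R - {v}) \<le> excess R - 2"
        using conn_good_vertex[OF fin 3(2)] by blast
      then have "real_of_int (max_excess (R - {v})) \<le> real_of_int (max_excess R - 2)"
        using max_excess_conn[OF fin 3(2)] by linarith
      then have me: "real_of_int (max_excess (R - {v})) \<le> real_of_int (max_excess R) - 2" by simp
      have "card (R - {v}) < card R" using v fin by (intro psubset_card_mono) auto
      then have "frag M (R - {v}) (max_excess (R - {v}) / 2 + 3 * real (card (R - {v})) / M)"
        using fin by (intro less.hyps) auto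
      then have "frag M R (max_excess (R - {v}) / 2 + 3 * real (card (R - {v})) / M + 1)"
        using v by (intro frag_remove) auto
      then show ?thesis by (rule frag_mono) (use me mono[of v] in simp)
    next
      case 2
      then have m1: "max_excess R = 1" using max_excess_conn[OF fin 3(2)] by simp
      obtain H where H: "core R H" using core_exists fin by blast
      then have "H \<noteq> {}" using m1 by (auto simp: core_def)
      then obtain v where v: "v \<in> H" by blast
      then have "max_excess (R - {v}) \<le> 0" using core_remove[OF fin H v] m1 by simp
      then have "frag M (R - {v}) (2 * real (card (R - {v})) / M)"
        using fin assms(2) by (intro frag_unicyclic) auto
      then have "frag M R (2 * real (card (R - {v})) / M + 1)"
        using v H by (intro frag_remove) (auto simp: core_def)
      then show ?thesis by (rule frag_mono) (use m1 big mono[of v] in simp)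
    next
      case 3
      then have "max_excess R = 0" using max_excess_conn[OF fin \<open>conn R\<close>] by simp
      then have "frag M R (2 * real (card R) / M)" using fin assms(2) by (intro frag_unicyclic) auto
      then show ?thesis by (rule frag_mono) (use nn big in simp)
    qed
  qed
qed

text \<open>A largest set that pays off three for one replaces the greedy loop: a further vertex
  lowering the maximal excess by 3 would extend it.\<close>

lemma stuck_set_exists:
  assumes "finite V"
  obtains A where "A \<subseteq> V" "max_excess (V - A) + 3 * int (card A) \<le> max_excess V"
    "\<And>v. v \<in> V - A \<Longrightarrow> max_excess (V - A) - 2 \<le> max_excess (V - A - {v})"
proof -
  define P where "P A \<longleftrightarrow> A \<subseteq> V \<and> max_excess (V - A) + 3 * int (card A) \<le> max_excess V" for A
  have "P {}" "\<And>A. P A \<Longrightarrow> A \<subseteq> V" by (auto simp: P_def)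
  then obtain A where PA: "P A" and A_max: "\<And>B. P B \<Longrightarrow> card B \<le> card A"
    using obtain_max_card[of V P] assms by blast
  have fA: "finite A" using PA assms by (auto simp: P_def intro: finite_subset)
  have "max_excess (V - A) - 2 \<le> max_excess (V - A - {v})" if v: "v \<in> V - A" for v
  proof (rule ccontr)
    assume "\<not> ?thesis"
    moreover have "V - insert v A = V - A - {v}" by auto
    ultimately have "P (insert v A)" using PA v fA by (simp add: P_def)
    from A_max[OF this] show False using v fA by simp
  qed
  then show ?thesis using that[of A] PA by (auto simp: P_def)
qed

theorem frag_degree_4:
  assumes fin: "finite V" and "1 \<le> M" and deg: "\<And>v. v \<in> V \<Longrightarrow> card {u \<in> V. E v u} \<le> 4"
  shows "frag M V (2 / 5 * real (card V) + 3 * real (card V) / M)"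
proof -
  have deg': "cut {v} U \<le> 4" if "v \<in> V" "U \<subseteq> V" for v U
  proof -
    have "cut {v} U \<le> cut {v} V" using fin that by (intro cut_mono) auto
    then show ?thesis using cut_le_card[OF fin, of v] deg[OF that(1)] by simp
  qed
  have mV: "max_excess V \<le> int (card V)"
  proof (rule max_excess_leI[OF fin])
    fix U assume U: "U \<subseteq> V"
    then have fU: "finite U" using fin finite_subset by blast
    have "cut U U \<le> (\<Sum>v\<in>U. 4)"
      unfolding cut_sum_degrees[OF fU, of U] using U by (intro sum_mono deg') auto
    then have "excess U \<le> int (card U)" using cut_excess[OF fU] by simp
    also have "\<dots> \<le> int (card V)" using U fin card_mono by simp
    finally show "excess U \<le> int (card V)" .
  qed
  obtain A where A: "A \<subseteq> V" "max_excess (V - A) + 3 * int (card A) \<le> max_excess V"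
    and stuck: "\<And>v. v \<in> V - A \<Longrightarrow> max_excess (V - A) - 2 \<le> max_excess (V - A - {v})"
    using stuck_set_exists[OF fin] by metis
  have fA: "finite A" using A fin finite_subset by blast
  obtain H where H: "core (V - A) H" using core_exists[of "V - A"] fin by blast
  have HV: "H \<subseteq> V - A" using H by (simp add: core_def)
  have "2 * max_excess (V - A) \<le> int (card H)"
    using fin H HV by (intro stuck_max_excess deg' stuck) auto
  also have "card H \<le> card (V - A)" using HV fin by (intro card_mono) auto
  finally have half: "2 * max_excess (V - A) \<le> int (card (V - A))" by simp
  have cards: "card (V - A) + card A = card V"
    using A fA fin card_Diff_subset[of A V] card_mono[of V A] by simp
  have "frag M (V - A) (max_excess (V - A) / 2 + 3 * real (card (V - A)) / M)"
    using fin assms(2) by (intro frag_max_excess) auto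
  then have "frag M V (max_excess (V - A) / 2 + 3 * real (card (V - A)) / M + real (card A))"
    using fA A(1) by (intro frag_removes)
  then show ?thesis
  proof (rule frag_mono)
    have "real (card (V - A)) / M \<le> real (card V) / M"
      using cards by (intro divide_right_mono) auto
    moreover have "2 * real_of_int (max_excess (V - A)) \<le> real (card V) - real (card A)"
      using half cards by linarith
    moreover have "real_of_int (max_excess (V - A)) + 3 * real (card A) \<le> real (card V)"
      using A(2) mV by linarith
    \<comment> \<open>With m the remaining maximal excess and a the number of deletions so far, 1/10
      of \<open>2m + a \<le> k\<close> plus 3/10 of \<open>m + 3a \<le> k\<close> is
      \<open>m/2 + a \<le> 2k/5\<close>.\<close>
    ultimately show "max_excess (V - A) / 2 + 3 * real (card (V - A)) / M + real (card A)
        \<le> 2 / 5 * real (card V) + 3 * real (card V) / M"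
      by simp
  qed
qed

end

section \<open>Bounded arithmetic terms on the random access machine\<close>

datatype binop = Plus | Minus | Times | Over

fun app :: "binop \<Rightarrow> nat \<Rightarrow> nat \<Rightarrow> nat" where
  "app Plus x y = x + y"
| "app Minus x y = x - y"
| "app Times x y = x * y"
| "app Over x y = x div y"

fun app_expr :: "binop \<Rightarrow> expr \<Rightarrow> expr \<Rightarrow> expr" where
  "app_expr Plus = Add"
| "app_expr Minus = Sub"
| "app_expr Times = Mul"
| "app_expr Over = Quot"

fun neutral :: "binop \<Rightarrow> nat" where
  "neutral Times = 1"
| "neutral _ = 0"

primrec bigop :: "binop \<Rightarrow> (nat \<Rightarrow> nat) \<Rightarrow> nat \<Rightarrow> nat" where
  "bigop f g 0 = neutral f"
| "bigop f g (Suc b) = app f (bigop f g b) (g b)"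

lemma bigop_Plus: "bigop Plus g b = (\<Sum>i<b. g i)"
  by (induction b) simp_all

lemma bigop_Times: "bigop Times g b = (\<Prod>i<b. g i)"
  by (induction b) (simp_all add: mult.commute)

text \<open>
  \<open>In a\<close> is the input cell with address \<open>a\<close>, and \<open>Big f x b e\<close> combines the values of \<open>e\<close> for
  \<open>x = 0, \<dots>, b - 1\<close> by \<open>f\<close>, from left to right.
\<close>

datatype tm = Num nat | Var nat | In tm | Op binop tm tm | Big binop nat tm tm

text \<open>
  In \<open>ev I V \<rho> e v s\<close>, all intermediate values are at most \<open>V\<close>, and \<open>s\<close> is an upper bound for
  the number of steps.
\<close>

inductive ev :: "memory \<Rightarrow> nat \<Rightarrow> (nat \<Rightarrow> nat) \<Rightarrow> tm \<Rightarrow> nat \<Rightarrow> nat \<Rightarrow> bool" for I V where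
  Num: "c \<le> V \<Longrightarrow> ev I V \<rho> (Num c) c 1"
| Var: "\<rho> x \<le> V \<Longrightarrow> ev I V \<rho> (Var x) (\<rho> x) 1"
| In: "ev I V \<rho> a x s \<Longrightarrow> I x \<le> V \<Longrightarrow> ev I V \<rho> (In a) (I x) (s + 1)"
| Op: "ev I V \<rho> a x s \<Longrightarrow> ev I V \<rho> b y s' \<Longrightarrow> app f x y \<le> V \<Longrightarrow> ev I V \<rho> (Op f a b) (app f x y) (s + s' + 1)"
| Big: "ev I V \<rho> b n s \<Longrightarrow> (\<And>i. i < n \<Longrightarrow> ev I V (\<rho>(x := i)) e (g i) h) \<Longrightarrow>
    (\<And>j. j \<le> n \<Longrightarrow> bigop f g j \<le> V) \<Longrightarrow> ev I V \<rho> (Big f x b e) (bigop f g n) (s + n * (h + 1) + 1)"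
| weaken: "ev I V \<rho> e v s \<Longrightarrow> s \<le> s' \<Longrightarrow> ev I V \<rho> e v s'"

lemma ev_le: "ev I V \<rho> e v s \<Longrightarrow> v \<le> V"
  by (induction rule: ev.induct) auto

text \<open>
  The cells behind the input hold alternately the variables and the intermediate results.
\<close>

definition cell :: "nat \<Rightarrow> expr" where
  "cell c = Add (Add (Mem (Const 0)) (Mem (Const 1))) (Const (2 + c))"

definition var :: "nat \<Rightarrow> expr" where "var x = cell (2 * x)"
definition tmp :: "nat \<Rightarrow> expr" where "tmp d = cell (2 * d + 1)"

text \<open>The value is left in temporary \<open>d\<close>, and lower temporaries are not touched.
  \<open>In\<close> guards its access, because cells behind the input are no longer 0 during the
  run. In \<open>Big\<close>, temporary \<open>d\<close> holds the bound, \<open>d + 1\<close> the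
  old value of the loop variable, to be restored afterwards, and \<open>d + 2\<close> the
  accumulator.\<close>

fun compile :: "nat \<Rightarrow> tm \<Rightarrow> prog" where
  "compile d (Num c) = Store (tmp d) (Const c)"
| "compile d (Var x) = Store (tmp d) (Mem (var x))"
| "compile d (In a) = Seq (compile d a)
     (If (Sub (cell 0) (Mem (tmp d))) (Store (tmp d) (Mem (Mem (tmp d)))) (Store (tmp d) (Const 0)))"
| "compile d (Op f a b) = Seq (compile d a) (Seq (compile (d + 1) b)
     (Store (tmp d) (app_expr f (Mem (tmp d)) (Mem (tmp (d + 1))))))"
| "compile d (Big f x b e) = Seq (compile d b) (Seq (Store (tmp (d + 1)) (Mem (var x)))
     (Seq (Store (tmp (d + 2)) (Const (neutral f))) (Seq (Store (var x) (Const 0))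
     (Seq (While (Sub (Mem (tmp d)) (Mem (var x)))
       (Seq (compile (d + 3) e)
         (Seq (Store (tmp (d + 2)) (app_expr f (Mem (tmp (d + 2))) (Mem (tmp (d + 3)))))
           (Store (var x) (Add (Mem (var x)) (Const 1))))))
     (Seq (Store (var x) (Mem (tmp (d + 1)))) (Store (tmp d) (Mem (tmp (d + 2)))))))))"

text \<open>The largest offset that is addressed. Logarithmic cost charges addresses too, so
  \<open>V\<close> has to bound them along with the values.\<close>

fun top_cell :: "nat \<Rightarrow> tm \<Rightarrow> nat" where
  "top_cell d (Num c) = 2 * d + 1"
| "top_cell d (Var x) = max (2 * d + 1) (2 * x)"
| "top_cell d (In a) = max (2 * d + 1) (top_cell d a)"
| "top_cell d (Op f a b) = max (2 * d + 3) (max (top_cell d a) (top_cell (d + 1) b))"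
| "top_cell d (Big f x b e) = max (2 * d + 7) (max (2 * x) (max (top_cell d b) (top_cell (d + 3) e)))"

section \<open>Executions with an upper bound on the time\<close>

definition run :: "prog \<Rightarrow> memory \<Rightarrow> nat \<Rightarrow> memory \<Rightarrow> bool" where
  "run p m B m' \<longleftrightarrow> (\<exists>T\<le>B. exec p m T m')"

lemma run_mono: "run p m B m' \<Longrightarrow> B \<le> B' \<Longrightarrow> run p m B' m'"
  by (meson run_def order_trans)

lemma run_Store:
  "1 + expr_cost a m + expr_cost b m \<le> B \<Longrightarrow> m' = m(val a m := val b m) \<Longrightarrow> run (Store a b) m B m'"
  unfolding run_def using exec.Store by blast

lemma run_Seq: "run p m B m' \<Longrightarrow> run q m' B' m'' \<Longrightarrow> run (Seq p q) m (B + B') m''"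
  unfolding run_def by (meson exec.Seq add_mono)

lemma run_IfTrue:
  assumes "val a m \<noteq> 0" "expr_cost a m \<le> A" "run p m B m'" shows "run (If a p q) m (1 + A + B) m'"
  using assms exec.IfTrue[of a m p _ m' q] unfolding run_def by (meson add_mono order_refl)

lemma run_IfFalse:
  assumes "val a m = 0" "expr_cost a m \<le> A" "run q m B m'" shows "run (If a p q) m (1 + A + B) m'"
  using assms exec.IfFalse[of a m q _ m' p] unfolding run_def by (meson add_mono order_refl)

lemma run_WhileTrue:
  assumes "val a m \<noteq> 0" "expr_cost a m \<le> A" "run p m B m'" "run (While a p) m' B' m''"
  shows "run (While a p) m (1 + A + B + B') m''"
  using assms exec.WhileTrue[of a m p _ m' _ m''] unfolding run_def by (meson add_mono order_refl)

lemma run_WhileFalse: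
  assumes "val a m = 0" "expr_cost a m \<le> A" shows "run (While a p) m (1 + A) m"
  using assms exec.WhileFalse[of a m p] unfolding run_def by (meson add_mono order_refl)

lemma len_mono: "x \<le> y \<Longrightarrow> len x \<le> len y"
  by (simp add: len_def floorlog_mono)

lemma len_pos: "1 \<le> len x"
  by (simp add: len_def)

section \<open>Correctness and cost of compiled terms\<close>

locale input_memory =
  fixes I :: memory and N V :: nat
  assumes N: "N = I 0 + I 1 + 2" and I_beyond: "N \<le> a \<Longrightarrow> I a = 0"
begin

definition mem :: "(nat \<Rightarrow> nat) \<Rightarrow> (nat \<Rightarrow> nat) \<Rightarrow> memory" where
  "mem \<rho> \<tau> a = (if a < N then I a
     else if even (a - N) then \<rho> ((a - N) div 2) else \<tau> ((a - N) div 2))"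

lemma mem_input: "a < N \<Longrightarrow> mem \<rho> \<tau> a = I a"
  by (simp add: mem_def)

lemma mem_01 [simp]: "mem \<rho> \<tau> 0 = I 0" "mem \<rho> \<tau> (Suc 0) = I 1"
proof -
  have "0 < N" "Suc 0 < N" using N by linarith+
  then show "mem \<rho> \<tau> 0 = I 0" "mem \<rho> \<tau> (Suc 0) = I 1" by (simp_all add: mem_def)
qed

definition var_addr :: "nat \<Rightarrow> nat" where "var_addr x = N + 2 * x"
definition tmp_addr :: "nat \<Rightarrow> nat" where "tmp_addr d = N + (2 * d + 1)"

lemma mem_var [simp]: "mem \<rho> \<tau> (var_addr x) = \<rho> x"
  by (simp add: mem_def var_addr_def)

lemma mem_tmp [simp]: "mem \<rho> \<tau> (tmp_addr d) = \<tau> d"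
  by (simp add: mem_def tmp_addr_def)

lemma mem_upd_var: "(mem \<rho> \<tau>)(var_addr x := v) = mem (\<rho>(x := v)) \<tau>"
  by (rule ext) (auto simp: mem_def var_addr_def elim!: evenE)

lemma mem_upd_tmp: "(mem \<rho> \<tau>)(tmp_addr d := v) = mem \<rho> (\<tau>(d := v))"
proof
  fix a
  have "a \<noteq> tmp_addr d \<Longrightarrow> N \<le> a \<Longrightarrow> odd (a - N) \<Longrightarrow> (a - N) div 2 \<noteq> d"
    unfolding tmp_addr_def by presburger
  then show "((mem \<rho> \<tau>)(tmp_addr d := v)) a = mem \<rho> (\<tau>(d := v)) a"
    by (cases "a = tmp_addr d") (simp_all add: mem_def[of _ _ a])
qed

lemma val_cell [simp]: "val (cell c) (mem \<rho> \<tau>) = N + c"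
proof -
  have "val (cell c) (mem \<rho> \<tau>) = I 0 + I 1 + (2 + c)" by (simp add: cell_def)
  then show ?thesis using N by linarith
qed

lemma val_var [simp]: "val (var x) (mem \<rho> \<tau>) = var_addr x"
  by (simp add: var_def var_addr_def)

lemma val_tmp [simp]: "val (tmp d) (mem \<rho> \<tau>) = tmp_addr d"
  by (simp add: tmp_def tmp_addr_def)

lemma len_le: "x \<le> V \<Longrightarrow> len x \<le> len V"
  by (rule len_mono)

lemma cost_cell: assumes "N + c \<le> V" shows "expr_cost (cell c) (mem \<rho> \<tau>) \<le> 7 * len V"
proof -
  have "0 \<le> V" "1 \<le> V" "I 0 \<le> V" "I 1 \<le> V" "I 0 + I 1 \<le> V" "2 + c \<le> V" "I 0 + I 1 + (2 + c) \<le> V"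
    using assms N by linarith+
  from this[THEN len_le] show ?thesis by (simp add: cell_def)
qed

lemma cost_var: "var_addr x \<le> V \<Longrightarrow> expr_cost (var x) (mem \<rho> \<tau>) \<le> 7 * len V"
  unfolding var_addr_def var_def by (rule cost_cell)

lemma cost_tmp: "tmp_addr d \<le> V \<Longrightarrow> expr_cost (tmp d) (mem \<rho> \<tau>) \<le> 7 * len V"
  unfolding tmp_addr_def tmp_def by (rule cost_cell)

lemma cost_Mem_var:
  "var_addr x \<le> V \<Longrightarrow> \<rho> x \<le> V \<Longrightarrow> expr_cost (Mem (var x)) (mem \<rho> \<tau>) \<le> 8 * len V"
  using cost_var[of x \<rho> \<tau>] len_le[of "\<rho> x"] by simp

lemma cost_Mem_tmp:
  "tmp_addr d \<le> V \<Longrightarrow> \<tau> d \<le> V \<Longrightarrow> expr_cost (Mem (tmp d)) (mem \<rho> \<tau>) \<le> 8 * len V"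
  using cost_tmp[of d \<rho> \<tau>] len_le[of "\<tau> d"] by simp

lemma val_app_expr: "val (app_expr f a b) m = app f (val a m) (val b m)"
  by (cases f) simp_all

lemma cost_app_expr: "expr_cost (app_expr f a b) m =
    expr_cost a m + expr_cost b m + len (app f (val a m) (val b m))"
  by (cases f) simp_all

lemma run_tmp:
  assumes "tmp_addr d \<le> V" "expr_cost b (mem \<rho> \<tau>) \<le> B"
  shows "run (Store (tmp d) b) (mem \<rho> \<tau>) (8 * len V + B) (mem \<rho> (\<tau>(d := val b (mem \<rho> \<tau>))))"
proof (rule run_Store)
  show "1 + expr_cost (tmp d) (mem \<rho> \<tau>) + expr_cost b (mem \<rho> \<tau>) \<le> 8 * len V + B"
    using cost_tmp[OF assms(1), of \<rho> \<tau>] assms(2) len_pos[of V] by linarith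
qed (simp add: mem_upd_tmp)

lemma run_var:
  assumes "var_addr x \<le> V" "expr_cost b (mem \<rho> \<tau>) \<le> B"
  shows "run (Store (var x) b) (mem \<rho> \<tau>) (8 * len V + B) (mem (\<rho>(x := val b (mem \<rho> \<tau>))) \<tau>)"
proof (rule run_Store)
  show "1 + expr_cost (var x) (mem \<rho> \<tau>) + expr_cost b (mem \<rho> \<tau>) \<le> 8 * len V + B"
    using cost_var[OF assms(1), of \<rho> \<tau>] assms(2) len_pos[of V] by linarith
qed (simp add: mem_upd_var)

text \<open>Arbitrary initial temporaries are allowed because a loop body starts with the leftovers
  of the previous pass; those below \<open>d\<close> hold pending operands and must survive. The
  factor 100 covers the largest overhead, that of \<open>Big\<close>, which is
  \<open>84 * len V\<close> outside the passes.\<close>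

definition computes :: "nat \<Rightarrow> tm \<Rightarrow> (nat \<Rightarrow> nat) \<Rightarrow> nat \<Rightarrow> nat \<Rightarrow> bool" where
  "computes d e \<rho> v s \<longleftrightarrow> (\<forall>\<tau>. \<exists>\<tau>'. \<tau>' d = v \<and> (\<forall>j<d. \<tau>' j = \<tau> j) \<and>
     run (compile d e) (mem \<rho> \<tau>) (100 * len V * s) (mem \<rho> \<tau>'))"

lemma computesE:
  assumes "computes d e \<rho> v s"
  obtains \<tau>' where "\<tau>' d = v" "\<And>j. j < d \<Longrightarrow> \<tau>' j = \<tau> j"
    "run (compile d e) (mem \<rho> \<tau>) (100 * len V * s) (mem \<rho> \<tau>')"
  using assms unfolding computes_def by metis

text \<open>Invariant: the loop variable is \<open>i\<close> and temporary \<open>d + 2\<close> is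
  \<open>bigop f g i\<close>. The bound in temporary \<open>d\<close> survives since the body works
  from \<open>d + 3\<close> on.\<close>

lemma run_loop:
  fixes f g e d x
  defines "body \<equiv> Seq (compile (d + 3) e)
         (Seq (Store (tmp (d + 2)) (app_expr f (Mem (tmp (d + 2))) (Mem (tmp (d + 3)))))
           (Store (var x) (Add (Mem (var x)) (Const 1))))"
  assumes cells: "var_addr x \<le> V" "tmp_addr d \<le> V" "tmp_addr (d + 2) \<le> V" "tmp_addr (d + 3) \<le> V" and n: "n \<le> V"
    and body: "\<And>i. i < n \<Longrightarrow> computes (d + 3) e (\<rho>(x := i)) (g i) h"
    and g: "\<And>i. i < n \<Longrightarrow> g i \<le> V" and acc: "\<And>j. j \<le> n \<Longrightarrow> bigop f g j \<le> V"
    and "i \<le> n" "\<tau> d = n" "\<tau> (d + 2) = bigop f g i"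
  shows "\<exists>\<tau>'. (\<forall>j<d+2. \<tau>' j = \<tau> j) \<and> \<tau>' (d + 2) = bigop f g n \<and>
     run (While (Sub (Mem (tmp d)) (Mem (var x))) body) (mem (\<rho>(x := i)) \<tau>)
       ((n - i) * (100 * len V * (h + 1)) + 18 * len V) (mem (\<rho>(x := n)) \<tau>')"
  using assms(10-12)
proof (induction "n - i" arbitrary: i \<tau>)
  case 0
  then have i: "i = n" by simp
  have "expr_cost (Sub (Mem (tmp d)) (Mem (var x))) (mem (\<rho>(x := i)) \<tau>) \<le> 17 * len V"
    using cost_Mem_tmp[of d \<tau> "\<rho>(x := i)"] cost_Mem_var[of x "\<rho>(x := i)" \<tau>] cells n 0 len_le[of 0] i
    by simp
  then have "run (While (Sub (Mem (tmp d)) (Mem (var x))) body) (mem (\<rho>(x := i)) \<tau>)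
      (1 + 17 * len V) (mem (\<rho>(x := i)) \<tau>)"
    using 0 i by (intro run_WhileFalse) simp_all
  then have "run (While (Sub (Mem (tmp d)) (Mem (var x))) body) (mem (\<rho>(x := i)) \<tau>)
      ((n - i) * (100 * len V * (h + 1)) + 18 * len V) (mem (\<rho>(x := i)) \<tau>)"
    by (rule run_mono) (use len_pos[of V] in simp)
  moreover have "\<tau> (d + 2) = bigop f g n" using 0 i by simp
  ultimately show ?case using i by blast
next
  case (Suc r)
  then have i: "i < n" by simp
  obtain \<tau>1 where t1: "\<tau>1 (d + 3) = g i" "\<And>j. j < d + 3 \<Longrightarrow> \<tau>1 j = \<tau> j"
    "run (compile (d + 3) e) (mem (\<rho>(x := i)) \<tau>) (100 * len V * h) (mem (\<rho>(x := i)) \<tau>1)"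
    using computesE[OF body[OF i]] by metis
  define \<tau>2 where "\<tau>2 = \<tau>1(d + 2 := bigop f g (Suc i))"
  have b2: "run (Store (tmp (d + 2)) (app_expr f (Mem (tmp (d + 2))) (Mem (tmp (d + 3)))))
      (mem (\<rho>(x := i)) \<tau>1) (8 * len V + 17 * len V) (mem (\<rho>(x := i)) \<tau>2)"
  proof -
    let ?e = "app_expr f (Mem (tmp (d + 2))) (Mem (tmp (d + 3)))"
    have v: "val ?e (mem (\<rho>(x := i)) \<tau>1) = bigop f g (Suc i)"
      using t1 Suc.prems by (simp only: val_app_expr val.simps val_tmp mem_tmp bigop.simps)
    have "expr_cost ?e (mem (\<rho>(x := i)) \<tau>1) \<le> 17 * len V"
      using cost_Mem_tmp[of "d + 2" \<tau>1 "\<rho>(x := i)"] cost_Mem_tmp[of "d + 3" \<tau>1 "\<rho>(x := i)"]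
        cells g[OF i] t1 acc[of i] len_le[OF acc[of "Suc i"]] i Suc.prems v
      by (simp add: cost_app_expr val_app_expr del: bigop.simps)
    from run_tmp[OF cells(3) this] show ?thesis unfolding v \<tau>2_def .
  qed
  have b3: "run (Store (var x) (Add (Mem (var x)) (Const 1))) (mem (\<rho>(x := i)) \<tau>2)
      (8 * len V + 10 * len V) (mem (\<rho>(x := Suc i)) \<tau>2)"
  proof -
    have "expr_cost (Add (Mem (var x)) (Const 1)) (mem (\<rho>(x := i)) \<tau>2) \<le> 10 * len V"
      using cost_Mem_var[of x "\<rho>(x := i)" \<tau>2] cells i n len_le[of 1] len_le[of "Suc i"] by simp
    from run_var[OF cells(1) this] show ?thesis by simp
  qed
  have b: "run body (mem (\<rho>(x := i)) \<tau>) (100 * len V * h + (25 * len V + 18 * len V))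
      (mem (\<rho>(x := Suc i)) \<tau>2)"
    unfolding body_def using run_Seq[OF t1(3) run_Seq[OF b2 b3]] by simp
  obtain \<tau>' where t': "\<forall>j<d+2. \<tau>' j = \<tau>2 j" "\<tau>' (d + 2) = bigop f g n"
    "run (While (Sub (Mem (tmp d)) (Mem (var x))) body) (mem (\<rho>(x := Suc i)) \<tau>2)
       ((n - Suc i) * (100 * len V * (h + 1)) + 18 * len V) (mem (\<rho>(x := n)) \<tau>')"
  proof -
    have "\<exists>\<tau>'. (\<forall>j<d+2. \<tau>' j = \<tau>2 j) \<and> \<tau>' (d + 2) = bigop f g n \<and>
      run (While (Sub (Mem (tmp d)) (Mem (var x))) body) (mem (\<rho>(x := Suc i)) \<tau>2)
       ((n - Suc i) * (100 * len V * (h + 1)) + 18 * len V) (mem (\<rho>(x := n)) \<tau>')"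
    proof (rule Suc.hyps(1))
      show "r = n - Suc i" using Suc.hyps(2) by simp
      show "\<tau>2 d = n" using Suc.prems(2) t1(2)[of d] by (simp add: \<tau>2_def)
    qed (use i in \<open>simp_all add: \<tau>2_def\<close>)
    then show thesis using that by blast
  qed
  have "expr_cost (Sub (Mem (tmp d)) (Mem (var x))) (mem (\<rho>(x := i)) \<tau>) \<le> 17 * len V"
    using cost_Mem_tmp[of d \<tau> "\<rho>(x := i)"] cost_Mem_var[of x "\<rho>(x := i)" \<tau>] cells n Suc.prems i
      len_le[of "n - i"] diff_le_self[of n i] by simp
  then have "run (While (Sub (Mem (tmp d)) (Mem (var x))) body) (mem (\<rho>(x := i)) \<tau>)
     (1 + 17 * len V + (100 * len V * h + (25 * len V + 18 * len V)) +
       ((n - Suc i) * (100 * len V * (h + 1)) + 18 * len V)) (mem (\<rho>(x := n)) \<tau>')"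
    using Suc.prems i by (intro run_WhileTrue[OF _ _ b t'(3)]) simp_all
  then have "run (While (Sub (Mem (tmp d)) (Mem (var x))) body) (mem (\<rho>(x := i)) \<tau>)
     ((n - i) * (100 * len V * (h + 1)) + 18 * len V) (mem (\<rho>(x := n)) \<tau>')"
  proof (rule run_mono)
    have 1: "n - i = Suc (n - Suc i)" using i by simp
    show "1 + 17 * len V + (100 * len V * h + (25 * len V + 18 * len V)) +
       ((n - Suc i) * (100 * len V * (h + 1)) + 18 * len V)
       \<le> (n - i) * (100 * len V * (h + 1)) + 18 * len V"
      using len_pos[of V] unfolding 1 mult_Suc distrib_left by linarith
  qed
  moreover have "\<forall>j<d+2. \<tau>' j = \<tau> j" using t'(1) t1(2) by (simp add: \<tau>2_def)
  ultimately show ?case using t'(2) by blast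
qed

theorem ev_computes:
  assumes "ev I V \<rho> e v s" "\<And>y. \<rho> y \<le> V" "N + top_cell d e \<le> V"
  shows "computes d e \<rho> v s"
  using assms
proof (induction arbitrary: d rule: ev.induct)
  case (Num c \<rho>)
  show ?case unfolding computes_def
  proof
    fix \<tau>
    have "run (compile d (tm.Num c)) (mem \<rho> \<tau>) (8 * len V + len V) (mem \<rho> (\<tau>(d := c)))"
      using Num run_tmp[of d "Const c" \<rho> \<tau> "len V"] len_le[of c] by (simp add: tmp_addr_def)
    then have "run (compile d (tm.Num c)) (mem \<rho> \<tau>) (100 * len V * 1) (mem \<rho> (\<tau>(d := c)))"
      by (rule run_mono) simp
    then show "\<exists>\<tau>'. \<tau>' d = c \<and> (\<forall>j<d. \<tau>' j = \<tau> j) \<and>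
        run (compile d (tm.Num c)) (mem \<rho> \<tau>) (100 * len V * 1) (mem \<rho> \<tau>')"
      by (intro exI[of _ "\<tau>(d := c)"]) simp
  qed
next
  case (Var \<rho> x)
  show ?case unfolding computes_def
  proof
    fix \<tau>
    have "tmp_addr d \<le> V" "var_addr x \<le> V" using Var.prems by (auto simp: tmp_addr_def var_addr_def)
    then have "run (compile d (tm.Var x)) (mem \<rho> \<tau>) (8 * len V + 8 * len V) (mem \<rho> (\<tau>(d := \<rho> x)))"
      using Var run_tmp[of d "Mem (var x)" \<rho> \<tau> "8 * len V"] cost_Mem_var[of x \<rho> \<tau>]
      by simp
    then have "run (compile d (tm.Var x)) (mem \<rho> \<tau>) (100 * len V * 1) (mem \<rho> (\<tau>(d := \<rho> x)))"
      by (rule run_mono) simp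
    then show "\<exists>\<tau>'. \<tau>' d = \<rho> x \<and> (\<forall>j<d. \<tau>' j = \<tau> j) \<and>
        run (compile d (tm.Var x)) (mem \<rho> \<tau>) (100 * len V * 1) (mem \<rho> \<tau>')"
      by (intro exI[of _ "\<tau>(d := \<rho> x)"]) simp
  qed
next
  case (In \<rho> a x s)
  have comp: "computes d a \<rho> x s" using In by auto
  have x: "x \<le> V" using In.hyps(1) ev_le by blast
  have cells: "tmp_addr d \<le> V" "N + 0 \<le> V" using In.prems by (auto simp: tmp_addr_def)
  show ?case unfolding computes_def
  proof
    fix \<tau>
    obtain \<tau>1 where t1: "\<tau>1 d = x" "\<And>j. j < d \<Longrightarrow> \<tau>1 j = \<tau> j"
      "run (compile d a) (mem \<rho> \<tau>) (100 * len V * s) (mem \<rho> \<tau>1)" using computesE[OF comp] by metis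
    let ?c = "Sub (cell 0) (Mem (tmp d))"
    have valc: "val ?c (mem \<rho> \<tau>1) = N - x" using t1(1) mem_tmp[of \<rho> \<tau>1 d] by simp
    have c: "expr_cost ?c (mem \<rho> \<tau>1) \<le> 16 * len V"
      using cost_cell[OF cells(2), of \<rho> \<tau>1] cost_Mem_tmp[OF cells(1), of \<tau>1 \<rho>] x t1(1)
        len_le[of "N - x"] diff_le_self[of N x] valc cells by simp
    have "run (If ?c (Store (tmp d) (Mem (Mem (tmp d)))) (Store (tmp d) (Const 0)))
        (mem \<rho> \<tau>1) (1 + 16 * len V + (8 * len V + 9 * len V)) (mem \<rho> (\<tau>1(d := I x)))"
    proof (cases "x < N")
      case True
      have "expr_cost (Mem (Mem (tmp d))) (mem \<rho> \<tau>1) \<le> 9 * len V"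
        using cost_Mem_tmp[OF cells(1), of \<tau>1 \<rho>] x t1(1) mem_tmp[of \<rho> \<tau>1 d]
          mem_input[OF True, of \<rho> \<tau>1] len_le[OF In.hyps(2)] by simp
      from run_tmp[OF cells(1) this]
      have "run (Store (tmp d) (Mem (Mem (tmp d)))) (mem \<rho> \<tau>1) (8 * len V + 9 * len V)
          (mem \<rho> (\<tau>1(d := I x)))"
        using t1(1) mem_tmp[of \<rho> \<tau>1 d]
          mem_input[OF True, of \<rho> \<tau>1] by simp
      then show ?thesis using valc c True by (intro run_IfTrue) simp_all
    next
      case False
      have "run (Store (tmp d) (Const 0)) (mem \<rho> \<tau>1) (8 * len V + 9 * len V) (mem \<rho> (\<tau>1(d := I x)))"
        using run_tmp[OF cells(1), of "Const 0" \<rho> \<tau>1 "9 * len V"] len_le[of 0] I_beyond[of x] False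
        by simp
      then show ?thesis using valc c False by (intro run_IfFalse) simp_all
    qed
    from run_Seq[OF t1(3) this]
    have "run (compile d (tm.In a)) (mem \<rho> \<tau>)
        (100 * len V * s + (1 + 16 * len V + (8 * len V + 9 * len V))) (mem \<rho> (\<tau>1(d := I x)))" by simp
    then have "run (compile d (tm.In a)) (mem \<rho> \<tau>) (100 * len V * (s + 1)) (mem \<rho> (\<tau>1(d := I x)))"
      by (rule run_mono) (use len_pos[of V] in \<open>simp add: algebra_simps\<close>)
    then show "\<exists>\<tau>'. \<tau>' d = I x \<and> (\<forall>j<d. \<tau>' j = \<tau> j) \<and>
        run (compile d (tm.In a)) (mem \<rho> \<tau>) (100 * len V * (s + 1)) (mem \<rho> \<tau>')"
      using t1(2) by (intro exI[of _ "\<tau>1(d := I x)"]) simp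
  qed
next
  case (Op \<rho> a x s b y s' f)
  have comp: "computes d a \<rho> x s" "computes (d + 1) b \<rho> y s'" using Op by auto
  have xy: "x \<le> V" "y \<le> V" using Op.hyps(1,2) ev_le by blast+
  have cells: "tmp_addr d \<le> V" "tmp_addr (d + 1) \<le> V" using Op.prems by (auto simp: tmp_addr_def)
  show ?case unfolding computes_def
  proof
    fix \<tau>
    obtain \<tau>1 where t1: "\<tau>1 d = x" "\<And>j. j < d \<Longrightarrow> \<tau>1 j = \<tau> j"
      "run (compile d a) (mem \<rho> \<tau>) (100 * len V * s) (mem \<rho> \<tau>1)" using computesE[OF comp(1)] by metis
    obtain \<tau>2 where t2: "\<tau>2 (d + 1) = y" "\<And>j. j < d + 1 \<Longrightarrow> \<tau>2 j = \<tau>1 j"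
      "run (compile (d + 1) b) (mem \<rho> \<tau>1) (100 * len V * s') (mem \<rho> \<tau>2)"
      using computesE[OF comp(2)] by metis
    let ?e = "app_expr f (Mem (tmp d)) (Mem (tmp (d + 1)))"
    have v: "val ?e (mem \<rho> \<tau>2) = app f x y"
      using t1 t2 by (simp only: val_app_expr val.simps val_tmp mem_tmp)
    have "expr_cost ?e (mem \<rho> \<tau>2) \<le> 17 * len V"
      using cost_Mem_tmp[OF cells(1), of \<tau>2 \<rho>] cost_Mem_tmp[OF cells(2), of \<tau>2 \<rho>]
        t1 t2 xy len_le[OF Op.hyps(3)] v by (simp add: cost_app_expr val_app_expr)
    from run_tmp[OF cells(1) this]
    have "run (Store (tmp d) ?e) (mem \<rho> \<tau>2) (8 * len V + 17 * len V) (mem \<rho> (\<tau>2(d := app f x y)))"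
      unfolding v .
    from run_Seq[OF t1(3) run_Seq[OF t2(3) this]]
    have "run (compile d (tm.Op f a b)) (mem \<rho> \<tau>)
        (100 * len V * s + (100 * len V * s' + (8 * len V + 17 * len V))) (mem \<rho> (\<tau>2(d := app f x y)))"
      by simp
    then have "run (compile d (tm.Op f a b)) (mem \<rho> \<tau>) (100 * len V * (s + s' + 1)) (mem \<rho> (\<tau>2(d := app f x y)))"
      by (rule run_mono) (simp add: algebra_simps)
    then show "\<exists>\<tau>'. \<tau>' d = app f x y \<and> (\<forall>j<d. \<tau>' j = \<tau> j) \<and>
        run (compile d (tm.Op f a b)) (mem \<rho> \<tau>) (100 * len V * (s + s' + 1)) (mem \<rho> \<tau>')"
      using t1(2) t2(2) by (intro exI[of _ "\<tau>2(d := app f x y)"]) simp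
  qed
next
  case (Big \<rho> b n s x e g h f)
  have cells: "var_addr x \<le> V" "tmp_addr d \<le> V" "tmp_addr (d + 2) \<le> V" "tmp_addr (d + 3) \<le> V"
    and cell1: "tmp_addr (d + 1) \<le> V"
    using Big.prems by (auto simp: var_addr_def tmp_addr_def)
  have n: "n \<le> V" using Big.hyps(1) ev_le by blast
  have comp: "computes d b \<rho> n s" using Big.IH(1) Big.prems by auto
  have body: "computes (d + 3) e (\<rho>(x := i)) (g i) h" if "i < n" for i
  proof (rule Big.IH(2)[OF that])
    show "(\<rho>(x := i)) y \<le> V" for y using Big.prems(1)[of y] that n by simp
    show "N + top_cell (d + 3) e \<le> V" using Big.prems(2) by simp
  qed
  have g: "g i \<le> V" if "i < n" for i using Big.hyps(2)[OF that] ev_le by blast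
  show ?case unfolding computes_def
  proof
    fix \<tau>
    obtain \<tau>1 where t1: "\<tau>1 d = n" "\<And>j. j < d \<Longrightarrow> \<tau>1 j = \<tau> j"
      "run (compile d b) (mem \<rho> \<tau>) (100 * len V * s) (mem \<rho> \<tau>1)" using computesE[OF comp] by metis
    have r1: "run (Store (tmp (d + 1)) (Mem (var x))) (mem \<rho> \<tau>1) (8 * len V + 8 * len V)
        (mem \<rho> (\<tau>1(d + 1 := \<rho> x)))"
      using run_tmp[of "d + 1" "Mem (var x)" \<rho> \<tau>1 "8 * len V"] cost_Mem_var[of x \<rho> \<tau>1] cells cell1 Big.prems(1)
      by simp
    define \<tau>2 where "\<tau>2 = \<tau>1(d + 1 := \<rho> x, d + 2 := neutral f)"
    have "neutral f \<le> V" using Big.hyps(3)[of 0] by simp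
    then have r2: "run (Store (tmp (d + 2)) (Const (neutral f))) (mem \<rho> (\<tau>1(d + 1 := \<rho> x)))
        (8 * len V + len V) (mem \<rho> \<tau>2)"
      using run_tmp[of "d + 2" "Const (neutral f)" \<rho> "\<tau>1(d + 1 := \<rho> x)" "len V"] len_le[of "neutral f"] cells
      by (simp add: \<tau>2_def)
    have r3: "run (Store (var x) (Const 0)) (mem \<rho> \<tau>2) (8 * len V + len V) (mem (\<rho>(x := 0)) \<tau>2)"
      using run_var[of x "Const 0" \<rho> \<tau>2 "len V"] len_le[of 0] cells by simp
    obtain \<tau>3 where t3: "\<forall>j<d+2. \<tau>3 j = \<tau>2 j" "\<tau>3 (d + 2) = bigop f g n"
      and r4: "run (While (Sub (Mem (tmp d)) (Mem (var x))) (Seq (compile (d + 3) e)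
         (Seq (Store (tmp (d + 2)) (app_expr f (Mem (tmp (d + 2))) (Mem (tmp (d + 3)))))
           (Store (var x) (Add (Mem (var x)) (Const 1)))))) (mem (\<rho>(x := 0)) \<tau>2)
       ((n - 0) * (100 * len V * (h + 1)) + 18 * len V) (mem (\<rho>(x := n)) \<tau>3)"
      using run_loop[OF cells n body g Big.hyps(3), of 0 \<tau>2] t1(1) by (auto simp: \<tau>2_def)
    have r5: "run (Store (var x) (Mem (tmp (d + 1)))) (mem (\<rho>(x := n)) \<tau>3) (8 * len V + 8 * len V)
        (mem \<rho> \<tau>3)"
      using run_var[of x "Mem (tmp (d + 1))" "\<rho>(x := n)" \<tau>3 "8 * len V"] mem_tmp[of "\<rho>(x := n)" \<tau>3 "d + 1"]
        cost_Mem_tmp[of "d + 1" \<tau>3 "\<rho>(x := n)"] cells cell1 t3 Big.prems(1) by (simp add: \<tau>2_def)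
    have r6: "run (Store (tmp d) (Mem (tmp (d + 2)))) (mem \<rho> \<tau>3) (8 * len V + 8 * len V)
        (mem \<rho> (\<tau>3(d := bigop f g n)))"
      using run_tmp[of d "Mem (tmp (d + 2))" \<rho> \<tau>3 "8 * len V"] mem_tmp[of \<rho> \<tau>3 "d + 2"]
        cost_Mem_tmp[of "d + 2" \<tau>3 \<rho>] cells cell1 t3 Big.hyps(3)[of n] by simp
    from run_Seq[OF t1(3) run_Seq[OF r1 run_Seq[OF r2 run_Seq[OF r3 run_Seq[OF r4 run_Seq[OF r5 r6]]]]]]
    have "run (compile d (tm.Big f x b e)) (mem \<rho> \<tau>) (100 * len V * s + (16 * len V + (9 * len V + (9 * len V +
        (n * (100 * len V * (h + 1)) + 18 * len V + (16 * len V + 16 * len V))))))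
        (mem \<rho> (\<tau>3(d := bigop f g n)))" by simp
    then have "run (compile d (tm.Big f x b e)) (mem \<rho> \<tau>) (100 * len V * (s + n * (h + 1) + 1))
        (mem \<rho> (\<tau>3(d := bigop f g n)))"
      by (rule run_mono) (simp add: algebra_simps)
    then show "\<exists>\<tau>'. \<tau>' d = bigop f g n \<and> (\<forall>j<d. \<tau>' j = \<tau> j) \<and>
        run (compile d (tm.Big f x b e)) (mem \<rho> \<tau>) (100 * len V * (s + n * (h + 1) + 1)) (mem \<rho> \<tau>')"
      using t1(2) t3(1) by (intro exI[of _ "\<tau>3(d := bigop f g n)"]) (simp add: \<tau>2_def)
  qed
next
  case (weaken \<rho> e v s s')
  then have "computes d e \<rho> v s" by blast
  moreover have "100 * len V * s \<le> 100 * len V * s'" using weaken.hyps(2) by simp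
  ultimately show ?case unfolding computes_def by (meson run_mono)
qed

end

section \<open>The search as a term\<close>

definition tm_n :: tm where "tm_n = In (Num 0)"
definition tm_k :: tm where "tm_k = In (Num 1)"

text \<open>Truth values are numbers, any nonzero value being true; truncated subtraction turns
  these into 0. Products serve as conjunctions, sums as disjunctions and bounded existential
  quantifiers.\<close>

definition tm_not :: "tm \<Rightarrow> tm" where "tm_not a = Op Minus (Num 1) a"
definition tm_le :: "tm \<Rightarrow> tm \<Rightarrow> tm" where "tm_le a b = tm_not (Op Minus a b)"
definition tm_less :: "tm \<Rightarrow> tm \<Rightarrow> tm" where "tm_less a b = tm_le (Op Plus a (Num 1)) b"
definition tm_mod :: "tm \<Rightarrow> tm \<Rightarrow> tm" where
  "tm_mod a b = Op Minus a (Op Times (Op Over a b) b)"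
definition tm_dist :: "tm \<Rightarrow> tm \<Rightarrow> tm" where
  "tm_dist a b = Op Plus (Op Minus a b) (Op Minus b a)"
definition tm_is1 :: "tm \<Rightarrow> tm" where "tm_is1 a = tm_not (tm_dist a (Num 1))"

text \<open>
  Sets of pattern elements are represented by variables holding their binary codes; the variables
  \<open>6\<close> and \<open>7\<close> are reserved for the auxiliary loops.
\<close>

definition tm_pow :: "tm \<Rightarrow> tm \<Rightarrow> tm" where "tm_pow a b = Big Times 7 b a"
definition tm_mem :: "nat \<Rightarrow> nat \<Rightarrow> tm" where
  "tm_mem x s = tm_mod (Op Over (Var s) (tm_pow (Num 2) (Var x))) (Num 2)"
definition tm_rank :: "nat \<Rightarrow> tm \<Rightarrow> tm" where "tm_rank s b = Big Plus 6 b (tm_mem 6 s)"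

text \<open>
  A map from a set to positions of the text is represented by a number whose \<open>n\<close>-adic digits are
  the images of the elements of the set, in increasing order.
\<close>

definition tm_dig :: "nat \<Rightarrow> nat \<Rightarrow> nat \<Rightarrow> tm" where
  "tm_dig a s x = tm_mod (Op Over (Var a) (tm_pow tm_n (tm_rank s (Var x)))) tm_n"

text \<open>
  The variables are \<open>0\<close> and \<open>1\<close> for the deleted set and its map, \<open>2\<close> and \<open>3\<close> for a part of the rest
  and its map, and \<open>4\<close>, \<open>5\<close>, \<open>8\<close> for pattern elements.
\<close>

definition tm_pos :: "nat \<Rightarrow> tm" where
  "tm_pos x = Op Plus (Op Plus (Op Times (tm_mem x 0) (tm_dig 1 0 x))
     (Op Times (tm_mem x 2) (tm_dig 3 2 x))) (Num 1)"
text \<open>Pattern elements are numbered from 0, so element \<open>x\<close> is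
  \<open>\<pi> (x + 1)\<close> in cell \<open>n + 1 + (x + 1)\<close>; text position
  \<open>p\<close>, counted from 1, is in cell \<open>p + 1\<close>.\<close>

definition tm_pat :: "nat \<Rightarrow> tm" where "tm_pat x = In (Op Plus tm_n (Op Plus (Var x) (Num 2)))"
definition tm_txt :: "nat \<Rightarrow> tm" where "tm_txt x = In (Op Plus (tm_pos x) (Num 1))"

definition tm_dom :: "nat \<Rightarrow> tm" where "tm_dom x = Op Plus (tm_mem x 0) (tm_mem x 2)"
definition tm_bad :: tm where
  "tm_bad = Op Plus (Op Times (tm_less (Var 4) (Var 5)) (tm_not (tm_less (tm_pos 4) (tm_pos 5))))
     (Op Times (tm_less (tm_pat 4) (tm_pat 5)) (tm_not (tm_less (tm_txt 4) (tm_txt 5))))"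
text \<open>All pairs of placed elements are tested, including nonadjacent ones: restrictions of an
  embedding pass this test as well.\<close>

definition tm_check :: tm where
  "tm_check = tm_not (Big Plus 4 tm_k (Big Plus 5 tm_k
     (Op Times (Op Times (tm_dom 4) (tm_dom 5)) tm_bad)))"

definition tm_adj :: tm where
  "tm_adj = Op Plus (tm_is1 (tm_dist (Var 4) (Var 5))) (tm_is1 (tm_dist (tm_pat 4) (tm_pat 5)))"
text \<open>Nonzero if the pair shows that the set is not a union of components of the remainder: an
  element of it was deleted, or is adjacent to an undeleted element outside.\<close>

definition tm_leak :: tm where
  "tm_leak = Op Times (tm_mem 4 2) (Op Plus (tm_mem 4 0)
     (Op Times (Op Times (tm_not (tm_mem 5 2)) (tm_not (tm_mem 5 0))) tm_adj))"
definition tm_part :: tm where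
  "tm_part = Op Times (tm_le (tm_rank 2 tm_k) (Num 100))
     (tm_not (Big Plus 4 tm_k (Big Plus 5 tm_k tm_leak)))"
text \<open>The coefficients 100 and 44 express the exponent 0.44k in integers. The nested negations
  say that every undeleted element is covered by some part.\<close>

definition tm_good :: tm where
  "tm_good = Op Times (tm_le (Op Times (Num 100) (tm_rank 0 tm_k)) (Op Times (Num 44) tm_k))
     (tm_not (Big Plus 8 tm_k (Op Times (tm_not (tm_mem 8 0))
       (tm_not (Big Plus 2 (tm_pow (Num 2) tm_k) (Op Times tm_part (tm_mem 8 2)))))))"
text \<open>The factors \<open>tm_good\<close> and \<open>tm_part\<close> in the loop bounds are
  guards: they make the loops over maps empty for unsuitable sets, which keeps the number of passes
  within the 0.44k-th and the 100th power of \<open>n\<close>. The two negations around the loop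
  over parts say that every part has a compatible map.\<close>

definition tm_main :: tm where
  "tm_main = Big Plus 0 (tm_pow (Num 2) tm_k)
     (Big Plus 1 (Op Times tm_good (tm_pow tm_n (tm_rank 0 tm_k)))
       (tm_not (Big Plus 2 (tm_pow (Num 2) tm_k) (Op Times tm_part
         (tm_not (Big Plus 3 (Op Times tm_part (tm_pow tm_n (tm_rank 2 tm_k))) tm_check))))))"

section \<open>Values and step counts of the terms\<close>

locale ppm =
  fixes I :: memory and n k V :: nat
  assumes I: "I 0 = n" "I 1 = k" "\<And>a. I a \<le> n"
    and kn: "k \<le> n" and V: "(n + 2) ^ (2 * k + 200) \<le> V"
begin

abbreviation E :: "(nat \<Rightarrow> nat) \<Rightarrow> tm \<Rightarrow> nat \<Rightarrow> nat \<Rightarrow> bool" where "E \<equiv> ev I V"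

text \<open>The largest counter sums over \<open>2 ^ k\<close> sets and at most
  \<open>(n + 2) ^ k\<close> maps each, hence \<open>2 * k\<close>; the 200 covers the maps of a
  part and numerical constants. The base is at least 2 even for \<open>n = 0\<close>.\<close>

lemma le_V_pow: "x \<le> (n + 2) ^ j \<Longrightarrow> j \<le> 2 * k + 200 \<Longrightarrow> x \<le> V"
proof -
  assume "x \<le> (n + 2) ^ j" "j \<le> 2 * k + 200"
  moreover from this(2) have "(n + 2) ^ j \<le> (n + 2) ^ (2 * k + 200)" by (intro power_increasing) auto
  ultimately show ?thesis using V by (meson order_trans)
qed

lemma le_V: "x \<le> 1000 * ((n + 2) * (n + 2)) \<Longrightarrow> x \<le> V"
proof -
  have "(1000::nat) \<le> 2 ^ 10" by simp
  also have "\<dots> \<le> (n + 2) ^ 10" by (intro power_mono) auto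
  finally have "1000 * ((n + 2) * (n + 2)) \<le> (n + 2) ^ 10 * ((n + 2) * (n + 2))" by (rule mult_right_mono) simp
  also have "\<dots> = (n + 2) ^ 12" by (simp flip: power_add power2_eq_square)
  finally show "x \<le> 1000 * ((n + 2) * (n + 2)) \<Longrightarrow> ?thesis" using le_V_pow[of x 12] by simp
qed

lemma le_V_lin: "x \<le> 1000 * (n + 2) \<Longrightarrow> x \<le> V"
  by (rule le_V) (erule order_trans, simp)

lemma I_le_V: "I a \<le> V"
  using I(3)[of a] by (intro le_V_lin) simp

text \<open>Unlike \<open>k\<close>, this is never 0, so lower powers are always absorbed by higher
  ones.\<close>

definition w :: nat where "w = k + 1"

lemma w_pow: "1 \<le> w" "w \<le> w ^ 2" "w ^ 2 \<le> w ^ 3" "w ^ 3 \<le> w ^ 4"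
proof -
  show 1: "1 \<le> w" by (simp add: w_def)
  show "w \<le> w ^ 2" using power_increasing[of 1 2 w] 1 by simp
  show "w ^ 2 \<le> w ^ 3" "w ^ 3 \<le> w ^ 4" using 1 by (intro power_increasing; simp)+
qed

lemma E_cong: "E \<rho> e v s \<Longrightarrow> v = v' \<Longrightarrow> s \<le> s' \<Longrightarrow> E \<rho> e v' s'"
  using ev.weaken by blast

lemma E_Op:
  assumes "E \<rho> a x s" "E \<rho> b y s'" "app f x y = v" "v \<le> V" "s + s' + 1 \<le> r"
  shows "E \<rho> (Op f a b) v r"
  using ev.weaken[OF ev.Op[OF assms(1,2), of f] assms(5)] assms(3,4) by simp

lemma E_Num: "c \<le> 1000 \<Longrightarrow> E \<rho> (Num c) c 1"
  by (rule ev.Num) (rule le_V_lin, simp)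

lemma E_n: "E \<rho> tm_n n 2" and E_k: "E \<rho> tm_k k 2"
  using ev.In[OF E_Num[of 0 \<rho>] I_le_V] ev.In[OF E_Num[of 1 \<rho>] I_le_V]
  by (simp_all add: tm_n_def tm_k_def I[unfolded One_nat_def] numeral_2_eq_2)

lemma E_not: "E \<rho> a x s \<Longrightarrow> E \<rho> (tm_not a) (of_bool (x = 0)) (s + 2)"
  unfolding tm_not_def by (rule E_Op[OF E_Num]) (auto intro: le_V_lin)

lemma E_le: "E \<rho> a x s \<Longrightarrow> E \<rho> b y s' \<Longrightarrow> E \<rho> (tm_le a b) (of_bool (x \<le> y)) (s + s' + 3)"
  unfolding tm_le_def
  using E_not[OF E_Op[of \<rho> a x s b y s' Minus "x - y" "s + s' + 1"]] ev_le[of I V \<rho> a x s]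
  by (simp add: numeral_3_eq_3)

lemma E_less:
  assumes "E \<rho> a x s" "E \<rho> b y s'" "x + 1 \<le> V"
  shows "E \<rho> (tm_less a b) (of_bool (x < y)) (s + s' + 5)"
proof -
  have "E \<rho> (Op Plus a (Num 1)) (x + 1) (s + 2)"
    by (rule E_Op[OF assms(1) E_Num]) (use assms(3) in simp_all)
  from E_le[OF this assms(2)] show ?thesis by (simp add: tm_less_def Suc_le_eq algebra_simps)
qed

lemma E_mod:
  assumes "E \<rho> a x s" "E \<rho> b y s'" shows "E \<rho> (tm_mod a b) (x mod y) (2 * s + 2 * s' + 3)"
proof -
  have x: "x \<le> V" using ev_le assms(1) by blast
  have "E \<rho> (Op Over a b) (x div y) (s + s' + 1)"
    by (rule E_Op[OF assms]) (use x div_le_dividend[of x y] order_trans in \<open>auto simp del: div_le_dividend\<close>)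
  then have "E \<rho> (Op Times (Op Over a b) b) (x div y * y) (s + 2 * s' + 2)"
    by (rule E_Op[OF _ assms(2)]) (use x div_times_less_eq_dividend[of x y] order_trans in \<open>auto simp del: div_times_less_eq_dividend\<close>)
  then show ?thesis unfolding tm_mod_def
    by (rule E_Op[OF assms(1)]) (use x mod_less_eq_dividend[of x y] order_trans in
      \<open>auto simp: minus_div_mult_eq_mod simp del: mod_less_eq_dividend\<close>)
qed

lemma E_dist:
  assumes "E \<rho> a x s" "E \<rho> b y s'" "x + y \<le> V"
  shows "E \<rho> (tm_dist a b) ((x - y) + (y - x)) (2 * s + 2 * s' + 3)"
proof -
  have "E \<rho> (Op Minus a b) (x - y) (s + s' + 1)" by (rule E_Op[OF assms(1,2)]) (use assms(3) in simp_all)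
  moreover have "E \<rho> (Op Minus b a) (y - x) (s + s' + 1)" by (rule E_Op[OF assms(2,1)]) (use assms(3) in simp_all)
  ultimately show ?thesis unfolding tm_dist_def by (rule E_Op) (use assms(3) in simp_all)
qed

lemma E_is1:
  assumes "E \<rho> a x s" "x + 1 \<le> V" shows "E \<rho> (tm_is1 a) (of_bool (x = 1)) (2 * s + 7)"
proof -
  have "E \<rho> (tm_not (tm_dist a (Num 1))) (of_bool ((x - 1) + (1 - x) = 0)) (2 * s + 2 * 1 + 3 + 2)"
    using assms by (intro E_not E_dist E_Num) simp_all
  moreover have "(x - 1) + (1 - x) = 0 \<longleftrightarrow> x = 1" by arith
  ultimately show ?thesis unfolding tm_is1_def by (elim E_cong) simp_all
qed

lemma E_pow:
  assumes "E \<rho> b r s" "\<And>i. E (\<rho>(7 := i)) a v h" "\<And>j. j \<le> r \<Longrightarrow> v ^ j \<le> V"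
  shows "E \<rho> (tm_pow a b) (v ^ r) (s + r * (h + 1) + 1)"
proof -
  have "bigop Times (\<lambda>_. v) j = v ^ j" for j by (simp add: bigop_Times)
  then show ?thesis
    using ev.Big[OF assms(1), of 7 a "\<lambda>_. v" h Times] assms(2,3) by (simp add: tm_pow_def)
qed

lemma E_pow2: "E \<rho> b r s \<Longrightarrow> r \<le> k \<Longrightarrow> E \<rho> (tm_pow (Num 2) b) (2 ^ r) (s + r * 2 + 1)"
proof -
  assume a: "E \<rho> b r s" "r \<le> k"
  have "2 ^ j \<le> V" if "j \<le> r" for j
    by (rule le_V_pow[of _ j]) (use that a in \<open>auto intro: power_mono\<close>)
  from E_pow[OF a(1) E_Num[of 2] this] show ?thesis by (rule E_cong) simp_all
qed

lemma E_pown: "E \<rho> b r s \<Longrightarrow> r \<le> k \<Longrightarrow> E \<rho> (tm_pow tm_n b) (n ^ r) (s + r * 3 + 1)"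
proof -
  assume a: "E \<rho> b r s" "r \<le> k"
  have "n ^ j \<le> V" if "j \<le> r" for j
    by (rule le_V_pow[of _ j]) (use that a in \<open>auto intro: power_mono\<close>)
  from E_pow[OF a(1) E_n this] show ?thesis by (rule E_cong) simp_all
qed

lemma E_mem:
  assumes "\<rho> x = r" "\<rho> s = c" "r < k" "c \<le> V"
  shows "E \<rho> (tm_mem x s) (of_bool (r \<in> set_decode c)) (13 * w)"
proof -
  have rV: "r \<le> V" by (rule le_V_lin) (use assms(3) kn in simp)
  have "E \<rho> (Var x) r 1" "E \<rho> (Var s) c 1"
    using ev.Var[of \<rho> x V I] ev.Var[of \<rho> s V I] assms rV by auto
  then have "E \<rho> (Op Over (Var s) (tm_pow (Num 2) (Var x))) (c div 2 ^ r) (r * 2 + 4)"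
    using assms(3,4) div_le_dividend[of c "2 ^ r"]
    by (intro E_Op[OF _ E_pow2[of _ _ r 1], of _ _ c 1]) (auto simp del: div_le_dividend)
  from E_mod[OF this E_Num[of 2]]
  have "E \<rho> (tm_mem x s) (of_bool (r \<in> set_decode c)) (2 * (r * 2 + 4) + 2 * 1 + 3)"
    by (simp add: tm_mem_def set_decode_def mod_2_eq_odd)
  then show ?thesis by (rule ev.weaken) (use assms(3) in \<open>simp add: w_def\<close>)
qed

definition rk :: "nat \<Rightarrow> nat \<Rightarrow> nat" where "rk c r = card (set_decode c \<inter> {..<r})"

lemma rk_le: "rk c r \<le> r"
  using card_mono[of "{..<r}" "set_decode c \<inter> {..<r}"] by (simp add: rk_def)

lemma E_rank:
  assumes "E \<rho> b r s'" "\<rho> s = c" "r \<le> k" "c \<le> V" "s \<noteq> 6"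
  shows "E \<rho> (tm_rank s b) (rk c r) (s' + 14 * w ^ 2)"
proof -
  have sum: "(\<Sum>i<j. of_bool (i \<in> set_decode c)) = rk c j" for j
    by (simp add: rk_def Int_commute Collect_mem_eq)
  have "E \<rho> (tm_rank s b) (bigop Plus (\<lambda>i. of_bool (i \<in> set_decode c)) r) (s' + r * (13 * w + 1) + 1)"
    unfolding tm_rank_def
  proof (rule ev.Big[OF assms(1)])
    fix i assume "i < r"
    then show "E (\<rho>(6 := i)) (tm_mem 6 s) (of_bool (i \<in> set_decode c)) (13 * w)"
      using assms by (intro E_mem) auto
  next
    fix j assume "j \<le> r"
    then show "bigop Plus (\<lambda>i. of_bool (i \<in> set_decode c)) j \<le> V"
      using assms(3) kn rk_le[of c j] unfolding bigop_Plus sum by (intro le_V_lin) simp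
  qed
  then have "E \<rho> (tm_rank s b) (rk c r) (s' + r * (13 * w + 1) + 1)" unfolding bigop_Plus sum .
  moreover have "r * (13 * w + 1) + 1 \<le> 14 * w ^ 2"
  proof -
    have "r * (13 * w + 1) \<le> k * (14 * w)" using assms(3) by (intro mult_mono) (auto simp: w_def)
    also have "\<dots> + 1 \<le> 14 * w ^ 2" by (simp add: w_def power2_eq_square algebra_simps)
    finally show ?thesis by simp
  qed
  ultimately show ?thesis by (elim ev.weaken) simp
qed

lemma E_Var: "\<rho> x \<le> V \<Longrightarrow> E \<rho> (Var x) (\<rho> x) 1"
  by (rule ev.Var)

lemma E_sum:
  assumes "E \<rho> b m s" "\<And>i. i < m \<Longrightarrow> E (\<rho>(x := i)) e (g i) h" "(\<Sum>i<m. g i) \<le> V"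
  shows "E \<rho> (Big Plus x b e) (\<Sum>i<m. g i) (s + m * (h + 1) + 1)"
proof -
  have "bigop Plus g j \<le> V" if "j \<le> m" for j
  proof -
    have "(\<Sum>i<j. g i) \<le> (\<Sum>i<m. g i)" using that by (intro sum_mono2) auto
    then show ?thesis using assms(3) by (simp add: bigop_Plus)
  qed
  from ev.Big[OF assms(1,2) this] show ?thesis by (simp add: bigop_Plus)
qed

lemma sum_le_mult: "(\<And>i. i < m \<Longrightarrow> g i \<le> c) \<Longrightarrow> (\<Sum>i<m. g i) \<le> m * c" for g :: "nat \<Rightarrow> nat"
  using sum_bounded_above[of "{..<m}" g c] by simp

text \<open>A loop over the pattern elements raises the power of \<open>w\<close> by one and the
  coefficient by 4.\<close>

lemma loop_bound: "k * (c * w ^ i + 1) + 3 \<le> (c + 4) * w ^ Suc i"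
proof -
  have "1 \<le> w ^ i" by (simp add: w_def)
  then have "k * (c * w ^ i + 1) \<le> w * (c * w ^ i + w ^ i)" by (intro mult_mono) (auto simp: w_def)
  moreover have "1 \<le> w ^ Suc i" by (rule one_le_power) (simp add: w_def)
  moreover have "w * (c * w ^ i + w ^ i) = c * w ^ Suc i + w ^ Suc i" by (simp add: algebra_simps)
  ultimately show ?thesis unfolding distrib_right by linarith
qed

definition digit :: "nat \<Rightarrow> nat \<Rightarrow> nat" where "digit a r = a div n ^ r mod n"

text \<open>For disjoint sets at most one product is nonzero, so the sum selects the map responsible
  for \<open>x\<close>; the final 1 turns a digit below \<open>n\<close> into a text
  position.\<close>

definition posv :: "nat \<Rightarrow> nat \<Rightarrow> nat \<Rightarrow> nat \<Rightarrow> nat \<Rightarrow> nat" where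
  "posv S a W b x = of_bool (x \<in> set_decode S) * digit a (rk S x)
     + of_bool (x \<in> set_decode W) * digit b (rk W x) + 1"
definition patv :: "nat \<Rightarrow> nat" where "patv x = I (n + (x + 2))"
definition domv :: "nat \<Rightarrow> nat \<Rightarrow> nat \<Rightarrow> nat" where
  "domv S W x = of_bool (x \<in> set_decode S) + of_bool (x \<in> set_decode W)"
definition badv :: "nat \<Rightarrow> nat \<Rightarrow> nat \<Rightarrow> nat \<Rightarrow> nat \<Rightarrow> nat \<Rightarrow> nat" where
  "badv S a W b x y = of_bool (x < y) * of_bool (\<not> posv S a W b x < posv S a W b y) +
     of_bool (patv x < patv y) * of_bool (\<not> I (posv S a W b x + 1) < I (posv S a W b y + 1))"
definition checkv :: "nat \<Rightarrow> nat \<Rightarrow> nat \<Rightarrow> nat \<Rightarrow> nat" where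
  "checkv S a W b = of_bool ((\<Sum>x<k. \<Sum>y<k. domv S W x * domv S W y * badv S a W b x y) = 0)"
definition adjv :: "nat \<Rightarrow> nat \<Rightarrow> nat" where
  "adjv x y = of_bool ((x - y) + (y - x) = 1) +
     of_bool ((patv x - patv y) + (patv y - patv x) = 1)"
definition leakv :: "nat \<Rightarrow> nat \<Rightarrow> nat \<Rightarrow> nat \<Rightarrow> nat" where
  "leakv S W x y = of_bool (x \<in> set_decode W) * (of_bool (x \<in> set_decode S) +
     of_bool (y \<notin> set_decode W) * of_bool (y \<notin> set_decode S) * adjv x y)"
definition partv :: "nat \<Rightarrow> nat \<Rightarrow> nat" where
  "partv S W = of_bool (rk W k \<le> 100) * of_bool ((\<Sum>x<k. \<Sum>y<k. leakv S W x y) = 0)"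
definition goodv :: "nat \<Rightarrow> nat" where
  "goodv S = of_bool (100 * rk S k \<le> 44 * k) * of_bool ((\<Sum>x<k. of_bool (x \<notin> set_decode S) *
     of_bool ((\<Sum>W<2^k. partv S W * of_bool (x \<in> set_decode W)) = 0)) = (0::nat))"
definition mainv :: nat where
  "mainv = (\<Sum>S<2^k. \<Sum>a<goodv S * n ^ rk S k. of_bool ((\<Sum>W<2^k. partv S W *
     of_bool ((\<Sum>b<partv S W * n ^ rk W k. checkv S a W b) = 0)) = 0))"

lemma E_dig:
  assumes "\<rho> x = r" "r < k" "\<rho> s = c" "\<rho> a = d" "c \<le> V" "d \<le> V" "s \<noteq> 6"
  shows "E \<rho> (tm_dig a s x) (digit d (rk c r)) (50 * w ^ 2)"
proof -
  have rV: "r \<le> V" by (rule le_V_lin) (use assms(2) kn in simp)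
  have "E \<rho> (Var x) r 1" "E \<rho> (Var a) d 1" using E_Var[of \<rho> x] E_Var[of \<rho> a] assms rV by auto
  moreover from this(1) have "E \<rho> (tm_rank s (Var x)) (rk c r) (1 + 14 * w ^ 2)"
    by (rule E_rank) (use assms in auto)
  then have "E \<rho> (tm_pow tm_n (tm_rank s (Var x))) (n ^ rk c r) (1 + 14 * w ^ 2 + rk c r * 3 + 1)"
    by (rule E_pown) (use rk_le[of c r] assms(2) in simp)
  ultimately have "E \<rho> (Op Over (Var a) (tm_pow tm_n (tm_rank s (Var x)))) (d div n ^ rk c r)
      (14 * w ^ 2 + rk c r * 3 + 4)"
    using div_le_dividend[of d "n ^ rk c r"] assms(6)
    by (intro E_Op) (auto simp del: div_le_dividend)
  from E_mod[OF this E_n]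
  show ?thesis unfolding tm_dig_def
    by (rule E_cong) (use rk_le[of c r] assms(2) w_pow in \<open>simp_all add: digit_def w_def\<close>)
qed

lemma digit_le: "r < k \<Longrightarrow> digit a i < n"
  using kn by (simp add: digit_def)

definition bd :: "(nat \<Rightarrow> nat) \<Rightarrow> bool" where "bd \<rho> \<longleftrightarrow> (\<forall>x. \<rho> x \<le> V)"

lemma bdD: "bd \<rho> \<Longrightarrow> \<rho> x \<le> V"
  by (simp add: bd_def)

lemma bd_upd [simp]: "bd \<rho> \<Longrightarrow> v \<le> V \<Longrightarrow> bd (\<rho>(x := v))"
  by (simp add: bd_def)

lemma E_Var': "bd \<rho> \<Longrightarrow> E \<rho> (Var x) (\<rho> x) 1"
  by (rule E_Var) (rule bdD)

lemma k_le_V: "x < k \<Longrightarrow> x \<le> V"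
  using kn by (intro le_V_lin) simp

lemma E_mem': "bd \<rho> \<Longrightarrow> \<rho> x < k \<Longrightarrow> E \<rho> (tm_mem x s) (of_bool (\<rho> x \<in> set_decode (\<rho> s))) (13 * w)"
  by (rule E_mem) (auto simp: bdD)

lemma E_pos:
  assumes "bd \<rho>" "\<rho> x < k"
  shows "E \<rho> (tm_pos x) (posv (\<rho> 0) (\<rho> 1) (\<rho> 2) (\<rho> 3) (\<rho> x)) (140 * w ^ 2)"
proof -
  have d: "E \<rho> (tm_dig 1 0 x) (digit (\<rho> 1) (rk (\<rho> 0) (\<rho> x))) (50 * w ^ 2)"
    "E \<rho> (tm_dig 3 2 x) (digit (\<rho> 3) (rk (\<rho> 2) (\<rho> x))) (50 * w ^ 2)"
    using assms by (auto intro!: E_dig simp: bdD)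
  have l: "digit (\<rho> 1) (rk (\<rho> 0) (\<rho> x)) < n" "digit (\<rho> 3) (rk (\<rho> 2) (\<rho> x)) < n"
    using assms digit_le by auto
  have v: "c \<le> V" if "c \<le> 2 * n + 1" for c using that by (intro le_V_lin) simp
  have 1: "E \<rho> (Op Times (tm_mem x 0) (tm_dig 1 0 x))
      (of_bool (\<rho> x \<in> set_decode (\<rho> 0)) * digit (\<rho> 1) (rk (\<rho> 0) (\<rho> x))) (13 * w + 50 * w ^ 2 + 1)"
    by (rule E_Op[OF E_mem'[OF assms] d(1)]) (use l in \<open>auto intro!: v\<close>)
  have 2: "E \<rho> (Op Times (tm_mem x 2) (tm_dig 3 2 x))
      (of_bool (\<rho> x \<in> set_decode (\<rho> 2)) * digit (\<rho> 3) (rk (\<rho> 2) (\<rho> x))) (13 * w + 50 * w ^ 2 + 1)"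
    by (rule E_Op[OF E_mem'[OF assms] d(2)]) (use l in \<open>auto intro!: v\<close>)
  show ?thesis unfolding tm_pos_def
    by (rule E_Op[OF E_Op[OF 1 2 refl _ order_refl] E_Num[of 1]])
      (use l w_pow in \<open>auto intro!: v simp: posv_def\<close>)
qed

lemma posv_le: "x < k \<Longrightarrow> posv S a W b x \<le> 2 * n"
proof -
  assume "x < k"
  then have "digit a (rk S x) < n" "digit b (rk W x) < n" using digit_le by auto
  then show ?thesis by (simp add: posv_def)
qed

lemma E_pat: "bd \<rho> \<Longrightarrow> \<rho> x < k \<Longrightarrow> E \<rho> (tm_pat x) (patv (\<rho> x)) 7"
proof -
  assume a: "bd \<rho>" "\<rho> x < k"
  have "E \<rho> (Op Plus (Var x) (Num 2)) (\<rho> x + 2) 3"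
    by (rule E_Op[OF E_Var'[OF a(1)] E_Num[of 2]]) (use a kn in \<open>auto intro!: le_V_lin\<close>)
  then have "E \<rho> (Op Plus tm_n (Op Plus (Var x) (Num 2))) (n + (\<rho> x + 2)) 6"
    by (rule E_Op[OF E_n]) (use a kn in \<open>auto intro!: le_V_lin\<close>)
  from ev.In[OF this I_le_V] show ?thesis unfolding tm_pat_def patv_def by (rule E_cong) simp_all
qed

lemma E_txt:
  assumes "bd \<rho>" "\<rho> x < k"
  shows "E \<rho> (tm_txt x) (I (posv (\<rho> 0) (\<rho> 1) (\<rho> 2) (\<rho> 3) (\<rho> x) + 1)) (140 * w ^ 2 + 3)"
proof -
  have "posv (\<rho> 0) (\<rho> 1) (\<rho> 2) (\<rho> 3) (\<rho> x) + 1 \<le> V"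
    using posv_le[OF assms(2), of "\<rho> 0" "\<rho> 1" "\<rho> 2" "\<rho> 3"] by (intro le_V_lin) simp
  then have "E \<rho> (Op Plus (tm_pos x) (Num 1)) (posv (\<rho> 0) (\<rho> 1) (\<rho> 2) (\<rho> 3) (\<rho> x) + 1) (140 * w ^ 2 + 2)"
    by (intro E_Op[OF E_pos[OF assms] E_Num[of 1]]) auto
  from ev.In[OF this I_le_V] show ?thesis unfolding tm_txt_def by (rule E_cong) simp_all
qed

lemma E_not_less:
  assumes "E \<rho> a x s" "E \<rho> b y s'" "x + 1 \<le> V"
  shows "E \<rho> (tm_not (tm_less a b)) (of_bool (\<not> x < y)) (s + s' + 7)"
  using E_not[OF E_less[OF assms]] by (rule E_cong) auto

lemma E_bad:
  assumes "bd \<rho>" "\<rho> 4 < k" "\<rho> 5 < k"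
  shows "E \<rho> tm_bad (badv (\<rho> 0) (\<rho> 1) (\<rho> 2) (\<rho> 3) (\<rho> 4) (\<rho> 5)) (610 * w ^ 2)"
proof -
  note var = E_Var'[OF assms(1)]
  have v: "c \<le> V" if "c \<le> 2 * n + 2" for c using that by (intro le_V_lin) simp
  have v1: "\<rho> 4 + 1 \<le> V" "posv (\<rho> 0) (\<rho> 1) (\<rho> 2) (\<rho> 3) (\<rho> 4) + 1 \<le> V" "patv (\<rho> 4) + 1 \<le> V"
    "I (posv (\<rho> 0) (\<rho> 1) (\<rho> 2) (\<rho> 3) (\<rho> 4) + 1) + 1 \<le> V"
    using assms kn posv_le[of "\<rho> 4" "\<rho> 0" "\<rho> 1" "\<rho> 2" "\<rho> 3"] I(3) unfolding patv_def
    by (auto intro!: v intro: order_trans[of _ "Suc n"])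
  have 1: "E \<rho> (Op Times (tm_less (Var 4) (Var 5)) (tm_not (tm_less (tm_pos 4) (tm_pos 5))))
     (of_bool (\<rho> 4 < \<rho> 5) * of_bool (\<not> posv (\<rho> 0) (\<rho> 1) (\<rho> 2) (\<rho> 3) (\<rho> 4)
        < posv (\<rho> 0) (\<rho> 1) (\<rho> 2) (\<rho> 3) (\<rho> 5))) (280 * w ^ 2 + 15)"
    by (rule E_Op[OF E_less[OF var var v1(1)] E_not_less[OF E_pos[OF assms(1,2)] E_pos[OF assms(1,3)] v1(2)]])
      (auto intro!: v)
  have 2: "E \<rho> (Op Times (tm_less (tm_pat 4) (tm_pat 5)) (tm_not (tm_less (tm_txt 4) (tm_txt 5))))
     (of_bool (patv (\<rho> 4) < patv (\<rho> 5)) * of_bool (\<not> I (posv (\<rho> 0) (\<rho> 1) (\<rho> 2) (\<rho> 3) (\<rho> 4) + 1)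
        < I (posv (\<rho> 0) (\<rho> 1) (\<rho> 2) (\<rho> 3) (\<rho> 5) + 1))) (280 * w ^ 2 + 33)"
    by (rule E_Op[OF E_less[OF E_pat[OF assms(1,2)] E_pat[OF assms(1,3)] v1(3)]
      E_not_less[OF E_txt[OF assms(1,2)] E_txt[OF assms(1,3)] v1(4)]]) (auto intro!: v)
  show ?thesis unfolding tm_bad_def badv_def
    by (rule E_Op[OF 1 2]) (use w_pow in \<open>auto intro!: v\<close>)
qed

lemma E_dom: "bd \<rho> \<Longrightarrow> \<rho> x < k \<Longrightarrow> E \<rho> (tm_dom x) (domv (\<rho> 0) (\<rho> 2) (\<rho> x)) (26 * w + 1)"
  unfolding tm_dom_def domv_def by (rule E_Op[OF E_mem' E_mem']) (auto intro!: le_V_lin)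

lemma domv_le: "domv S W x \<le> 2" and badv_le: "badv S a W b x y \<le> 2"
  by (auto simp: domv_def badv_def)

lemma E_check:
  assumes "bd \<rho>"
  shows "E \<rho> tm_check (checkv (\<rho> 0) (\<rho> 1) (\<rho> 2) (\<rho> 3)) (700 * w ^ 4)"
proof -
  let ?g = "\<lambda>x y. domv (\<rho> 0) (\<rho> 2) x * domv (\<rho> 0) (\<rho> 2) y * badv (\<rho> 0) (\<rho> 1) (\<rho> 2) (\<rho> 3) x y"
  have g: "?g x y \<le> 8" for x y
    by (rule order_trans[OF mult_le_mono[OF mult_le_mono[OF domv_le domv_le] badv_le]]) simp
  have s1: "(\<Sum>y<k. ?g x y) \<le> k * 8" for x by (rule sum_le_mult) (rule g)
  then have s2: "(\<Sum>x<k. \<Sum>y<k. ?g x y) \<le> k * (k * 8)" by (rule sum_le_mult)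
  have body: "E (\<rho>(4 := x, 5 := y)) (Op Times (Op Times (tm_dom 4) (tm_dom 5)) tm_bad) (?g x y) (670 * w ^ 2)"
    if "x < k" "y < k" for x y
  proof -
    let ?r = "\<rho>(4 := x, 5 := y)"
    have r: "bd ?r" "?r 4 < k" "?r 5 < k" using assms that k_le_V by auto
    have "E ?r (Op Times (tm_dom 4) (tm_dom 5)) (domv (\<rho> 0) (\<rho> 2) x * domv (\<rho> 0) (\<rho> 2) y) (52 * w + 3)"
    proof (rule E_Op[OF E_dom[OF r(1,2)] E_dom[OF r(1,3)]])
      show "domv (\<rho> 0) (\<rho> 2) x * domv (\<rho> 0) (\<rho> 2) y \<le> V"
        using mult_le_mono[OF domv_le domv_le] by (rule le_V_lin[OF order_trans]) simp
    qed auto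
    then show ?thesis
    proof (rule E_Op[OF _ E_bad[OF r]])
      show "?g x y \<le> V" using g[of x y] by (intro le_V_lin) simp
    qed (use w_pow in auto)
  qed
  have inner: "E (\<rho>(4 := x)) (Big Plus 5 tm_k (Op Times (Op Times (tm_dom 4) (tm_dom 5)) tm_bad))
      (\<Sum>y<k. ?g x y) (674 * w ^ 3)" if "x < k" for x
  proof (rule E_cong[OF E_sum[OF E_k body[OF that]]])
    show "(\<Sum>y<k. ?g x y) \<le> V" using s1[of x] kn by (intro le_V_lin) simp
    show "2 + k * (670 * w ^ 2 + 1) + 1 \<le> 674 * w ^ 3" using loop_bound[of 670 2] by (simp add: eval_nat_numeral)
  qed simp_all
  have "E \<rho> (Big Plus 4 tm_k (Big Plus 5 tm_k (Op Times (Op Times (tm_dom 4) (tm_dom 5)) tm_bad)))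
      (\<Sum>x<k. \<Sum>y<k. ?g x y) (678 * w ^ 4)"
  proof (rule E_cong[OF E_sum[OF E_k inner]])
    have "k * (k * 8) \<le> 1000 * ((n + 2) * (n + 2))"
      using mult_mono[of k "n + 2" k "n + 2"] kn by simp
    then show "(\<Sum>x<k. \<Sum>y<k. ?g x y) \<le> V" using s2 by (intro le_V) simp
    show "2 + k * (674 * w ^ 3 + 1) + 1 \<le> 678 * w ^ 4" using loop_bound[of 674 3] by (simp add: eval_nat_numeral)
  qed simp_all
  from E_not[OF this] show ?thesis unfolding tm_check_def checkv_def
    by (rule E_cong) (use w_pow in simp_all)
qed

lemma E_adj:
  assumes "bd \<rho>" "\<rho> 4 < k" "\<rho> 5 < k"
  shows "E \<rho> tm_adj (adjv (\<rho> 4) (\<rho> 5)) 91"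
proof -
  note var = E_Var'[OF assms(1)]
  have v: "c \<le> V" if "c \<le> 2 * n + 2" for c using that by (intro le_V_lin) simp
  have p: "patv (\<rho> 4) \<le> n" "patv (\<rho> 5) \<le> n" using I(3) by (auto simp: patv_def)
  have 1: "E \<rho> (tm_is1 (tm_dist (Var 4) (Var 5))) (of_bool ((\<rho> 4 - \<rho> 5) + (\<rho> 5 - \<rho> 4) = 1)) 21"
    by (rule E_cong[OF E_is1[OF E_dist[OF var var]]]) (use assms kn in \<open>auto intro!: v\<close>)
  have 2: "E \<rho> (tm_is1 (tm_dist (tm_pat 4) (tm_pat 5)))
      (of_bool ((patv (\<rho> 4) - patv (\<rho> 5)) + (patv (\<rho> 5) - patv (\<rho> 4)) = 1)) 69"
    by (rule E_cong[OF E_is1[OF E_dist[OF E_pat[OF assms(1,2)] E_pat[OF assms(1,3)]]]])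
      (use p in \<open>auto intro!: v\<close>)
  show ?thesis unfolding tm_adj_def adjv_def by (rule E_Op[OF 1 2]) (auto intro!: v)
qed

lemma adjv_le: "adjv x y \<le> 2" and leakv_le: "leakv S W x y \<le> 3"
  by (auto simp: adjv_def leakv_def)

lemma E_not_mem: "bd \<rho> \<Longrightarrow> \<rho> x < k \<Longrightarrow>
    E \<rho> (tm_not (tm_mem x s)) (of_bool (\<rho> x \<notin> set_decode (\<rho> s))) (13 * w + 2)"
  by (rule E_cong[OF E_not[OF E_mem']]) auto

lemma E_leak:
  assumes "bd \<rho>" "\<rho> 4 < k" "\<rho> 5 < k"
  shows "E \<rho> tm_leak (leakv (\<rho> 0) (\<rho> 2) (\<rho> 4) (\<rho> 5)) (200 * w)"
proof -
  have v: "c \<le> V" if "c \<le> 3" for c using that by (intro le_V_lin) simp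
  have 1: "E \<rho> (Op Times (tm_not (tm_mem 5 2)) (tm_not (tm_mem 5 0)))
      (of_bool (\<rho> 5 \<notin> set_decode (\<rho> 2)) * of_bool (\<rho> 5 \<notin> set_decode (\<rho> 0))) (26 * w + 5)"
    by (rule E_Op[OF E_not_mem[OF assms(1,3)] E_not_mem[OF assms(1,3)]]) (auto intro!: v)
  have 2: "E \<rho> (Op Times (Op Times (tm_not (tm_mem 5 2)) (tm_not (tm_mem 5 0))) tm_adj)
      (of_bool (\<rho> 5 \<notin> set_decode (\<rho> 2)) * of_bool (\<rho> 5 \<notin> set_decode (\<rho> 0)) * adjv (\<rho> 4) (\<rho> 5)) (26 * w + 97)"
    by (rule E_Op[OF 1 E_adj[OF assms]]) (use adjv_le[of "\<rho> 4" "\<rho> 5"] in \<open>auto intro!: v\<close>)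
  have 3: "E \<rho> (Op Plus (tm_mem 4 0) (Op Times (Op Times (tm_not (tm_mem 5 2)) (tm_not (tm_mem 5 0))) tm_adj))
      (of_bool (\<rho> 4 \<in> set_decode (\<rho> 0)) + of_bool (\<rho> 5 \<notin> set_decode (\<rho> 2))
        * of_bool (\<rho> 5 \<notin> set_decode (\<rho> 0)) * adjv (\<rho> 4) (\<rho> 5)) (39 * w + 98)"
    by (rule E_Op[OF E_mem'[OF assms(1,2)] 2]) (use adjv_le[of "\<rho> 4" "\<rho> 5"] in \<open>auto intro!: v\<close>)
  show ?thesis unfolding tm_leak_def
  proof (rule E_Op[OF E_mem'[OF assms(1,2)] 3])
    show "leakv (\<rho> 0) (\<rho> 2) (\<rho> 4) (\<rho> 5) \<le> V" by (intro v leakv_le)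
  qed (use w_pow in \<open>simp_all add: leakv_def\<close>)
qed

lemma E_part:
  assumes "bd \<rho>" shows "E \<rho> tm_part (partv (\<rho> 0) (\<rho> 2)) (250 * w ^ 3)"
proof -
  let ?g = "leakv (\<rho> 0) (\<rho> 2)"
  have s1: "(\<Sum>y<k. ?g x y) \<le> k * 3" for x by (rule sum_le_mult) (rule leakv_le)
  then have s2: "(\<Sum>x<k. \<Sum>y<k. ?g x y) \<le> k * (k * 3)" by (rule sum_le_mult)
  have body: "E (\<rho>(4 := x, 5 := y)) tm_leak (?g x y) (200 * w ^ 1)" if "x < k" "y < k" for x y
    by (rule E_cong[OF E_leak]) (use assms that k_le_V in auto)
  have inner: "E (\<rho>(4 := x)) (Big Plus 5 tm_k tm_leak) (\<Sum>y<k. ?g x y) (204 * w ^ 2)" if "x < k" for x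
  proof (rule E_cong[OF E_sum[OF E_k body[OF that]]])
    show "(\<Sum>y<k. ?g x y) \<le> V" using s1[of x] kn by (intro le_V_lin) simp
    show "2 + k * (200 * w ^ 1 + 1) + 1 \<le> 204 * w ^ 2" using loop_bound[of 200 1] by (simp add: eval_nat_numeral)
  qed simp_all
  have "E \<rho> (Big Plus 4 tm_k (Big Plus 5 tm_k tm_leak)) (\<Sum>x<k. \<Sum>y<k. ?g x y) (208 * w ^ 3)"
  proof (rule E_cong[OF E_sum[OF E_k inner]])
    have "k * (k * 3) \<le> 1000 * ((n + 2) * (n + 2))"
      using mult_mono[of k "n + 2" k "n + 2"] kn by simp
    then show "(\<Sum>x<k. \<Sum>y<k. ?g x y) \<le> V" using s2 by (intro le_V) simp
    show "2 + k * (204 * w ^ 2 + 1) + 1 \<le> 208 * w ^ 3" using loop_bound[of 204 2] by (simp add: eval_nat_numeral)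
  qed simp_all
  note 1 = E_not[OF this]
  have "E \<rho> (tm_rank 2 tm_k) (rk (\<rho> 2) k) (2 + 14 * w ^ 2)"
    by (rule E_rank[OF E_k]) (use assms in \<open>auto simp: bdD\<close>)
  from E_le[OF this E_Num[of 100]]
  have 2: "E \<rho> (tm_le (tm_rank 2 tm_k) (Num 100)) (of_bool (rk (\<rho> 2) k \<le> 100)) (2 + 14 * w ^ 2 + 1 + 3)" by simp
  show ?thesis unfolding tm_part_def partv_def
    by (rule E_Op[OF 2 1]) (use w_pow in \<open>auto intro!: le_V_lin\<close>)
qed

lemma pow2_le_V: "x \<le> 2 ^ k \<Longrightarrow> x \<le> V"
proof -
  assume "x \<le> 2 ^ k"
  also have "(2::nat) ^ k \<le> (n + 2) ^ k" by (intro power_mono) auto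
  finally show ?thesis by (rule le_V_pow) simp
qed

lemma pown_le_V: "x \<le> n ^ i \<Longrightarrow> i \<le> k + 100 \<Longrightarrow> x \<le> V"
proof -
  assume "x \<le> n ^ i" "i \<le> k + 100"
  moreover have "n ^ i \<le> (n + 2) ^ i" by (intro power_mono) auto
  ultimately show ?thesis by (intro le_V_pow[of x i]) auto
qed

lemma E_pow2_k: "E \<rho> (tm_pow (Num 2) tm_k) (2 ^ k) (4 * w)"
  by (rule E_cong[OF E_pow2[OF E_k]]) (simp_all add: w_def)

lemma E_good:
  assumes "bd \<rho>" shows "E \<rho> tm_good (goodv (\<rho> 0)) (2 ^ k * (400 * w ^ 4))"
proof -
  define A :: nat where "A = 2 ^ k"
  have A: "1 \<le> A" by (simp add: A_def)
  let ?S = "\<rho> 0"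
  let ?g = "\<lambda>x W. partv ?S W * of_bool (x \<in> set_decode W)"
  have inner: "E (\<rho>(8 := x)) (Big Plus 2 (tm_pow (Num 2) tm_k) (Op Times tm_part (tm_mem 8 2)))
      (\<Sum>W<2^k. ?g x W) (A * (270 * w ^ 3))" if x: "x < k" for x
  proof (rule E_cong[OF E_sum[OF E_pow2_k]])
    fix W :: nat assume W: "W < 2 ^ k"
    let ?r = "\<rho>(8 := x, 2 := W)"
    have r: "bd ?r" using assms k_le_V[OF x] pow2_le_V[of W] W by auto
    show "E ?r (Op Times tm_part (tm_mem 8 2)) (?g x W) (264 * w ^ 3)"
      by (rule E_Op[OF E_part[OF r] E_mem'[OF r]]) (use x w_pow in \<open>auto intro!: le_V_lin simp: partv_def\<close>)
  next
    have "(\<Sum>W<2^k. ?g x W) \<le> 2 ^ k * 1" by (rule sum_le_mult) (simp add: partv_def)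
    then show "(\<Sum>W<2^k. ?g x W) \<le> V" by (intro pow2_le_V) simp
    have "4 * w + A * (264 * w ^ 3 + 1) + 1 \<le> A * (4 * w ^ 3) + A * (264 * w ^ 3 + w ^ 3) + A * w ^ 3"
    proof (intro add_mono mult_left_mono)
      show "4 * w \<le> A * (4 * w ^ 3)" using mult_le_mono[OF A, of "4 * w" "4 * w ^ 3"] w_pow by simp
      show "1 \<le> A * w ^ 3" using mult_le_mono[OF A, of 1 "w ^ 3"] w_pow by simp
    qed (use w_pow in auto)
    then show "4 * w + 2 ^ k * (264 * w ^ 3 + 1) + 1 \<le> A * (270 * w ^ 3)" by (simp add: A_def algebra_simps)
  qed simp_all
  let ?h = "\<lambda>x. of_bool (x \<notin> set_decode ?S) * of_bool ((\<Sum>W<2^k. ?g x W) = 0) :: nat"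
  have outer: "E \<rho> (Big Plus 8 tm_k (Op Times (tm_not (tm_mem 8 0))
       (tm_not (Big Plus 2 (tm_pow (Num 2) tm_k) (Op Times tm_part (tm_mem 8 2))))))
      (\<Sum>x<k. ?h x) (A * (300 * w ^ 4))"
  proof (rule E_cong[OF E_sum[OF E_k]])
    fix x assume x: "x < k"
    have r: "bd (\<rho>(8 := x))" using assms k_le_V[OF x] by auto
    have "E (\<rho>(8 := x)) (Op Times (tm_not (tm_mem 8 0))
       (tm_not (Big Plus 2 (tm_pow (Num 2) tm_k) (Op Times tm_part (tm_mem 8 2))))) (?h x)
       (13 * w + 2 + (A * (270 * w ^ 3) + 2) + 1)"
      by (rule E_Op[OF E_not_mem[OF r] E_not[OF inner[OF x]]]) (use x in \<open>auto intro!: le_V_lin\<close>)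
    then show "E (\<rho>(8 := x)) (Op Times (tm_not (tm_mem 8 0))
       (tm_not (Big Plus 2 (tm_pow (Num 2) tm_k) (Op Times tm_part (tm_mem 8 2))))) (?h x)
       (288 * A * w ^ 3)"
    proof (rule E_cong)
      have "1 * w ^ 3 \<le> A * w ^ 3" using A by (intro mult_right_mono) auto
      then show "13 * w + 2 + (A * (270 * w ^ 3) + 2) + 1 \<le> 288 * A * w ^ 3" unfolding mult.assoc using w_pow by linarith
    qed simp
  next
    have "(\<Sum>x<k. ?h x) \<le> k * 1" by (rule sum_le_mult) simp
    then show "(\<Sum>x<k. ?h x) \<le> V" using kn by (intro le_V_lin) simp
    have Suc3: "Suc 3 = (4::nat)" by simp
    have "(288 * A + 4) * w ^ 4 \<le> (292 * A) * w ^ 4" using A by (intro mult_right_mono) auto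
    then show "2 + k * (288 * A * w ^ 3 + 1) + 1 \<le> A * (300 * w ^ 4)"
      using loop_bound[of "288 * A" 3, unfolded Suc3] by linarith
  qed simp_all
  have k100: "100 * rk ?S k \<le> 100 * (n + 2)" "44 * k \<le> 44 * (n + 2)" using rk_le[of ?S k] kn by auto
  have "E \<rho> (tm_rank 0 tm_k) (rk ?S k) (2 + 14 * w ^ 2)"
    by (rule E_rank[OF E_k]) (use assms in \<open>auto simp: bdD\<close>)
  then have 1: "E \<rho> (Op Times (Num 100) (tm_rank 0 tm_k)) (100 * rk ?S k) (4 + 14 * w ^ 2)"
    by (intro E_Op[OF E_Num]) (use k100 in \<open>auto intro!: le_V_lin\<close>)
  have 2: "E \<rho> (Op Times (Num 44) tm_k) (44 * k) 4"
    by (intro E_Op[OF E_Num E_k]) (use k100 in \<open>auto intro!: le_V_lin\<close>)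
  show ?thesis unfolding tm_good_def
  proof (rule E_Op[OF E_le[OF 1 2] E_not[OF outer]])
    have "1 * w ^ 4 \<le> A * w ^ 4" using A by (intro mult_right_mono) auto
    then show "4 + 14 * w ^ 2 + 4 + 3 + (A * (300 * w ^ 4) + 2) + 1 \<le> 2 ^ k * (400 * w ^ 4)"
      unfolding A_def[symmetric] using w_pow by linarith
  qed (auto intro!: le_V_lin simp: goodv_def)
qed

text \<open>Bounds the number of maps of a part. The base \<open>n + 1\<close> keeps it positive for
  \<open>n = 0\<close>.\<close>

definition N :: nat where "N = (n + 1) ^ 100"

lemma N_pos: "1 \<le> N"
  by (simp add: N_def)

lemma part_pow_le: "partv S W * n ^ rk W k \<le> N"
proof (cases "partv S W = 0")
  case False
  then have 1: "partv S W = 1" "rk W k \<le> 100" by (auto simp: partv_def split: if_splits)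
  have "n ^ rk W k \<le> (n + 1) ^ rk W k" by (intro power_mono) auto
  also have "\<dots> \<le> N" unfolding N_def using 1(2) by (intro power_increasing) auto
  finally show ?thesis using 1 by simp
qed simp

lemma N_le_V: "x \<le> N \<Longrightarrow> x \<le> V"
proof -
  assume "x \<le> N"
  also have "N \<le> (n + 2) ^ 100" unfolding N_def by (intro power_mono) auto
  finally show ?thesis by (rule le_V_pow) simp
qed

definition bodyv :: "nat \<Rightarrow> nat \<Rightarrow> nat" where
  "bodyv S a = of_bool ((\<Sum>W<2^k. partv S W *
     of_bool ((\<Sum>b<partv S W * n ^ rk W k. checkv S a W b) = 0)) = 0)"

lemma E_check_loop:
  assumes "bd \<rho>"
  shows "E \<rho> (Big Plus 3 (Op Times tm_part (tm_pow tm_n (tm_rank 2 tm_k))) tm_check)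
    (\<Sum>b<partv (\<rho> 0) (\<rho> 2) * n ^ rk (\<rho> 2) k. checkv (\<rho> 0) (\<rho> 1) (\<rho> 2) b) (N * (1000 * w ^ 4))"
proof -
  let ?S = "\<rho> 0" and ?W = "\<rho> 2"
  have rk: "E \<rho> (tm_rank 2 tm_k) (rk ?W k) (2 + 14 * w ^ 2)"
    by (rule E_rank[OF E_k]) (use assms in \<open>auto simp: bdD\<close>)
  have "E \<rho> (Op Times tm_part (tm_pow tm_n (tm_rank 2 tm_k))) (partv ?S ?W * n ^ rk ?W k)
      (250 * w ^ 3 + (2 + 14 * w ^ 2 + rk ?W k * 3 + 1) + 1)"
    by (rule E_Op[OF E_part[OF assms] E_pown[OF rk rk_le]]) (auto intro: N_le_V part_pow_le)
  then have bound: "E \<rho> (Op Times tm_part (tm_pow tm_n (tm_rank 2 tm_k))) (partv ?S ?W * n ^ rk ?W k)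
      (280 * w ^ 4)"
  proof (rule E_cong)
    have "rk ?W k \<le> w" using rk_le[of ?W k] by (simp add: w_def)
    then show "250 * w ^ 3 + (2 + 14 * w ^ 2 + rk ?W k * 3 + 1) + 1 \<le> 280 * w ^ 4"
      using w_pow by linarith
  qed simp
  show ?thesis
  proof (rule E_cong[OF E_sum[OF bound]])
    fix b assume "b < partv ?S ?W * n ^ rk ?W k"
    then have "b \<le> V" using part_pow_le[of ?S ?W] by (intro N_le_V) simp
    then show "E (\<rho>(3 := b)) tm_check (checkv ?S (\<rho> 1) ?W b) (700 * w ^ 4)"
      using E_check[of "\<rho>(3 := b)"] assms by simp
  next
    have "(\<Sum>b<partv ?S ?W * n ^ rk ?W k. checkv ?S (\<rho> 1) ?W b) \<le> partv ?S ?W * n ^ rk ?W k * 1"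
      by (rule sum_le_mult) (simp add: checkv_def)
    then show "(\<Sum>b<partv ?S ?W * n ^ rk ?W k. checkv ?S (\<rho> 1) ?W b) \<le> V"
      using part_pow_le[of ?S ?W] by (intro N_le_V) simp
    define X where "X = partv ?S ?W * n ^ rk ?W k * (700 * w ^ 4 + 1)"
    have "X \<le> N * (700 * w ^ 4 + w ^ 4)"
      unfolding X_def using part_pow_le[of ?S ?W] w_pow by (intro mult_le_mono) auto
    also have "\<dots> = 701 * (N * w ^ 4)" by simp
    finally have "X \<le> 701 * (N * w ^ 4)" .
    moreover have "1 * w ^ 4 \<le> N * w ^ 4" using N_pos by (intro mult_right_mono) auto
    ultimately have "280 * w ^ 4 + X + 1 \<le> 1000 * (N * w ^ 4)" using w_pow by linarith
    also have "\<dots> = N * (1000 * w ^ 4)" by simp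
    finally show "280 * w ^ 4 + partv ?S ?W * n ^ rk ?W k * (700 * w ^ 4 + 1) + 1 \<le> N * (1000 * w ^ 4)"
      unfolding X_def .
  qed simp_all
qed

lemma E_body:
  assumes "bd \<rho>"
  shows "E \<rho> (tm_not (Big Plus 2 (tm_pow (Num 2) tm_k) (Op Times tm_part
         (tm_not (Big Plus 3 (Op Times tm_part (tm_pow tm_n (tm_rank 2 tm_k))) tm_check)))))
    (bodyv (\<rho> 0) (\<rho> 1)) (2 ^ k * N * (1300 * w ^ 4))"
proof -
  define B where "B = 2 ^ k * N * w ^ 4"
  have "1 * w ^ 4 \<le> (2 ^ k * N) * w ^ 4" using N_pos by (intro mult_right_mono) auto
  then have B: "w ^ 4 \<le> B" by (simp add: B_def)
  let ?S = "\<rho> 0"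
  let ?c = "\<lambda>W. \<Sum>b<partv ?S W * n ^ rk W k. checkv ?S (\<rho> 1) W b"
  have "E \<rho> (Big Plus 2 (tm_pow (Num 2) tm_k) (Op Times tm_part
         (tm_not (Big Plus 3 (Op Times tm_part (tm_pow tm_n (tm_rank 2 tm_k))) tm_check))))
    (\<Sum>W<2^k. partv ?S W * of_bool (?c W = 0)) (1280 * B)"
  proof (rule E_cong[OF E_sum[OF E_pow2_k]])
    fix W :: nat assume W: "W < 2 ^ k"
    let ?r = "\<rho>(2 := W)"
    have r: "bd ?r" using assms pow2_le_V[of W] W by auto
    have c: "E ?r (tm_not (Big Plus 3 (Op Times tm_part (tm_pow tm_n (tm_rank 2 tm_k))) tm_check))
        (of_bool (?c W = 0)) (N * (1000 * w ^ 4) + 2)"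
      using E_not[OF E_check_loop[OF r]] by simp
    show "E ?r (Op Times tm_part
         (tm_not (Big Plus 3 (Op Times tm_part (tm_pow tm_n (tm_rank 2 tm_k))) tm_check)))
        (partv ?S W * of_bool (?c W = 0)) (N * (1260 * w ^ 4))"
    proof (rule E_Op[OF E_part[OF r] c])
      have "1 * w ^ 4 \<le> N * w ^ 4" using N_pos by (intro mult_right_mono) auto
      then show "250 * w ^ 3 + (N * (1000 * w ^ 4) + 2) + 1 \<le> N * (1260 * w ^ 4)"
        using w_pow by linarith
    qed (auto intro!: le_V_lin simp: partv_def)
  next
    have "(\<Sum>W<2^k. partv ?S W * of_bool (?c W = 0)) \<le> 2 ^ k * 1" by (rule sum_le_mult) (simp add: partv_def)
    then show "(\<Sum>W<2^k. partv ?S W * of_bool (?c W = 0)) \<le> V" by (intro pow2_le_V) simp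
    have "1 * 1 \<le> N * w ^ 4" using N_pos w_pow by (intro mult_le_mono) auto
    then have "2 ^ k * (N * (1260 * w ^ 4) + 1) \<le> 2 ^ k * (N * (1260 * w ^ 4) + N * w ^ 4)" by simp
    also have "\<dots> = 1261 * B" by (simp add: B_def algebra_simps)
    finally show "4 * w + 2 ^ k * (N * (1260 * w ^ 4) + 1) + 1 \<le> 1280 * B" using B w_pow by linarith
  qed simp_all
  from E_not[OF this] show ?thesis
  proof (rule E_cong)
    show "1280 * B + 2 \<le> 2 ^ k * N * (1300 * w ^ 4)" using B w_pow by (simp add: B_def)
  qed (simp add: bodyv_def)
qed

text \<open>\<open>G\<close> stands for \<open>n\<close> to the power 0.44k and stays abstract, so
  that no real exponent enters here. The 1 in \<open>G + 1\<close> pays for the work on a set before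
  any map is tried, including sets whose loop is empty.\<close>

lemma E_main:
  assumes "bd \<rho>" and G: "\<And>r. 100 * r \<le> 44 * k \<Longrightarrow> n ^ r \<le> G"
  shows "E \<rho> tm_main mainv (2 ^ k * 2 ^ k * N * (G + 1) * (3000 * w ^ 4))"
proof -
  define B where "B = 2 ^ k * N * w ^ 4"
  have "1 * w ^ 4 \<le> (2 ^ k * N) * w ^ 4" using N_pos by (intro mult_right_mono) auto
  then have B: "w ^ 4 \<le> B" by (simp add: B_def)
  have gG: "goodv S * n ^ rk S k \<le> G" "goodv S * n ^ rk S k \<le> n ^ rk S k" for S
    using G[of "rk S k"] by (auto simp: goodv_def)
  have gV: "goodv S * n ^ rk S k \<le> V" for S
    by (rule pown_le_V[OF gG(2)]) (use rk_le[of S k] in simp)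
  have inner: "E (\<rho>(0 := S)) (Big Plus 1 (Op Times tm_good (tm_pow tm_n (tm_rank 0 tm_k)))
       (tm_not (Big Plus 2 (tm_pow (Num 2) tm_k) (Op Times tm_part
         (tm_not (Big Plus 3 (Op Times tm_part (tm_pow tm_n (tm_rank 2 tm_k))) tm_check))))))
     (\<Sum>a<goodv S * n ^ rk S k. bodyv S a) (2000 * (G + 1) * B)" if S: "S < 2 ^ k" for S
  proof -
    let ?r = "\<rho>(0 := S)"
    have r: "bd ?r" using assms pow2_le_V[of S] S by auto
    have rk: "E ?r (tm_rank 0 tm_k) (rk S k) (2 + 14 * w ^ 2)"
      by (rule E_rank[OF E_k]) (use assms S in \<open>auto simp: pow2_le_V\<close>)
    have "E ?r (Op Times tm_good (tm_pow tm_n (tm_rank 0 tm_k))) (goodv S * n ^ rk S k)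
        (2 ^ k * (400 * w ^ 4) + (2 + 14 * w ^ 2 + rk S k * 3 + 1) + 1)"
      by (rule E_Op[OF E_good[OF r, simplified] E_pown[OF rk rk_le]]) (use gV in auto)
    then have bound: "E ?r (Op Times tm_good (tm_pow tm_n (tm_rank 0 tm_k))) (goodv S * n ^ rk S k) (430 * B)"
    proof (rule E_cong)
      have "2 ^ k * (400 * w ^ 4) * 1 \<le> 2 ^ k * (400 * w ^ 4) * N" using N_pos by (intro mult_left_mono) auto
      then have "2 ^ k * (400 * w ^ 4) \<le> 400 * B" by (simp add: B_def mult_ac)
      moreover have "rk S k \<le> w" using rk_le[of S k] by (simp add: w_def)
      ultimately show "2 ^ k * (400 * w ^ 4) + (2 + 14 * w ^ 2 + rk S k * 3 + 1) + 1 \<le> 430 * B"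
        using w_pow B by linarith
    qed simp
    show ?thesis
    proof (rule E_cong[OF E_sum[OF bound]])
      fix a assume "a < goodv S * n ^ rk S k"
      then have "a \<le> V" using gV[of S] by simp
      then have "bd (\<rho>(0 := S, 1 := a))" using r by simp
      from E_body[OF this] show "E (\<rho>(0 := S, 1 := a)) (tm_not (Big Plus 2 (tm_pow (Num 2) tm_k) (Op Times tm_part
         (tm_not (Big Plus 3 (Op Times tm_part (tm_pow tm_n (tm_rank 2 tm_k))) tm_check)))))
         (bodyv S a) (1300 * B)" by (simp add: B_def mult_ac)
    next
      have "(\<Sum>a<goodv S * n ^ rk S k. bodyv S a) \<le> goodv S * n ^ rk S k * 1"
        by (rule sum_le_mult) (simp add: bodyv_def)
      then show "(\<Sum>a<goodv S * n ^ rk S k. bodyv S a) \<le> V" using gV[of S] by simp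
      have "goodv S * n ^ rk S k * (1300 * B + 1) \<le> G * (1301 * B)"
        using gG(1) B w_pow by (intro mult_le_mono) auto
      moreover have "2000 * (G + 1) * B = 2000 * (G * B) + 2000 * B" "G * (1301 * B) = 1301 * (G * B)"
        by (simp_all add: algebra_simps)
      ultimately show "430 * B + goodv S * n ^ rk S k * (1300 * B + 1) + 1 \<le> 2000 * (G + 1) * B"
        using B w_pow by linarith
    qed simp_all
  qed
  have "E \<rho> tm_main (\<Sum>S<2^k. \<Sum>a<goodv S * n ^ rk S k. bodyv S a)
      (2 ^ k * 2 ^ k * N * (G + 1) * (3000 * w ^ 4))"
    unfolding tm_main_def
  proof (rule E_cong[OF E_sum[OF E_pow2_k inner]])
    have nk: "goodv S * n ^ rk S k \<le> (n + 2) ^ k" for S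
    proof -
      have "n ^ rk S k \<le> (n + 2) ^ rk S k" by (intro power_mono) auto
      also have "\<dots> \<le> (n + 2) ^ k" using rk_le by (intro power_increasing) auto
      finally show ?thesis using gG(2)[of S] by linarith
    qed
    have "(\<Sum>a<goodv S * n ^ rk S k. bodyv S a) \<le> (n + 2) ^ k" for S
    proof -
      have "(\<Sum>a<goodv S * n ^ rk S k. bodyv S a) \<le> goodv S * n ^ rk S k * 1"
        by (rule sum_le_mult) (simp add: bodyv_def)
      then show ?thesis using nk[of S] by simp
    qed
    then have "(\<Sum>S<2^k. \<Sum>a<goodv S * n ^ rk S k. bodyv S a) \<le> 2 ^ k * (n + 2) ^ k"
      by (intro sum_le_mult) simp
    also have "\<dots> \<le> (n + 2) ^ k * (n + 2) ^ k" by (intro mult_right_mono power_mono) auto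
    also have "\<dots> = (n + 2) ^ (k + k)" by (simp add: power_add)
    finally show "(\<Sum>S<2^k. \<Sum>a<goodv S * n ^ rk S k. bodyv S a) \<le> V" by (rule le_V_pow) simp
    define D where "D = (G + 1) * B"
    have D: "B \<le> D" by (simp add: D_def)
    have "2 ^ k * (2000 * D + 1) \<le> 2 ^ k * (2001 * D)" using D B w_pow by (intro mult_left_mono) auto
    moreover have "1 * D \<le> 2 ^ k * D" by (intro mult_right_mono) auto
    ultimately have "4 * w + 2 ^ k * (2000 * D + 1) + 1 \<le> 2 ^ k * (3000 * D)"
      using D B w_pow by linarith
    moreover have "2000 * (G + 1) * B = 2000 * D" unfolding D_def by (simp only: mult_ac)
    moreover have "2 ^ k * 2 ^ k * N * (G + 1) * (3000 * w ^ 4) = 2 ^ k * (3000 * D)"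
      unfolding D_def B_def by (simp only: mult_ac)
    ultimately show "4 * w + 2 ^ k * (2000 * (G + 1) * B + 1) + 1 \<le> 2 ^ k * 2 ^ k * N * (G + 1) * (3000 * w ^ 4)"
      by (simp only:)
  qed simp_all
  then show ?thesis by (simp add: mainv_def bodyv_def)
qed

end

section \<open>Correctness of the search\<close>

lemma digits_exist:
  fixes n :: nat
  assumes "\<And>i. i < m \<Longrightarrow> h i < n"
  shows "\<exists>a < n ^ m. \<forall>i<m. a div n ^ i mod n = h i"
  using assms
proof (induction m arbitrary: h)
  case 0
  then show ?case by simp
next
  case (Suc m)
  obtain a where a: "a < n ^ m" "\<forall>i<m. a div n ^ i mod n = h (Suc i)"
    using Suc.IH[of "h \<circ> Suc"] Suc.prems by auto
  have h0: "h 0 < n" using Suc.prems by simp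
  have div: "(h 0 + n * a) div n = a" using h0 by simp
  have "h 0 + n * a < n * (a + 1)" using h0 by (simp add: algebra_simps)
  also have "\<dots> \<le> n * n ^ m" using a(1) by (intro mult_left_mono) auto
  finally have "h 0 + n * a < n ^ Suc m" by simp
  moreover have "(h 0 + n * a) div n ^ i mod n = h i" if "i < Suc m" for i
    using that h0 a(2) div by (cases i) (simp_all add: div_mult2_eq)
  ultimately show ?case by blast
qed

lemma rank_less: "x \<in> A \<Longrightarrow> x < y \<Longrightarrow> card (A \<inter> {..<x}) < card (A \<inter> {..<y})" for x y :: nat
  by (intro psubset_card_mono) auto

text \<open>Ranks within \<open>A\<close> run through \<open>{..<card A}\<close> bijectively, so the
  digits can be prescribed independently.\<close>

lemma assignment_code:
  fixes g :: "nat \<Rightarrow> nat"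
  assumes "A \<subseteq> {..<k}" "\<And>x. x \<in> A \<Longrightarrow> g x < n"
  shows "\<exists>a < n ^ card A. \<forall>x\<in>A. a div n ^ card (A \<inter> {..<x}) mod n = g x"
proof -
  define r where "r x = card (A \<inter> {..<x})" for x
  have inj: "inj_on r A" using rank_less[of _ A] unfolding r_def
    by (intro inj_onI) (metis less_irrefl linorder_neqE_nat)
  have fin: "finite A" using assms(1) finite_subset by blast
  have "r x < card A" if "x \<in> A" for x
    unfolding r_def using that fin by (intro psubset_card_mono) auto
  then have "r ` A \<subseteq> {..<card A}" by auto
  then have "r ` A = {..<card A}" using card_image[OF inj] by (intro card_subset_eq) auto
  then have "g (inv_into A r i) < n" if "i < card A" for i
    using that assms(2) inv_into_into[of i r A] by auto
  then obtain a where "a < n ^ card A" "\<forall>i<card A. a div n ^ i mod n = g (inv_into A r i)"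
    using digits_exist[of "card A" "\<lambda>i. g (inv_into A r i)" n] by auto
  moreover have "r x < card A" if "x \<in> A" for x using \<open>r ` A = _\<close> that by blast
  ultimately show ?thesis using inv_into_f_f[OF inj] unfolding r_def[symmetric] by metis
qed

lemma set_decode_subset: "x < 2 ^ k \<Longrightarrow> set_decode x \<subseteq> {..<k}"
proof
  fix i assume x: "x < 2 ^ k" and i: "i \<in> set_decode x"
  show "i \<in> {..<k}"
  proof (rule ccontr)
    assume "i \<notin> {..<k}"
    then have "(2::nat) ^ k \<le> 2 ^ i" by (intro power_increasing) auto
    then have "x < 2 ^ i" using x by linarith
    then have "x div 2 ^ i = 0" by simp
    then show False using i by (simp add: set_decode_def)
  qed
qed

lemma set_encode_less:
  assumes "A \<subseteq> {..<k}" shows "set_encode A < 2 ^ k"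
proof -
  have "set_encode A \<le> set_encode {..<k}" unfolding set_encode_def using assms by (intro sum_mono2) auto
  also have "\<dots> < 2 ^ k"
    by (induction k) (simp_all add: lessThan_Suc)
  finally show ?thesis .
qed

text \<open>The reason why constraints between consecutive elements suffice; it is applied once to
  positions and once to values.\<close>

lemma less_chain:
  fixes f :: "nat \<Rightarrow> nat"
  assumes "\<And>i. a \<le> i \<Longrightarrow> i < b \<Longrightarrow> f i < f (Suc i)" "a \<le> u" "u < v" "v \<le> b"
  shows "f u < f v"
  using assms(3,4)
proof (induction v)
  case (Suc v)
  then have "f v < f (Suc v)" using assms(1,2) by simp
  then show ?case using Suc by (cases "u = v") auto
qed simp

locale ppm_input = ppm I n k V for I n k V +
  fixes t \<pi> :: "nat \<Rightarrow> nat"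
  assumes t: "t permutes {1..n}" and \<pi>: "\<pi> permutes {1..k}" and I_eq: "I = input n t k \<pi>"
begin

lemma patv: "x < k \<Longrightarrow> patv x = \<pi> (x + 1)"
  unfolding patv_def by (simp add: I_eq input_def)

lemma txtv: "1 \<le> p \<Longrightarrow> p \<le> n \<Longrightarrow> I (p + 1) = t p"
  by (simp add: I_eq input_def)

definition adj :: "nat \<Rightarrow> nat \<Rightarrow> bool" where "adj x y \<longleftrightarrow> adjv x y \<noteq> 0"

lemma adj_iff: "adj x y \<longleftrightarrow> (x - y) + (y - x) = 1 \<or> (patv x - patv y) + (patv y - patv x) = 1"
  by (simp add: adj_def adjv_def)

sublocale sgraph adj
  by unfold_locales (simp_all add: adj_iff add.commute)

lemma card_dist1: "inj_on f A \<Longrightarrow> finite A \<Longrightarrow> card {u \<in> A. (c - f u) + (f u - c) = (1::nat)} \<le> 2"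
proof -
  assume a: "inj_on f A" "finite A"
  let ?B = "{u \<in> A. (c - f u) + (f u - c) = 1}"
  have "card ?B = card (f ` ?B)" using a(1) by (intro card_image[symmetric]) (auto intro: inj_on_subset)
  also have "\<dots> \<le> card {c - 1, c + 1}" by (intro card_mono) auto
  also have "\<dots> \<le> 2" using card_insert_le_m1[of 2 "{c + 1}" "c - 1"] by simp
  finally show ?thesis .
qed

lemma inj_patv: "inj_on patv {..<k}"
  using permutes_inj[OF \<pi>] by (auto simp: inj_on_def patv)

lemma degree: "card {u \<in> {..<k}. adj v u} \<le> 4"
proof -
  have "{u \<in> {..<k}. adj v u} = {u \<in> {..<k}. (v - u) + (u - v) = 1}
      \<union> {u \<in> {..<k}. (patv v - patv u) + (patv u - patv v) = 1}" (is "_ = ?A \<union> ?B")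
    by (auto simp: adj_iff)
  moreover have "card ?A \<le> 2" using card_dist1[of id "{..<k}" v] by simp
  moreover have "card ?B \<le> 2" by (rule card_dist1[OF inj_patv]) simp
  ultimately show ?thesis using card_Un_le[of ?A ?B] by simp
qed

lemma rk_k: "S < 2 ^ k \<Longrightarrow> rk S k = card (set_decode S)"
  using set_decode_subset[of S k] by (simp add: rk_def Int_absorb2)

definition part :: "nat \<Rightarrow> nat \<Rightarrow> bool" where
  "part S W \<longleftrightarrow> rk W k \<le> 100 \<and> (\<forall>x<k. x \<in> set_decode W \<longrightarrow> x \<notin> set_decode S \<and>
     (\<forall>y<k. y \<notin> set_decode W \<longrightarrow> y \<notin> set_decode S \<longrightarrow> \<not> adj x y))"

lemma partv: "partv S W = of_bool (part S W)"
  by (auto simp: partv_def part_def leakv_def adj_def)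

lemma goodv: "goodv S = of_bool (100 * rk S k \<le> 44 * k \<and>
    (\<forall>x<k. x \<notin> set_decode S \<longrightarrow> (\<exists>W<2^k. part S W \<and> x \<in> set_decode W)))"
  by (auto simp: goodv_def partv)

lemma good_exists: "\<exists>S<2^k. goodv S = 1"
proof -
  have "frag 100 {..<k} (2 / 5 * real (card {..<k}) + 3 * real (card {..<k}) / real 100)"
    by (rule frag_degree_4) (use degree in auto)
  then obtain S where S: "S \<subseteq> {..<k}" "real (card S) \<le> 2 / 5 * real k + 3 * real k / 100"
    "\<forall>v\<in>{..<k} - S. \<exists>W\<subseteq>{..<k} - S. v \<in> W \<and> card W \<le> 100 \<and> cut W ({..<k} - S - W) = 0"
    unfolding frag_def by auto
  have fS: "finite S" using S(1) finite_subset by blast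
  have dS: "set_decode (set_encode S) = S" using fS by simp
  have lS: "set_encode S < 2 ^ k" using S(1) by (rule set_encode_less)
  \<comment> \<open>Indeed 2/5 + 3/100 = 0.43.\<close>
  have "real (100 * card S) \<le> real (44 * k)" using S(2) by simp
  then have "100 * card S \<le> 44 * k" by (simp only: of_nat_le_iff)
  then have 1: "100 * rk (set_encode S) k \<le> 44 * k" using rk_k[OF lS] dS by simp
  have "\<exists>W<2^k. part (set_encode S) W \<and> x \<in> set_decode W" if x: "x < k" "x \<notin> S" for x
  proof -
    obtain W where W: "W \<subseteq> {..<k} - S" "x \<in> W" "card W \<le> 100" "cut W ({..<k} - S - W) = 0"
      using S(3) x by blast
    have fW: "finite W" using W(1) by (rule finite_subset) simp
    have dW: "set_decode (set_encode W) = W" using fW by simp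
    have lW: "set_encode W < 2 ^ k" using W(1) by (intro set_encode_less) auto
    have "part (set_encode S) (set_encode W)"
      unfolding part_def using W fW rk_k[OF lW] by (auto simp: dS dW cut_eq_0_iff)
    then show ?thesis using lW dW W(2) by auto
  qed
  then have "goodv (set_encode S) = 1" using 1 dS by (simp add: goodv)
  then show ?thesis using lS by blast
qed

definition ok :: "(nat \<Rightarrow> nat) \<Rightarrow> nat \<Rightarrow> nat \<Rightarrow> bool" where
  "ok g x y \<longleftrightarrow> (x < y \<longrightarrow> g x < g y) \<and> (\<pi> (x + 1) < \<pi> (y + 1) \<longrightarrow> t (g x) < t (g y))"

lemma ok_cong: "g x = g' x \<Longrightarrow> g y = g' y \<Longrightarrow> ok g x y \<longleftrightarrow> ok g' x y"
  by (simp add: ok_def)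

lemma posv_range:
  assumes "x < k" "x \<in> set_decode S \<union> set_decode W" "x \<notin> set_decode S \<inter> set_decode W"
  shows "1 \<le> posv S a W b x" "posv S a W b x \<le> n"
  using assms digit_le[OF assms(1), of a "rk S x"] digit_le[OF assms(1), of b "rk W x"]
  by (auto simp: posv_def)

text \<open>Disjointness of the two sets puts all positions between 1 and \<open>n\<close>, so that
  \<open>tm_txt\<close> really reads text values.\<close>

lemma checkv:
  assumes "S < 2 ^ k" "W < 2 ^ k" "part S W"
  shows "checkv S a W b = of_bool (\<forall>x \<in> set_decode S \<union> set_decode W.
    \<forall>y \<in> set_decode S \<union> set_decode W. ok (posv S a W b) x y)"
proof -
  let ?U = "set_decode S \<union> set_decode W"
  have U: "?U \<subseteq> {..<k}" using assms set_decode_subset by blast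
  have disj: "set_decode S \<inter> set_decode W = {}"
    using assms(3) set_decode_subset[OF assms(2)] by (auto simp: part_def)
  have bad: "badv S a W b x y = 0 \<longleftrightarrow> ok (posv S a W b) x y" if "x \<in> ?U" "y \<in> ?U" for x y
  proof -
    have "x < k" "y < k" using that U by auto
    then show ?thesis
      using that disj posv_range[of x S W a b] posv_range[of y S W a b]
        txtv[of "posv S a W b x"] txtv[of "posv S a W b y"] patv
      by (auto simp: badv_def ok_def)
  qed
  have "(\<Sum>x<k. \<Sum>y<k. domv S W x * domv S W y * badv S a W b x y) = 0 \<longleftrightarrow>
      (\<forall>x\<in>{..<k}. \<forall>y\<in>{..<k}. domv S W x * domv S W y * badv S a W b x y = 0)"
    by (simp only: sum_eq_0_iff finite_lessThan)
  also have "\<dots> \<longleftrightarrow> (\<forall>x\<in>?U. \<forall>y\<in>?U. badv S a W b x y = 0)"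
  proof -
    have dom: "domv S W x = 0 \<longleftrightarrow> x \<notin> ?U" for x by (auto simp: domv_def)
    show ?thesis
    proof (intro iffI ballI)
      fix x y assume "\<forall>x\<in>{..<k}. \<forall>y\<in>{..<k}. domv S W x * domv S W y * badv S a W b x y = 0"
        and xy: "x \<in> ?U" "y \<in> ?U"
      moreover from xy have "x \<in> {..<k}" "y \<in> {..<k}" using U by blast+
      ultimately have "domv S W x * domv S W y * badv S a W b x y = 0" by blast
      then show "badv S a W b x y = 0" using xy dom by auto
    next
      fix x y assume "\<forall>x\<in>?U. \<forall>y\<in>?U. badv S a W b x y = 0"
      then show "domv S W x * domv S W y * badv S a W b x y = 0"
        using dom by (cases "x \<in> ?U \<and> y \<in> ?U") auto
    qed
  qed
  also have "\<dots> \<longleftrightarrow> (\<forall>x\<in>?U. \<forall>y\<in>?U. ok (posv S a W b) x y)" using bad by blast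
  finally show ?thesis by (simp add: checkv_def)
qed

lemma bodyv: "bodyv S a = of_bool (\<forall>W<2^k. part S W \<longrightarrow> (\<exists>b<n ^ rk W k. checkv S a W b \<noteq> 0))"
  by (auto simp: bodyv_def partv)

lemma mainv_pos: "mainv > 0 \<longleftrightarrow> (\<exists>S<2^k. goodv S = 1 \<and> (\<exists>a<n ^ rk S k. bodyv S a = 1))"
proof -
  have "mainv = 0 \<longleftrightarrow> (\<forall>S\<in>{..<2^k}. \<forall>a\<in>{..<goodv S * n ^ rk S k}. bodyv S a = 0)"
    unfolding mainv_def bodyv_def[symmetric] by (simp only: sum_eq_0_iff finite_lessThan)
  moreover have "goodv S = 0 \<or> goodv S = 1" "bodyv S a = 0 \<or> bodyv S a = 1" for S a
    by (simp_all only: goodv bodyv of_bool_def) auto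
  ultimately show ?thesis
    by (smt (verit, best) lessThan_iff gr0I less_nat_zero_code mult_0 nat_mult_1 zero_neq_one)
qed

text \<open>The restrictions of a single embedding to the deleted set and to each part pass all
  tests.\<close>

lemma main_complete:
  assumes "contains_pattern n t k \<pi>" shows "mainv > 0"
proof -
  obtain i where i: "strict_mono_on {1..k} i" "i ` {1..k} \<subseteq> {1..n}"
    "\<forall>j\<in>{1..k}. \<forall>l\<in>{1..k}. t (i j) < t (i l) \<longleftrightarrow> \<pi> j < \<pi> l"
    using assms by (auto simp: contains_pattern_def)
  define g where "g x = i (x + 1)" for x
  have g: "1 \<le> g x" "g x \<le> n" if "x < k" for x
    using subsetD[OF i(2) imageI, of "x + 1"] that by (simp_all add: g_def)
  have g_ok: "ok g x y" if "x < k" "y < k" for x y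
    using i(1,3) that by (auto simp: ok_def g_def strict_mono_on_def)
  have code: "\<exists>a<n ^ rk A k. \<forall>x\<in>set_decode A. digit a (rk A x) = g x - 1" if "A < 2 ^ k" for A
  proof -
    have "set_decode A \<subseteq> {..<k}" using that by (rule set_decode_subset)
    then have "\<exists>a<n ^ card (set_decode A). \<forall>x\<in>set_decode A.
        a div n ^ card (set_decode A \<inter> {..<x}) mod n = g x - 1"
    proof (rule assignment_code)
      fix x assume "x \<in> set_decode A"
      then have "x < k" using \<open>set_decode A \<subseteq> {..<k}\<close> by auto
      from g[OF this] show "g x - 1 < n" by simp
    qed
    then show ?thesis by (simp add: digit_def rk_k[OF that] flip: rk_def)
  qed
  obtain S where S: "S < 2 ^ k" "goodv S = 1" using good_exists by blast
  obtain a where a: "a < n ^ rk S k" "\<forall>x\<in>set_decode S. digit a (rk S x) = g x - 1" using code S by blast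
  have "\<exists>b<n ^ rk W k. checkv S a W b \<noteq> 0" if W: "W < 2 ^ k" "part S W" for W
  proof -
    obtain b where b: "b < n ^ rk W k" "\<forall>x\<in>set_decode W. digit b (rk W x) = g x - 1" using code W by blast
    have sub: "set_decode S \<subseteq> {..<k}" "set_decode W \<subseteq> {..<k}" using S W set_decode_subset by auto
    have pos: "posv S a W b x = g x" if x: "x \<in> set_decode S \<union> set_decode W" for x
    proof -
      have "x < k" using x sub by auto
      moreover from this have "x \<notin> set_decode S \<or> x \<notin> set_decode W" using W(2) by (auto simp: part_def)
      ultimately show ?thesis using x a(2) b(2) g[of x] by (auto simp: posv_def)
    qed
    have "ok (posv S a W b) x y" if "x \<in> set_decode S \<union> set_decode W" "y \<in> set_decode S \<union> set_decode W" for x y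
    proof -
      have "x < k" "y < k" using that sub by auto
      then show ?thesis using g_ok pos[OF that(1)] pos[OF that(2)] ok_cong by metis
    qed
    then have "checkv S a W b \<noteq> 0" unfolding checkv[OF S(1) W] by simp
    then show ?thesis using b(1) by blast
  qed
  then have "bodyv S a = 1" by (simp add: bodyv)
  then show ?thesis using S a(1) mainv_pos by blast
qed

text \<open>Once the map of the deleted set is fixed, solutions for different parts cannot conflict,
  because no constraint links them; so they need not come from a common embedding
  beforehand.\<close>

lemma main_sound:
  assumes "mainv > 0" shows "contains_pattern n t k \<pi>"
proof -
  obtain S a where S: "S < 2 ^ k" "goodv S = 1" and a: "bodyv S a = 1"
    using assms mainv_pos by blast
  define A where "A = set_decode S"
  define gA where "gA x = digit a (rk S x) + 1" for x
  have Ak: "A \<subseteq> {..<k}" using S(1) by (simp add: A_def set_decode_subset)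
  have ex_g: "\<exists>g. (\<forall>x\<in>A. g x = gA x) \<and> (\<forall>x\<in>A \<union> set_decode W. 1 \<le> g x \<and> g x \<le> n) \<and>
      (\<forall>x\<in>A \<union> set_decode W. \<forall>y\<in>A \<union> set_decode W. ok g x y)" if W: "W < 2 ^ k" "part S W" for W
  proof -
    obtain b where b: "checkv S a W b \<noteq> 0" using a[unfolded bodyv of_bool_eq_1_iff] W by blast
    have disj: "x \<notin> set_decode S \<inter> set_decode W" "x < k" if "x \<in> A \<union> set_decode W" for x
      using W set_decode_subset[OF W(1)] Ak that by (auto simp: part_def)
    have 1: "\<forall>x\<in>A \<union> set_decode W. \<forall>y\<in>A \<union> set_decode W. ok (posv S a W b) x y"
      using b checkv[OF S(1) W, of a b] by (simp add: A_def split: if_splits)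
    have 2: "posv S a W b x = gA x" if "x \<in> A" for x
      using disj[of x] that by (auto simp: posv_def gA_def A_def)
    have 3: "1 \<le> posv S a W b x \<and> posv S a W b x \<le> n" if "x \<in> A \<union> set_decode W" for x
      using posv_range[of x S W a b] disj[OF that] that by (auto simp: A_def)
    show ?thesis by (rule exI[of _ "posv S a W b"]) (use 1 2 3 in blast)
  qed
  \<comment> \<open>\<open>P\<close> is a union of components of the remainder. While maps are
    assembled part by part, only constraints between adjacent elements can be maintained.\<close>
  have glue: "\<exists>g. (\<forall>x\<in>A. g x = gA x) \<and> (\<forall>x\<in>A \<union> P. 1 \<le> g x \<and> g x \<le> n) \<and>
      (\<forall>x\<in>A \<union> P. \<forall>y\<in>A \<union> P. adj x y \<longrightarrow> ok g x y)"
    if "P \<subseteq> {..<k} - A" "\<forall>x\<in>P. \<forall>y\<in>{..<k} - A - P. \<not> adj x y" for P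
    using that
  proof (induction "card P" arbitrary: P rule: less_induct)
    case less
    show ?case
    proof (cases "P = {}")
      case True
      \<comment> \<open>The code 0 is that of the empty part; it yields consistency of the map on
        \<open>A\<close> alone.\<close>
      have "part S 0" by (simp add: part_def rk_def)
      from ex_g[OF _ this] show ?thesis using True by auto
    next
      case False
      then obtain x where x: "x \<in> P" by blast
      then have "x < k" "x \<notin> set_decode S" using less.prems(1) by (auto simp: A_def)
      then obtain W where W: "W < 2 ^ k" "part S W" "x \<in> set_decode W"
        using S(2)[unfolded goodv of_bool_eq_1_iff] by blast
      obtain g where g: "\<forall>x\<in>A. g x = gA x" "\<forall>x\<in>A \<union> set_decode W. 1 \<le> g x \<and> g x \<le> n"
        "\<forall>x\<in>A \<union> set_decode W. \<forall>y\<in>A \<union> set_decode W. ok g x y"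
        using ex_g[OF W(1,2)] by blast
      \<comment> \<open>\<open>W\<close> may reach beyond \<open>P\<close>, so only its share in
        \<open>P\<close> is peeled off; closure of \<open>W\<close> keeps this share free of edges
        to the rest of \<open>P\<close>.\<close>
      define W' where "W' = set_decode W \<inter> P"
      define P' where "P' = P - W'"
      have closed: "\<not> adj u v" if "u \<in> set_decode W" "v \<in> {..<k} - A - set_decode W" for u v
        using W(2) that set_decode_subset[OF W(1)] by (auto simp: part_def A_def)
      have sep: "\<not> adj u v" "\<not> adj v u" if "u \<in> P'" "v \<in> W'" for u v
        using closed[of v u] that less.prems(1) sym by (auto simp: P'_def W'_def)
      have "finite P" using less.prems(1) by (rule finite_subset) simp
      then have "card P' < card P" using x W(3) by (intro psubset_card_mono) (auto simp: P'_def W'_def)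
      moreover have "P' \<subseteq> {..<k} - A" using less.prems(1) by (auto simp: P'_def)
      moreover have "\<forall>u\<in>P'. \<forall>v\<in>{..<k} - A - P'. \<not> adj u v"
        using less.prems(2) sep by (auto simp: P'_def)
      ultimately have "\<exists>g. (\<forall>x\<in>A. g x = gA x) \<and> (\<forall>x\<in>A \<union> P'. 1 \<le> g x \<and> g x \<le> n) \<and>
        (\<forall>x\<in>A \<union> P'. \<forall>y\<in>A \<union> P'. adj x y \<longrightarrow> ok g x y)" by (rule less.hyps)
      then obtain g' where g': "\<forall>x\<in>A. g' x = gA x" "\<forall>x\<in>A \<union> P'. 1 \<le> g' x \<and> g' x \<le> n"
        "\<forall>x\<in>A \<union> P'. \<forall>y\<in>A \<union> P'. adj x y \<longrightarrow> ok g' x y" by blast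
      define h where "h u = (if u \<in> W' then g u else g' u)" for u
      have AW: "A \<inter> W' = {}" using less.prems(1) by (auto simp: W'_def)
      have h1: "h u = g' u" if "u \<in> A \<union> P'" for u using that AW by (auto simp: h_def P'_def)
      have h2: "h u = g u" if "u \<in> A \<union> W'" for u using that g(1) g'(1) by (auto simp: h_def)
      have un: "A \<union> P = A \<union> P' \<union> W'" by (auto simp: P'_def W'_def)
      have "1 \<le> h u \<and> h u \<le> n" if "u \<in> A \<union> P" for u
        using that g(2) g'(2) unfolding un by (auto simp: h_def W'_def)
      moreover have "ok h u v" if uv: "u \<in> A \<union> P" "v \<in> A \<union> P" "adj u v" for u v
      proof -
        consider "u \<in> A \<union> P'" "v \<in> A \<union> P'" | "u \<in> A \<union> W'" "v \<in> A \<union> W'"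
          using uv sep unfolding un by blast
        then show ?thesis
        proof cases
          case 1
          then show ?thesis using g'(3) uv(3) h1 ok_cong[of h u g' v] by simp
        next
          case 2
          then have "ok g u v" using g(3) by (auto simp: W'_def)
          then show ?thesis using 2 h2 ok_cong[of h u g v] by simp
        qed
      qed
      moreover have "\<forall>u\<in>A. h u = gA u" using h1 g'(1) by simp
      ultimately show ?thesis by blast
    qed
  qed
  obtain g where g: "\<forall>x\<in>A \<union> ({..<k} - A). 1 \<le> g x \<and> g x \<le> n"
    "\<forall>x\<in>A \<union> ({..<k} - A). \<forall>y\<in>A \<union> ({..<k} - A). adj x y \<longrightarrow> ok g x y"
    using glue[of "{..<k} - A"] by auto
  have "A \<union> ({..<k} - A) = {..<k}" using Ak by auto
  then have g: "1 \<le> g x" "g x \<le> n" "y < k \<Longrightarrow> adj x y \<Longrightarrow> ok g x y" if "x < k" for x y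
    using g that by auto
  have mono: "g x < g y" if "x < y" "y < k" for x y
  proof (rule less_chain[where f = g and a = 0 and b = "k - 1"])
    fix i assume "i < k - 1"
    then have "ok g i (Suc i)" by (intro g(3)) (auto simp: adj_iff)
    then show "g i < g (Suc i)" by (simp add: ok_def)
  qed (use that in auto)
  \<comment> \<open>\<open>e v\<close> is the text value assigned to the pattern element of value
    \<open>v\<close>. Elements of values \<open>v\<close> and \<open>v + 1\<close> are adjacent, so
    the chain argument also works along the values.\<close>
  define e where "e v = t (g (inv \<pi> v - 1))" for v
  have inv: "inv \<pi> v \<in> {1..k}" "\<pi> (inv \<pi> v) = v" if "v \<in> {1..k}" for v
    using that permutes_in_image[OF permutes_inv[OF \<pi>], of v] permutes_inverses(1)[OF \<pi>] by auto
  have e_less: "e u < e v" if "1 \<le> u" "u < v" "v \<le> k" for u v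
  proof (rule less_chain[where f = e and a = 1 and b = k])
    fix i assume i: "1 \<le> i" "i < k"
    let ?x = "inv \<pi> i - 1" and ?y = "inv \<pi> (Suc i) - 1"
    have inv_i: "inv \<pi> i \<in> {1..k}" "inv \<pi> (Suc i) \<in> {1..k}" using inv(1) i by auto
    then have xy: "?x < k" "?y < k" "?x + 1 = inv \<pi> i" "?y + 1 = inv \<pi> (Suc i)" by auto
    then have pat: "\<pi> (?x + 1) = i" "\<pi> (?y + 1) = Suc i" using inv(2) i by auto
    have "adj ?x ?y" unfolding adj_iff patv[OF xy(1)] patv[OF xy(2)] pat by simp
    then have "ok g ?x ?y" using g(3) xy by blast
    then show "e i < e (Suc i)" unfolding ok_def pat e_def by simp
  qed (use that in auto)
  have val: "t (g (j - 1)) < t (g (l - 1))" if "j \<in> {1..k}" "l \<in> {1..k}" "\<pi> j < \<pi> l" for j l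
  proof -
    have "\<pi> j \<in> {1..k}" "\<pi> l \<in> {1..k}" using that permutes_in_image[OF \<pi>] by auto
    then have "e (\<pi> j) < e (\<pi> l)" using that by (intro e_less) auto
    then show ?thesis by (simp add: e_def permutes_inverses(2)[OF \<pi>])
  qed
  \<comment> \<open>The converse is \<open>val\<close> with \<open>j\<close> and \<open>l\<close>
    exchanged, together with injectivity of \<open>\<pi>\<close>.\<close>
  have iff: "t (g (j - 1)) < t (g (l - 1)) \<longleftrightarrow> \<pi> j < \<pi> l" if "j \<in> {1..k}" "l \<in> {1..k}" for j l
    using val[OF that] val[OF that(2,1)] permutes_inj[OF \<pi>, THEN injD, of j l]
    by (metis less_asym less_irrefl linorder_neqE_nat)
  have "strict_mono_on {1..k} (\<lambda>j. g (j - 1))"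
    by (auto simp: strict_mono_on_def intro!: mono)
  moreover have "(\<lambda>j. g (j - 1)) ` {1..k} \<subseteq> {1..n}" using g(1,2) by auto
  ultimately show ?thesis unfolding contains_pattern_def using iff by (intro exI[of _ "\<lambda>j. g (j - 1)"]) simp
qed

end

section \<open>Running time\<close>

text \<open>The result of the search counts the successful maps of deleted sets;
  \<open>1 - (1 - x)\<close> reduces the count to 0 or 1. Cell 0 is overwritten last, since the
  address of \<open>tmp 0\<close> is computed from it.\<close>

definition algorithm :: prog where
  "algorithm = Seq (compile 0 tm_main) (Store (Const 0) (Sub (Const 1) (Sub (Const 1) (Mem (tmp 0)))))"

lemma len_pow2: "len (2 ^ L) = L + 2"
  by (simp add: len_def floorlog_def log_nat_power)

lemma algorithm_correct:
  assumes t: "t permutes {1..n}" and \<pi>: "\<pi> permutes {1..k}" and kn: "k \<le> n"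
    and G: "\<And>r. 100 * r \<le> 44 * k \<Longrightarrow> n ^ r \<le> G"
  shows "\<exists>T m. exec algorithm (input n t k \<pi>) T m \<and>
    (if contains_pattern n t k \<pi> then accepting m else rejecting m) \<and>
    T \<le> 120 * ((n + 2) * (2 * k + 200) + 2) *
      (2 ^ k * 2 ^ k * (n + 1) ^ 100 * (G + 1) * (3000 * (k + 1) ^ 4))"
proof -
  define I where "I = input n t k \<pi>"
  \<comment> \<open>By \<open>n + 2 \<le> 2 ^ (n + 2)\<close> the power \<open>2 ^ L\<close> is
    large enough for \<open>V\<close>. The estimate is crude, but the cost depends on
    \<open>len V = L + 2\<close>, which is polynomial in \<open>n\<close>.\<close>
  define L where "L = (n + 2) * (2 * k + 200)"
  define V :: nat where "V = 2 ^ L"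
  have lV: "len V = L + 2" by (simp add: V_def len_pow2)
  have I01: "I 0 = n" "I 1 = k" by (simp_all add: I_def input_def)
  have I_le: "I a \<le> n" for a
  proof -
    have "t (a - 1) \<le> n" if "a \<noteq> 0" "a \<noteq> 1" "a \<le> n + 1"
      using permutes_in_image[OF t, of "a - 1"] that by auto
    moreover have "\<pi> (a - (n + 1)) \<le> n" if "\<not> a \<le> n + 1" "a \<le> n + k + 1"
      using permutes_in_image[OF \<pi>, of "a - (n + 1)"] that kn by auto
    ultimately show ?thesis using kn by (auto simp: I_def input_def)
  qed
  have V: "(n + 2) ^ (2 * k + 200) \<le> V"
  proof -
    have "n + 2 \<le> 2 ^ (n + 2)" by (rule less_imp_le) (rule less_exp)
    then have "(n + 2) ^ (2 * k + 200) \<le> (2 ^ (n + 2)) ^ (2 * k + 200)" by (rule power_mono) simp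
    then show ?thesis by (simp only: V_def L_def power_mult)
  qed
  interpret ppm_input I n k V t \<pi>
    by unfold_locales (use I01 I_le kn V t \<pi> in \<open>auto simp: I_def\<close>)
  define base where "base = n + k + 2"
  interpret M: input_memory I base V
    by unfold_locales (use I01 in \<open>auto simp: I_def input_def base_def\<close>)
  let ?z = "\<lambda>_::nat. 0::nat"
  have mem: "M.mem ?z ?z = I"
  proof
    fix a show "M.mem ?z ?z a = I a"
      using M.I_beyond[of a] by (simp add: M.mem_def)
  qed
  define s where "s = 2 ^ k * 2 ^ k * (n + 1) ^ 100 * (G + 1) * (3000 * (k + 1) ^ 4)"
  have "0 < s" unfolding s_def by (intro mult_pos_pos zero_less_power) auto
  then have s: "1 \<le> s" by simp
  have "ev I V ?z tm_main mainv s"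
    using E_main[of ?z G] G by (simp only: s_def bd_def N_def w_def) simp
  moreover have "base + top_cell 0 tm_main \<le> V"
    unfolding base_def by (rule le_V_lin) (use kn in \<open>simp add: tm_main_def tm_good_def tm_part_def tm_leak_def tm_adj_def
      tm_check_def tm_bad_def tm_dom_def tm_txt_def tm_pat_def tm_pos_def tm_dig_def tm_rank_def
      tm_mem_def tm_pow_def tm_is1_def tm_dist_def tm_mod_def tm_less_def tm_le_def tm_not_def
      tm_n_def tm_k_def\<close>)
  ultimately have "M.computes 0 tm_main ?z mainv s" by (intro M.ev_computes) auto
  then obtain \<tau> where \<tau>: "\<tau> 0 = mainv" "run (compile 0 tm_main) I (100 * len V * s) (M.mem ?z \<tau>)"
    using M.computesE[of 0 tm_main ?z mainv s ?z] mem by metis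
  let ?m = "(M.mem ?z \<tau>)(0 := 1 - (1 - mainv))"
  have tmp0: "M.tmp_addr 0 \<le> V" 
    unfolding M.tmp_addr_def unfolding base_def by (rule le_V_lin) (use kn in simp)
  have mV: "mainv \<le> V" using ev_le[OF \<open>ev I V ?z tm_main mainv s\<close>] .
  have "expr_cost (Mem (tmp 0)) (M.mem ?z \<tau>) \<le> 8 * len V"
    by (rule M.cost_Mem_tmp[OF tmp0]) (use \<tau>(1) mV in simp)
  moreover have "len 0 \<le> len V" "len 1 \<le> len V" "len (1 - mainv) \<le> len V" "len (1 - (1 - mainv)) \<le> len V"
    by (auto intro!: M.len_le le_V_lin)
  ultimately have "run (Store (Const 0) (Sub (Const 1) (Sub (Const 1) (Mem (tmp 0))))) (M.mem ?z \<tau>)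
      (20 * len V) ?m"
    using \<tau>(1) len_pos[of V] by (intro run_Store) simp_all
  from run_Seq[OF \<tau>(2) this]
  obtain T where T: "T \<le> 100 * len V * s + 20 * len V" "exec algorithm I T ?m"
    unfolding run_def algorithm_def by blast
  have "20 * len V * 1 \<le> 20 * len V * s" using s by (intro mult_left_mono) auto
  then have "T \<le> 120 * len V * s" using T(1) by linarith
  then have "T \<le> 120 * ((n + 2) * (2 * k + 200) + 2) * s" by (simp only: lV L_def)
  moreover have "if contains_pattern n t k \<pi> then accepting ?m else rejecting ?m"
    using main_complete main_sound by (cases "mainv = 0") (auto simp: accepting_def rejecting_def)
  ultimately show ?thesis using T(2) unfolding I_def s_def by blast
qed

text \<open>Chosen so that \<open>real k powr growth k = 4 ^ k\<close> for \<open>k \<ge> 2\<close>.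
  For \<open>k = 1\<close> the denominator would be \<open>ln 1 = 0\<close>; the default value 0 is
  compensated by the factor 4 in \<open>pow4_le\<close>.\<close>

definition growth :: "nat \<Rightarrow> real" where
  "growth k = (if k \<ge> 2 then real k * ln 4 / ln (real k) else 0)"

lemma growth_smallo: "growth \<in> o(\<lambda>k. real k)"
proof -
  have "(\<lambda>k. real k * ln 4 / ln (real k)) \<in> o(\<lambda>k. real k)" by real_asymp
  moreover have ev: "eventually (\<lambda>k. growth k = real k * ln 4 / ln (real k)) at_top"
    using eventually_ge_at_top[of 2] by eventually_elim (simp add: growth_def)
  ultimately show ?thesis by (simp only: landau_o.small.in_cong[OF ev])
qed

lemma pow4_le: assumes "k \<le> n" "1 \<le> n" shows "4 ^ k \<le> 4 * real n powr growth k"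
proof (cases "k \<ge> 2")
  case True
  then have ln: "ln (real k) > 0" by simp
  have "(4::real) ^ k = exp (real k * ln 4)" by (simp add: exp_of_nat_mult)
  also have "\<dots> = real k powr growth k" using True ln by (simp add: powr_def growth_def)
  also have "\<dots> \<le> real n powr growth k"
    using assms True ln by (intro powr_mono2) (auto simp: growth_def)
  also have "\<dots> \<le> 4 * real n powr growth k" by simp
  finally show ?thesis .
next
  case False
  then have "k = 0 \<or> k = 1" by auto
  then show ?thesis using assms(2) by (auto simp: growth_def)
qed

text \<open>The 106 collects 2 from the length of \<open>V\<close>, 100 from the maps of a part and
  4 from the polynomial in \<open>k\<close>; \<open>growth k\<close> pays for the two factors
  \<open>2 ^ k\<close>. The numerical factors multiply to less than \<open>10 ^ 50\<close>.\<close>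

lemma time_bound:
  fixes n k G T :: nat
  assumes kn: "k \<le> n" and n: "1 \<le> n" and G: "G = nat \<lceil>real n powr (0.44 * real k)\<rceil> + 1"
    and T: "T \<le> 120 * ((n + 2) * (2 * k + 200) + 2) *
      (2 ^ k * 2 ^ k * (n + 1) ^ 100 * (G + 1) * (3000 * (k + 1) ^ 4))"
  shows "real T \<le> 10 ^ 50 * real n powr (0.44 * real k + (growth k + 106))"
proof -
  let ?x = "real n" and ?p = "real n powr (0.44 * real k)" and ?q = "real n powr growth k"
  have x: "1 \<le> ?x" using n by simp
  have p: "1 \<le> ?p" using x by (intro ge_one_powr_ge_zero) auto
  have "(n + 2) * (2 * k + 200) + 2 \<le> (3 * n) * (202 * n) + 2 * (n * n)"
    using kn n by (intro add_mono mult_mono) auto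
  then have 1: "real ((n + 2) * (2 * k + 200) + 2) \<le> 608 * ?x ^ 2"
    by (simp add: power2_eq_square flip: of_nat_le_iff[where 'a = real])
  have 2: "real (2 ^ k * 2 ^ k) \<le> 4 * ?q"
    using pow4_le[OF kn n] by (simp flip: power_mult_distrib)
  have "real ((n + 1) ^ 100) \<le> (2 * ?x) ^ 100" unfolding of_nat_power using x by (intro power_mono) auto
  then have 3: "real ((n + 1) ^ 100) \<le> 2 ^ 100 * ?x ^ 100" by (simp only: power_mult_distrib)
  have "real (nat \<lceil>?p\<rceil>) \<le> ?p + 1" using p by linarith
  then have 4: "real (G + 1) \<le> 4 * ?p" using p unfolding G of_nat_add of_nat_1 by linarith
  have "real ((k + 1) ^ 4) \<le> (2 * ?x) ^ 4" unfolding of_nat_power using kn n by (intro power_mono) auto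
  then have 5: "real (3000 * (k + 1) ^ 4) \<le> 48000 * ?x ^ 4" by (simp add: power_mult_distrib)
  have "real T \<le> real (120 * ((n + 2) * (2 * k + 200) + 2) *
      (2 ^ k * 2 ^ k * (n + 1) ^ 100 * (G + 1) * (3000 * (k + 1) ^ 4)))"
    using T by (simp only: of_nat_le_iff)
  also have "\<dots> = 120 * real ((n + 2) * (2 * k + 200) + 2) *
      (real (2 ^ k * 2 ^ k) * real ((n + 1) ^ 100) * real (G + 1) * real (3000 * (k + 1) ^ 4))"
    by (simp only: of_nat_mult of_nat_numeral)
  also have "\<dots> \<le> 120 * (608 * ?x ^ 2) * ((4 * ?q) * (2 ^ 100 * ?x ^ 100) * (4 * ?p) * (48000 * ?x ^ 4))"
    by (intro mult_mono mult_nonneg_nonneg order_refl 1 2 3 4 5) (auto intro: mult_nonneg_nonneg)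
  also have "\<dots> = (120 * 608 * 4 * 2 ^ 100 * 4 * 48000) * (?x ^ 106 * ?q * ?p)"
    by (simp add: power_add[symmetric] mult_ac)
  also have "\<dots> \<le> 10 ^ 50 * (?x ^ 106 * ?q * ?p)"
    by (intro mult_right_mono) auto
  also have "?x ^ 106 * ?q * ?p = ?x powr (0.44 * real k + (growth k + 106))"
    using n by (simp add: powr_add powr_numeral mult_ac)
  finally show ?thesis .
qed

text \<open>The time bound is claimed for \<open>n \<ge> 1\<close> since \<open>0 powr x\<close> is
  0, whereas every run takes positive time; the answer is correct for \<open>n = 0\<close>
  too.\<close>

theorem theorem1:
  "\<exists>(p :: prog) (f :: nat \<Rightarrow> real) (C :: real).
     f \<in> o(\<lambda>k. real k) \<and>
     (\<forall>n k t \<pi>. t permutes {1..n} \<longrightarrow> \<pi> permutes {1..k} \<longrightarrow> k \<le> n \<longrightarrow>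
        (\<exists>T m. exec p (input n t k \<pi>) T m \<and>
               (if contains_pattern n t k \<pi> then accepting m else rejecting m) \<and>
               (n \<ge> 1 \<longrightarrow> real T \<le> C * real n powr (0.44 * real k + f k))))"
proof (rule exI[of _ algorithm], rule exI[of _ "\<lambda>k. growth k + 106"], rule exI[of _ "10 ^ 50"],
    rule conjI, goal_cases)
  case 1
  have "(\<lambda>_. 106) \<in> o(\<lambda>k. real k)" by real_asymp
  then show ?case by (rule sum_in_smallo(1)[OF growth_smallo])
next
  case 2
  show ?case
  proof (intro allI impI)
    fix n k and t \<pi> :: "nat \<Rightarrow> nat"
    assume t: "t permutes {1..n}" and \<pi>: "\<pi> permutes {1..k}" and kn: "k \<le> n"
    define G where "G = nat \<lceil>real n powr (0.44 * real k)\<rceil> + 1"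
    have "n ^ r \<le> G" if r: "100 * r \<le> 44 * k" for r
    proof (cases "n = 0")
      \<comment> \<open>Here \<open>real n powr (0.44 * real k)\<close> is 0 but
        \<open>n ^ 0\<close> is 1, so the summand 1 in \<open>G\<close> matters.\<close>
      case True
      then have "r = 0" using r kn by simp
      then show ?thesis by (simp add: G_def)
    next
      case False
      have "real (100 * r) \<le> real (44 * k)" using r by (simp only: of_nat_le_iff)
      then have "real r \<le> 0.44 * real k" by simp
      then have "real n powr real r \<le> real n powr (0.44 * real k)" using False by (intro powr_mono) auto
      then have "real (n ^ r) \<le> real n powr (0.44 * real k)" using False by (simp add: powr_realpow)
      then show ?thesis unfolding G_def by linarith
    qed
    from algorithm_correct[OF t \<pi> kn this]
    obtain T m where "exec algorithm (input n t k \<pi>) T m"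
      "if contains_pattern n t k \<pi> then accepting m else rejecting m"
      "T \<le> 120 * ((n + 2) * (2 * k + 200) + 2) *
        (2 ^ k * 2 ^ k * (n + 1) ^ 100 * (G + 1) * (3000 * (k + 1) ^ 4))" by blast
    then show "\<exists>T m. exec algorithm (input n t k \<pi>) T m \<and>
                 (if contains_pattern n t k \<pi> then accepting m else rejecting m) \<and>
                 (n \<ge> 1 \<longrightarrow> real T \<le> 10 ^ 50 * real n powr (0.44 * real k + (growth k + 106)))"
      using time_bound[OF kn _ G_def] by blast
  qed
qed

end
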